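(* Let $\Gamma$ be a Brauer tree of type $(m,e)$ and let $A_\Gamma$ be the basic Brauer tree algebra of $\Gamma$ with the grading constructed by taking Green's walk around $\Gamma$. If $C_{A_\Gamma}$ is the graded Cartan matrix of $A_\Gamma$, then $$\det C_{A_\Gamma}=1+q^e+q^{2e}+\dots+q^{me^2}.$$
   Context: $k$ is an algebraically closed field of positive characteristic; modules are left modules. A Brauer tree $\Gamma$ of type $(m,e)$ is a finite connected planar tree with $e\ge 1$ edges, a distinguished exceptional vertex with multiplicity $m\ge1$, and at each vertex the counter-clockwise cyclic ordering of the adjacent edges. The basic Brauer tree algebra $A_\Gamma=kQ/I$: the vertices of $Q$ are the edges of $\Gamma$. For each vertex $u$ of $\Gamma$ with $r\ge2$ adjacent edges $j_1,\dots,j_r$ in cyclic order there are $r$ arrows $j_{s+1}\to j_s$ ($s$ modulo $r$), forming a cycle of $Q$; if the exceptional vertex has only one adjacent edge and $m>1$ (or $e=1$) there is a loop at that edge. The cycle (or loop) coming from the exceptional vertex is the exceptional cycle. Paths are multiplied left to right. If all edges are adjacent to the exceptional vertex (the star), $I$ is generated by all paths of length $me+1$. Otherwise $I$ is generated by: $ab$ for consecutive arrows $a,b$ in different cycles; $\alpha-\beta$ for two non-exceptional cycles $\alpha,\beta$ (full turns) based at the same vertex; $\alpha^m-\beta$ if $\alpha$ is the exceptional and $\beta$ a non-exceptional cycle based at the same vertex; paths of length $r+1$ along a non-exceptional cycle of length $r$ and paths of length $mr+1$ along the exceptional cycle of length $r$. The projective cover $P_{S_j}$ of $S_j$ is spanned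 by the paths ending at $S_j$. Green's walk numbering: start at the exceptional vertex with an arbitrary adjacent edge and walk around $\Gamma$ counter-clockwise, numbering the edges $S_1,\dots,S_e$ in order of first visit (depth-first; on arriving at a vertex along an edge, the remaining edges there are visited in counter-clockwise order starting after the incoming edge; at the exceptional vertex, in counter-clockwise order from the starting edge). The grading constructed by taking Green's walk: an arrow $S_i\to S_j$ of the exceptional cycle has degree $i-j$ if $i>j$, $e-(j-i)$ if $i<j$, and $e$ if it is a loop; an arrow of a non-exceptional cycle, coming from a vertex $u$ of $\Gamma$, has degree $me$ if its source is the edge at $u$ closest to the exceptional vertex, and degree $0$ otherwise. The graded Cartan matrix is the $e\times e$ matrix over $\mathbb Z[q,q^{-1}]$ with $c_{ij}=\sum_{l\in\mathbb Z}q^l\dim\mathrm{Hom}(P_{S_i},P_{S_j}\langle l\rangle)$, where $\mathrm{Hom}$ denotes degree-preserving homomorphisms, $M\langle l\rangle_n=M_{l+n}$, and each $P_{S_i}$ is graded with top in degree $0$; equivalently, the coefficient of $q^l$ is the multiplicity of $S_i$ in degree $l$ as a composition factor of $P_{S_j}$. *)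

theory Defs
  imports
    "HOL-Library.Poly_Mapping"
    "HOL-Combinatorics.Orbits"
    "HOL-Algebra.QuotRing"
    "Graph_Theory.Arc_Walk"
    "Jordan_Normal_Form.VS_Connect"
begin

section \<open>Brauer trees\<close>

definition tree :: "'v set \<Rightarrow> 'v set set \<Rightarrow> bool" where
  "tree V E \<longleftrightarrow>
     finite V \<and> V \<noteq> {} \<and>
     E \<subseteq> {{x, y} | x y. x \<in> V \<and> y \<in> V \<and> x \<noteq> y} \<and>
     (\<forall>x\<in>V. \<forall>y\<in>V. (x, y) \<in> {(a, b). {a, b} \<in> E}\<^sup>*) \<and>
     \<not> (\<exists>vs. 3 \<le> length vs \<and> distinct vs \<and>
            successively (\<lambda>a b. {a, b} \<in> E) vs \<and> {last vs, hd vs} \<in> E)"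

text \<open>
  The plane embedding is recorded by its rotation system: \<open>bt_ccw \<Gamma> u j\<close> is the edge following
  \<open>j\<close> counter-clockwise around \<open>u\<close>.  Every rotation system on a tree comes from a plane embedding.
\<close>

record 'v brauer_tree =
  bt_verts :: "'v set"
  bt_edges :: "'v set set"
  bt_exc :: 'v
  bt_mult :: nat
  bt_ccw :: "'v \<Rightarrow> 'v set \<Rightarrow> 'v set"

definition edges_at :: "'v brauer_tree \<Rightarrow> 'v \<Rightarrow> 'v set set" where
  "edges_at \<Gamma> u = {j \<in> bt_edges \<Gamma>. u \<in> j}"

definition is_brauer_tree :: "'v brauer_tree \<Rightarrow> nat \<Rightarrow> nat \<Rightarrow> bool" where
  "is_brauer_tree \<Gamma> m e \<longleftrightarrow>
     tree (bt_verts \<Gamma>) (bt_edges \<Gamma>) \<and>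
     card (bt_edges \<Gamma>) = e \<and> e \<ge> 1 \<and>
     bt_exc \<Gamma> \<in> bt_verts \<Gamma> \<and>
     bt_mult \<Gamma> = m \<and> m \<ge> 1 \<and>
     (\<forall>u\<in>bt_verts \<Gamma>. cyclic_on (bt_ccw \<Gamma> u) (edges_at \<Gamma> u))"

definition bt_cw :: "'v brauer_tree \<Rightarrow> 'v \<Rightarrow> 'v set \<Rightarrow> 'v set" where
  "bt_cw \<Gamma> u = inv_into (edges_at \<Gamma> u) (bt_ccw \<Gamma> u)"

section \<open>The quiver and the path algebra\<close>

definition has_cycle :: "'v brauer_tree \<Rightarrow> 'v \<Rightarrow> bool" where
  "has_cycle \<Gamma> u \<longleftrightarrow> u \<in> bt_verts \<Gamma> \<and>
     (card (edges_at \<Gamma> u) \<ge> 2 \<or>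
      u = bt_exc \<Gamma> \<and> card (edges_at \<Gamma> u) = 1 \<and> (bt_mult \<Gamma> > 1 \<or> card (bt_edges \<Gamma>) = 1))"

text \<open>
  The arrow \<open>(u, j)\<close> belongs to the cycle coming from \<open>u\<close> and goes from \<open>j\<close> to the edge preceding
  \<open>j\<close> in the counter-clockwise order at \<open>u\<close>; if \<open>j\<close> is the only edge at \<open>u\<close>, it is a loop.
\<close>

type_synonym 'v arrow = "'v \<times> 'v set"

definition bt_quiver :: "'v brauer_tree \<Rightarrow> ('v set, 'v arrow) pre_digraph" where
  "bt_quiver \<Gamma> =
     \<lparr>verts = bt_edges \<Gamma>,
      arcs = {(u, j). has_cycle \<Gamma> u \<and> j \<in> edges_at \<Gamma> u},
      tail = (\<lambda>(u, j). j),
      head = (\<lambda>(u, j). bt_cw \<Gamma> u j)\<rparr>"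

text \<open>A path is stored as (source, list of arrows, target), the arrows in the order of traversal.\<close>

type_synonym ('a, 'b) qpath = "'a \<times> 'b list \<times> 'a"

definition qpaths :: "('a, 'b) pre_digraph \<Rightarrow> ('a, 'b) qpath set" where
  "qpaths Q = {(i, p, j). pre_digraph.awalk Q i p j}"

definition path_mult ::
    "(('a, 'b) qpath \<Rightarrow>\<^sub>0 'k::field) \<Rightarrow> (('a, 'b) qpath \<Rightarrow>\<^sub>0 'k) \<Rightarrow> (('a, 'b) qpath \<Rightarrow>\<^sub>0 'k)" where
  "path_mult f g =
     (\<Sum>(i, p, j)\<in>Poly_Mapping.keys f. \<Sum>(i', p', j')\<in>Poly_Mapping.keys g.
        if j = i'
        then Poly_Mapping.single (i, p @ p', j')
               (Poly_Mapping.lookup f (i, p, j) * Poly_Mapping.lookup g (i', p', j'))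
        else 0)"

definition path_scalar :: "('a, 'b) pre_digraph \<Rightarrow> 'k::field \<Rightarrow> (('a, 'b) qpath \<Rightarrow>\<^sub>0 'k)" where
  "path_scalar Q c = (\<Sum>i\<in>verts Q. Poly_Mapping.single (i, [], i) c)"

definition path_algebra :: "('a, 'b) pre_digraph \<Rightarrow> (('a, 'b) qpath \<Rightarrow>\<^sub>0 'k::field) ring" where
  "path_algebra Q =
     \<lparr>carrier = {f. Poly_Mapping.keys f \<subseteq> qpaths Q},
      mult = path_mult, one = path_scalar Q 1, zero = 0, add = (+)\<rparr>"

section \<open>The basic Brauer tree algebra\<close>

definition turn :: "'v brauer_tree \<Rightarrow> 'v \<Rightarrow> 'v set \<Rightarrow> nat \<Rightarrow> ('v set, 'v arrow) qpath" where
  "turn \<Gamma> u j n = (j, map (\<lambda>i. (u, (bt_cw \<Gamma> u ^^ i) j)) [0..<n], (bt_cw \<Gamma> u ^^ n) j)"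

abbreviation path_elem :: "('a, 'b) qpath \<Rightarrow> (('a, 'b) qpath \<Rightarrow>\<^sub>0 'k::field)" where
  "path_elem p \<equiv> Poly_Mapping.single p 1"

definition brauer_relations ::
    "'v brauer_tree \<Rightarrow> (('v set, 'v arrow) qpath \<Rightarrow>\<^sub>0 'k::field) set" where
  "brauer_relations \<Gamma> =
     (let m = bt_mult \<Gamma>; e = card (bt_edges \<Gamma>); x = bt_exc \<Gamma>; r = (\<lambda>u. card (edges_at \<Gamma> u))
      in if \<forall>j\<in>bt_edges \<Gamma>. x \<in> j
         then {path_elem (i, p, j) | i p j. (i, p, j) \<in> qpaths (bt_quiver \<Gamma>) \<and> length p = m * e + 1}
         else
           {path_elem (i, [a, b], j) | i a b j.
              (i, [a, b], j) \<in> qpaths (bt_quiver \<Gamma>) \<and> fst a \<noteq> fst b} \<union>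
           {path_elem (turn \<Gamma> u j (r u)) - path_elem (turn \<Gamma> v j (r v)) | u v j.
              has_cycle \<Gamma> u \<and> has_cycle \<Gamma> v \<and> u \<noteq> x \<and> v \<noteq> x \<and> u \<noteq> v \<and>
              j \<in> edges_at \<Gamma> u \<inter> edges_at \<Gamma> v} \<union>
           {path_elem (turn \<Gamma> x j (m * r x)) - path_elem (turn \<Gamma> v j (r v)) | v j.
              has_cycle \<Gamma> x \<and> has_cycle \<Gamma> v \<and> v \<noteq> x \<and>
              j \<in> edges_at \<Gamma> x \<inter> edges_at \<Gamma> v} \<union>
           {path_elem (turn \<Gamma> u j (r u + 1)) | u j.
              has_cycle \<Gamma> u \<and> u \<noteq> x \<and> j \<in> edges_at \<Gamma> u} \<union>
           {path_elem (turn \<Gamma> x j (m * r x + 1)) | j.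
              has_cycle \<Gamma> x \<and> j \<in> edges_at \<Gamma> x})"

definition brauer_ideal ::
    "'v brauer_tree \<Rightarrow> (('v set, 'v arrow) qpath \<Rightarrow>\<^sub>0 'k::field) set" where
  "brauer_ideal \<Gamma> = genideal (path_algebra (bt_quiver \<Gamma>)) (brauer_relations \<Gamma>)"

definition brauer_algebra ::
    "'v brauer_tree \<Rightarrow> (('v set, 'v arrow) qpath \<Rightarrow>\<^sub>0 'k::field) set ring" where
  "brauer_algebra \<Gamma> = path_algebra (bt_quiver \<Gamma>) Quot brauer_ideal \<Gamma>"

definition brauer_proj ::
    "'v brauer_tree \<Rightarrow> (('v set, 'v arrow) qpath \<Rightarrow>\<^sub>0 'k::field) \<Rightarrow>
     (('v set, 'v arrow) qpath \<Rightarrow>\<^sub>0 'k) set" where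
  "brauer_proj \<Gamma> f = brauer_ideal \<Gamma> +>\<^bsub>path_algebra (bt_quiver \<Gamma>)\<^esub> f"

definition brauer_scalar ::
    "'v brauer_tree \<Rightarrow> 'k::field \<Rightarrow> (('v set, 'v arrow) qpath \<Rightarrow>\<^sub>0 'k) set" where
  "brauer_scalar \<Gamma> c = brauer_proj \<Gamma> (path_scalar (bt_quiver \<Gamma>) c)"

section \<open>Green's walk and the grading\<close>

definition other_end :: "'v \<Rightarrow> 'v set \<Rightarrow> 'v" where
  "other_end u j = (THE v. j = {u, v})"

text \<open>
  In step \<open>n\<close> of the walk starting with the edge \<open>s\<close>, if \<open>green_walk \<Gamma> s n = (u, j)\<close>, the edge \<open>j\<close>
  is traversed from its endpoint \<open>u\<close> to the other one.  The walk turns back at leaves, where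
  \<open>bt_ccw\<close> fixes the only edge.
\<close>

primrec green_walk :: "'v brauer_tree \<Rightarrow> 'v set \<Rightarrow> nat \<Rightarrow> 'v \<times> 'v set" where
  "green_walk \<Gamma> s 0 = (bt_exc \<Gamma>, s)"
| "green_walk \<Gamma> s (Suc n) =
     (let (u, j) = green_walk \<Gamma> s n; v = other_end u j in (v, bt_ccw \<Gamma> v j))"

definition first_visit :: "'v brauer_tree \<Rightarrow> 'v set \<Rightarrow> 'v set \<Rightarrow> nat" where
  "first_visit \<Gamma> s j = (LEAST n. snd (green_walk \<Gamma> s n) = j)"

definition green_number :: "'v brauer_tree \<Rightarrow> 'v set \<Rightarrow> 'v set \<Rightarrow> nat" where
  "green_number \<Gamma> s j = card {i \<in> bt_edges \<Gamma>. first_visit \<Gamma> s i \<le> first_visit \<Gamma> s j}"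

definition green_edge :: "'v brauer_tree \<Rightarrow> 'v set \<Rightarrow> nat \<Rightarrow> 'v set" where
  "green_edge \<Gamma> s i = (THE j. j \<in> bt_edges \<Gamma> \<and> green_number \<Gamma> s j = i)"

definition exc_dist :: "'v brauer_tree \<Rightarrow> 'v \<Rightarrow> nat" where
  "exc_dist \<Gamma> u = (LEAST n. (bt_exc \<Gamma>, u) \<in> {(a, b). {a, b} \<in> bt_edges \<Gamma>} ^^ n)"

definition closest_edge :: "'v brauer_tree \<Rightarrow> 'v \<Rightarrow> 'v set \<Rightarrow> bool" where
  "closest_edge \<Gamma> u = is_arg_min (\<lambda>j. Min (exc_dist \<Gamma> ` j)) (\<lambda>j. j \<in> edges_at \<Gamma> u)"

definition arrow_degree :: "'v brauer_tree \<Rightarrow> 'v set \<Rightarrow> 'v arrow \<Rightarrow> int" where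
  "arrow_degree \<Gamma> s a =
     (let u = fst a;
          i = int (green_number \<Gamma> s (tail (bt_quiver \<Gamma>) a));
          j = int (green_number \<Gamma> s (head (bt_quiver \<Gamma>) a));
          m = int (bt_mult \<Gamma>); e = int (card (bt_edges \<Gamma>))
      in if u = bt_exc \<Gamma>
         then (if i > j then i - j else if i < j then e - (j - i) else e)
         else (if closest_edge \<Gamma> u (tail (bt_quiver \<Gamma>) a) then m * e else 0))"

definition path_degree :: "'v brauer_tree \<Rightarrow> 'v set \<Rightarrow> ('v set, 'v arrow) qpath \<Rightarrow> int" where
  "path_degree \<Gamma> s = (\<lambda>(i, p, j). sum_list (map (arrow_degree \<Gamma> s) p))"

definition brauer_grading ::
    "'v brauer_tree \<Rightarrow> 'v set \<Rightarrow> int \<Rightarrow> (('v set, 'v arrow) qpath \<Rightarrow>\<^sub>0 'k::field) set set" where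
  "brauer_grading \<Gamma> s n =
     brauer_proj \<Gamma> ` {f. Poly_Mapping.keys f \<subseteq> {p \<in> qpaths (bt_quiver \<Gamma>). path_degree \<Gamma> s p = n}}"

section \<open>Graded modules and the graded Cartan matrix\<close>

text \<open>
  Only graded left ideals \<open>M\<close> of an algebra \<open>A\<close> and their shifts are needed as graded modules.  They
  are given by the carrier together with the family of homogeneous components.
\<close>

type_synonym 'a graded = "'a set \<times> (int \<Rightarrow> 'a set)"

definition shift :: "'a graded \<Rightarrow> int \<Rightarrow> 'a graded" where
  "shift M l = (fst M, \<lambda>n. snd M (l + n))"

definition graded_hom :: "('a, 'r) ring_scheme \<Rightarrow> 'a graded \<Rightarrow> 'a graded \<Rightarrow> ('a \<Rightarrow> 'a) set" where
  "graded_hom A M N =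
     {f \<in> fst M \<rightarrow>\<^sub>E fst N.
        (\<forall>x\<in>fst M. \<forall>y\<in>fst M. f (x \<oplus>\<^bsub>A\<^esub> y) = f x \<oplus>\<^bsub>A\<^esub> f y) \<and>
        (\<forall>a\<in>carrier A. \<forall>x\<in>fst M. f (a \<otimes>\<^bsub>A\<^esub> x) = a \<otimes>\<^bsub>A\<^esub> f x) \<and>
        (\<forall>n. f ` snd M n \<subseteq> snd N n)}"

text \<open>The scalar \<open>c\<close> acts on \<open>A\<close> as left multiplication by \<open>\<iota> c\<close>; the fields \<open>mult\<close> and \<open>one\<close> are unused.\<close>

definition hom_space ::
    "('a, 'r) ring_scheme \<Rightarrow> ('k \<Rightarrow> 'a) \<Rightarrow> 'a graded \<Rightarrow> 'a graded \<Rightarrow> ('k, 'a \<Rightarrow> 'a) module" where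
  "hom_space A \<iota> M N =
     \<lparr>carrier = graded_hom A M N,
      mult = undefined, one = undefined,
      zero = (\<lambda>x\<in>fst M. \<zero>\<^bsub>A\<^esub>),
      add = (\<lambda>f g. \<lambda>x\<in>fst M. f x \<oplus>\<^bsub>A\<^esub> g x),
      smult = (\<lambda>c f. \<lambda>x\<in>fst M. \<iota> c \<otimes>\<^bsub>A\<^esub> f x)\<rparr>"

definition proj_module ::
    "'v brauer_tree \<Rightarrow> 'v set \<Rightarrow> 'v set \<Rightarrow> (('v set, 'v arrow) qpath \<Rightarrow>\<^sub>0 'k::field) set graded" where
  "proj_module \<Gamma> s j =
     (let P = (\<lambda>a. a \<otimes>\<^bsub>brauer_algebra \<Gamma>\<^esub> brauer_proj \<Gamma> (path_elem (j, [], j)))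
                ` carrier (brauer_algebra \<Gamma>)
      in (P, \<lambda>n. P \<inter> brauer_grading \<Gamma> s n))"

definition graded_hom_dim ::
    "'k::field itself \<Rightarrow> 'v brauer_tree \<Rightarrow> 'v set \<Rightarrow> 'v set \<Rightarrow> 'v set \<Rightarrow> int \<Rightarrow> nat" where
  "graded_hom_dim k \<Gamma> s i j l =
     vectorspace.dim (class_ring :: 'k ring)
       (hom_space (brauer_algebra \<Gamma>) (brauer_scalar \<Gamma>)
          (proj_module \<Gamma> s i) (shift (proj_module \<Gamma> s j) l))"

text \<open>
  The ring of Laurent polynomials over the integers is the group ring \<open>int \<Rightarrow>\<^sub>0 int\<close>.  Matrix
  indices start at 0, whereas the numbering of the simple modules starts at 1.
\<close>

type_synonym laurent = "int \<Rightarrow>\<^sub>0 int"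

definition laurent_q :: laurent where
  "laurent_q = Poly_Mapping.single 1 1"

definition graded_cartan :: "'k::field itself \<Rightarrow> 'v brauer_tree \<Rightarrow> 'v set \<Rightarrow> laurent mat" where
  "graded_cartan k \<Gamma> s =
     (let e = card (bt_edges \<Gamma>)
      in mat e e (\<lambda>(i, j).
           Sum_any (\<lambda>l. Poly_Mapping.single l (int
             (graded_hom_dim k \<Gamma> s (green_edge \<Gamma> s (i + 1)) (green_edge \<Gamma> s (j + 1)) l)))))"

end

theory Submission
  imports Defs
begin

text \<open>
  Modulo the relations, a path is zero unless it stays on the cycle of one vertex \<open>u\<close> and has at most
  the length \<open>M u\<close> of a maximal nonzero path there, and the only further identifications are between
  the full turns of both ends of an edge; that the remaining paths are linearly independent is seen
  by evaluating the functions on paths which respect these identifications.  Hence the entry of the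
  Cartan matrix at the edges \<open>i\<close>, \<open>j\<close> is the sum of \<open>q\<close> to the degree over the nonzero paths from
  \<open>i\<close> to \<open>j\<close>.  Green's walk first traverses an edge away from the exceptional vertex, so the numbers
  decrease along each cycle except at the arrow leaving the first edge at the vertex.  After
  conjugating the contribution of the exceptional vertex by powers of \<open>q\<close>, an off-diagonal entry at
  two edges meeting in \<open>u\<close> becomes \<open>h u\<close> or \<open>h u + b\<close>, according to the order of the two edges, and
  a diagonal entry at \<open>{u, v}\<close> becomes \<open>h u + h v + b\<close>, where \<open>b = q\<^sup>m\<^sup>e - 1\<close>.  Adding leaf edges one
  at a time shows that \<open>b\<close> times the determinant of such a matrix is
  \<open>(\<Prod>u. h u + b) - (\<Prod>u. h u)\<close>.
\<close>

section \<open>A determinant attached to a tree\<close>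

text \<open>The determinant formula carries the factor \<open>b\<close> on the left because no
  division is available in the ring; \<open>b\<close> is cancelled only at the very end, where m e >
  0 makes it nonzero. A leaf edge interacts only with the edges at its old end, so removing it
  changes a single factor of each product. This is why the shape of the tree leaves no trace and
  only the values of h at the vertices matter.

  At a vertex other than the exceptional one, h = 1 and h + b = q^(me). At the exceptional vertex h
  = 1 + q^e + ... + q^(e(m-1)), hence (q^e - 1) h = b and h + b = q^e h. With e vertices of the
  first kind, the difference of the two products is h (q^(e + m e^2) - 1), and dividing by b = (q^e
  - 1) h leaves the geometric sum of the theorem.

  For the algebra, the delicate point is that the ideal of relations is not too large. No normal
  forms of paths are computed: the elements killed by all admissible functions on paths form a
  two-sided ideal containing the relations, because prolonging the argument by a path preserves
  admissibility.\<close>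

lemma det_bordered:
  fixes A :: "'a::idom mat" and v w :: "nat \<Rightarrow> 'a" and \<beta> \<gamma> \<delta> :: 'a
  assumes A: "A \<in> carrier_mat n n"
  shows "Determinant.det (mat (Suc n) (Suc n) (\<lambda>(i, j).
           if i < n then if j < n then A $$ (i, j) else \<beta> * v i
           else if j < n then \<gamma> * w j else \<delta>))
       = (\<delta> - \<beta> * \<gamma>) * Determinant.det A
         + \<beta> * \<gamma> * Determinant.det (A - mat n n (\<lambda>(i, j). v i * w j))"
proof -
  define X where "X \<equiv> \<lambda>d. mat (Suc n) (Suc n) (\<lambda>(i, j).
           if i < n then if j < n then A $$ (i, j) else \<beta> * v i
           else if j < n then \<gamma> * w j else d)"
  have Xc: "X d \<in> carrier_mat (Suc n) (Suc n)" for d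
    by (simp add: X_def)
  have del: "mat_delete (X d) n n = A" for d
    using A by (intro eq_matI) (auto simp: mat_delete_def X_def)
  have cof: "cofactor (X d) n j = cofactor (X d') n j" for d d' j
  proof -
    have "mat_delete (X d) n j = mat_delete (X d') n j"
      by (intro eq_matI) (auto simp: mat_delete_def X_def)
    then show ?thesis by (simp add: cofactor_def)
  qed
  \<comment> \<open>The determinant is affine in the corner entry with slope det A, so one
    convenient corner suffices. For the corner \<beta>\<gamma> the matrix is a product of two block
    triangular ones; no inverse of A is needed as in a Schur complement.\<close>
  have lin: "Determinant.det (X d)
      = Determinant.det (X (\<beta> * \<gamma>)) + (d - \<beta> * \<gamma>) * Determinant.det A" for d
  proof -
    have exp: "Determinant.det (X t) = (\<Sum>j<n. \<gamma> * w j * cofactor (X 0) n j) + t * Determinant.det A" for t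
    proof -
      have "Determinant.det (X t) = (\<Sum>j<Suc n. X t $$ (n, j) * cofactor (X t) n j)"
        by (rule laplace_expansion_row[OF Xc]) simp
      also have "\<dots> = (\<Sum>j<n. \<gamma> * w j * cofactor (X 0) n j) + t * cofactor (X t) n n"
        by (auto simp: X_def intro!: sum.cong) (metis X_def cof)
      also have "cofactor (X t) n n = Determinant.det A"
        by (simp add: cofactor_def del)
      finally show ?thesis .
    qed
    show ?thesis by (simp add: exp algebra_simps)
  qed
  let ?B = "A - mat n n (\<lambda>(i, j). v i * w j)"
  let ?v = "mat n 1 (\<lambda>(i, j). v i)" and ?w = "mat 1 n (\<lambda>(i, j). w j)"
  let ?c = "\<lambda>x. mat 1 1 (\<lambda>_. x)"
  have dets: "Determinant.det (?c x) = x" for x :: 'a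
    by (subst det_single) auto
  note dets = dets[unfolded One_nat_def] dets
  have vw: "?v * ?w = mat n n (\<lambda>(i, j). v i * w j)"
    by (intro eq_matI) (auto simp: scalar_prod_def)
  have B: "?B \<in> carrier_mat n n" by (simp add: minus_carrier_mat)
  have "X (\<beta> * \<gamma>) = four_block_mat (1\<^sub>m n) ?v (0\<^sub>m 1 n) (?c \<gamma>) * four_block_mat ?B (0\<^sub>m n 1) ?w (?c \<beta>)"
  proof -
    have "four_block_mat (1\<^sub>m n) ?v (0\<^sub>m 1 n) (?c \<gamma>) * four_block_mat ?B (0\<^sub>m n 1) ?w (?c \<beta>)
      = four_block_mat (1\<^sub>m n * ?B + ?v * ?w) (1\<^sub>m n * 0\<^sub>m n 1 + ?v * ?c \<beta>)
          (0\<^sub>m 1 n * ?B + ?c \<gamma> * ?w) (0\<^sub>m 1 n * 0\<^sub>m n 1 + ?c \<gamma> * ?c \<beta>)"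
      by (rule mult_four_block_mat) (use A in auto)
    also have "\<dots> = X (\<beta> * \<gamma>)"
      unfolding vw using A
      by (intro eq_matI) (auto simp: X_def scalar_prod_def ac_simps)
    finally show ?thesis by simp
  qed
  then have "Determinant.det (X (\<beta> * \<gamma>)) =
      Determinant.det (four_block_mat (1\<^sub>m n) ?v (0\<^sub>m 1 n) (?c \<gamma>)) *
      Determinant.det (four_block_mat ?B (0\<^sub>m n 1) ?w (?c \<beta>))"
    using det_mult[of "four_block_mat (1\<^sub>m n) ?v (0\<^sub>m 1 n) (?c \<gamma>)" "n + 1"
        "four_block_mat ?B (0\<^sub>m n 1) ?w (?c \<beta>)"] B
    by (metis four_block_carrier_mat mat_carrier one_carrier_mat)
  also have "Determinant.det (four_block_mat (1\<^sub>m n) ?v (0\<^sub>m 1 n) (?c \<gamma>)) = \<gamma>"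
    by (subst det_four_block_mat_lower_left_zero) (auto simp: dets)
  also have "Determinant.det (four_block_mat ?B (0\<^sub>m n 1) ?w (?c \<beta>)) = Determinant.det ?B * \<beta>"
    by (subst det_four_block_mat_upper_right_zero[OF B]) (auto simp: dets)
  finally show ?thesis
    using lin[of \<delta>] by (simp add: X_def algebra_simps)
qed

text \<open>The weights \<open>w\<close>, \<open>w'\<close>, inverse to each other below, conjugate the contribution of a vertex; the
  powers of \<open>q\<close> coming from the numbers of the edges at the exceptional vertex are of this kind.\<close>

definition tree_matrix ::
    "(nat \<Rightarrow> 'v set) \<Rightarrow> ('v \<Rightarrow> nat \<Rightarrow> 'a) \<Rightarrow> ('v \<Rightarrow> nat \<Rightarrow> 'a) \<Rightarrow> 'a \<Rightarrow> ('v \<Rightarrow> 'a) \<Rightarrow> nat \<Rightarrow> 'a::comm_ring_1 mat" where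
  "tree_matrix E w w' b h n = mat n n (\<lambda>(i, j).
     (\<Sum>z\<in>E i \<inter> E j. w z i * w' z j * (h z + (if i < j then b else 0))) + (if i = j then b else 0))"

text \<open>The last edge is a leaf edge and borders the matrix of the other edges; in \<open>det_bordered\<close> the
  rank-one perturbation of the latter amounts to lowering \<open>h\<close> by one at the old end of the leaf edge.\<close>

lemma det_tree_matrix:
  fixes E :: "nat \<Rightarrow> 'v set" and w w' :: "'v \<Rightarrow> nat \<Rightarrow> 'a::idom" and h :: "'v \<Rightarrow> 'a"
  assumes "\<And>k. k < n \<Longrightarrow> E k = {u k, v k}"
    and "\<And>k. k < n \<Longrightarrow> u k \<in> insert x (\<Union>i<k. E i)"
    and "\<And>k. k < n \<Longrightarrow> v k \<notin> insert x (\<Union>i<k. E i)"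
    and "\<And>k z. k < n \<Longrightarrow> z \<in> E k \<Longrightarrow> w z k * w' z k = 1"
  shows "b * Determinant.det (tree_matrix E w w' b h n)
    = (\<Prod>z\<in>insert x (\<Union>i<n. E i). h z + b) - (\<Prod>z\<in>insert x (\<Union>i<n. E i). h z)"
  \<comment> \<open>The induction must allow every h, since the hypothesis is applied both to h and
    to h lowered at one vertex.\<close>
  using assms
proof (induction n arbitrary: h)
  case 0
  then show ?case by (simp add: tree_matrix_def det_dim_zero)
next
  case (Suc n)
  define V where "V = insert x (\<Union>i<n. E i)"
  let ?u = "u n" and ?v = "v n"
  have En: "E n = {?u, ?v}" and u: "?u \<in> V" and v: "?v \<notin> V"
    using Suc.prems(1-3)[of n] by (auto simp: V_def)
  have "finite (E i)" if "i < n" for i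
    using Suc.prems(1)[of i] that by simp
  then have fin: "finite V" by (simp add: V_def)
  have V': "insert x (\<Union>i<Suc n. E i) = insert ?v V"
    using u En by (auto simp: V_def lessThan_Suc)
  have IH: "b * Determinant.det (tree_matrix E w w' b h n) = (\<Prod>z\<in>V. h z + b) - (\<Prod>z\<in>V. h z)" for h
    unfolding V_def by (rule Suc.IH) (use Suc.prems in auto)
  define W where "W i = (if ?u \<in> E i then w ?u i else 0)" for i
  define W' where "W' i = (if ?u \<in> E i then w' ?u i else 0)" for i
  have vE: "?v \<notin> E i" if "i < n" for i
    using v that by (auto simp: V_def)
  have sum1: "(\<Sum>z\<in>E i \<inter> E n. f z) = (if ?u \<in> E i then f ?u else 0)" if "i < n" for i and f :: "'v \<Rightarrow> 'a"
  proof -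
    have "E i \<inter> E n = (if ?u \<in> E i then {?u} else {})" using vE[OF that] En by auto
    then show ?thesis by simp
  qed
  have uv: "?u \<noteq> ?v" using u v by auto
  have wn: "w ?u n * w' ?u n = 1" "w ?v n * w' ?v n = 1"
    using Suc.prems(4)[of n] En by auto
  let ?\<beta> = "w' ?u n * (h ?u + b)" and ?\<gamma> = "w ?u n * h ?u"
  let ?A = "tree_matrix E w w' b h n"
  have \<beta>\<gamma>: "?\<beta> * ?\<gamma> = (h ?u + b) * h ?u" 
    by (metis (no_types, lifting) wn(1) mult.assoc mult.commute mult.right_neutral)
  have "tree_matrix E w w' b h (Suc n) = mat (Suc n) (Suc n) (\<lambda>(i, j).
           if i < n then if j < n then ?A $$ (i, j) else ?\<beta> * W i
           else if j < n then ?\<gamma> * W' j else h ?u + h ?v + b)"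
  proof (rule eq_matI, goal_cases)
    case (1 i j)
    then have ij: "i < Suc n" "j < Suc n" by simp_all
    consider "i < n" "j < n" | "i < n" "j = n" | "i = n" "j < n" | "i = n" "j = n" using ij by linarith
    then show ?case
    proof cases
      case 3
      then show ?thesis by (simp add: tree_matrix_def sum1 W'_def Int_commute[of "E n"] ac_simps)
    next
      case 4
      then show ?thesis using uv wn by (simp add: tree_matrix_def En)
    qed (simp_all add: tree_matrix_def sum1 W_def ac_simps)
  qed (simp_all add: tree_matrix_def)
  then have "Determinant.det (tree_matrix E w w' b h (Suc n)) =
      (h ?u + h ?v + b - (h ?u + b) * h ?u) * Determinant.det ?A
      + (h ?u + b) * h ?u * Determinant.det (?A - mat n n (\<lambda>(i, j). W i * W' j))"
    by (simp add: det_bordered[of _ n] tree_matrix_def flip: \<beta>\<gamma>)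
  also have "?A - mat n n (\<lambda>(i, j). W i * W' j) = tree_matrix E w w' b (h(?u := h ?u - 1)) n"
  proof (rule eq_matI, goal_cases)
    case (1 i j)
    then have ij: "i < n" "j < n" by (simp_all add: tree_matrix_def)
    let ?f = "\<lambda>h z. w z i * w' z j * (h z + (if i < j then b else 0))"
    have fin: "finite (E i \<inter> E j)" using Suc.prems(1)[of i] ij by simp
    have "sum (?f (h(?u := h ?u - 1))) (E i \<inter> E j)
      = (\<Sum>z\<in>E i \<inter> E j. ?f h z - (if z = ?u then W i * W' j else 0))"
      by (rule sum.cong) (auto simp: W_def W'_def algebra_simps)
    also have "\<dots> = sum (?f h) (E i \<inter> E j) - W i * W' j"
      by (simp add: sum_subtractf fin) (auto simp: W_def W'_def)
    finally show ?case using ij by (simp add: tree_matrix_def)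
  qed (simp_all add: tree_matrix_def)
  finally have "Determinant.det (tree_matrix E w w' b h (Suc n)) =
      (h ?u + h ?v + b - (h ?u + b) * h ?u) * Determinant.det ?A
      + (h ?u + b) * h ?u * Determinant.det (tree_matrix E w w' b (h(?u := h ?u - 1)) n)" .
  then have "b * Determinant.det (tree_matrix E w w' b h (Suc n)) =
      (h ?u + h ?v + b - (h ?u + b) * h ?u) * (b * Determinant.det ?A)
      + (h ?u + b) * h ?u * (b * Determinant.det (tree_matrix E w w' b (h(?u := h ?u - 1)) n))"
    by (simp only: distrib_left mult.left_commute)
  also have "\<dots> = (h ?u + h ?v + b - (h ?u + b) * h ?u) * ((\<Prod>z\<in>V. h z + b) - (\<Prod>z\<in>V. h z))
      + (h ?u + b) * h ?u * ((\<Prod>z\<in>V. (h(?u := h ?u - 1)) z + b) - (\<Prod>z\<in>V. (h(?u := h ?u - 1)) z))"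
    by (simp only: IH)
  also have "\<dots> = (\<Prod>z\<in>insert ?v V. h z + b) - (\<Prod>z\<in>insert ?v V. h z)"
  proof -
    \<comment> \<open>Lowering h at \<open>?u\<close> affects only the factor at \<open>?u\<close>.
      With the remaining factors named P and R the claim becomes a polynomial identity.\<close>
    define P where "P = (\<Prod>z\<in>V - {?u}. h z + b)"
    define R where "R = (\<Prod>z\<in>V - {?u}. h z)"
    have "(\<Prod>z\<in>V. (h(?u := t)) z + b) = (t + b) * P" "(\<Prod>z\<in>V. (h(?u := t)) z) = t * R" for t
      unfolding P_def R_def using u fin
      by (subst prod.remove[OF fin u]; auto intro!: prod.cong)+
    note PR = this
    have ph: "(\<Prod>z\<in>V. h z + b) = (h ?u + b) * P" "(\<Prod>z\<in>V. h z) = h ?u * R"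
      using PR[of "h ?u"] by simp_all
    show ?thesis
      unfolding PR prod.insert[OF fin v] ph by (simp add: algebra_simps)
  qed
  finally show ?case unfolding V' .
qed

section \<open>Finitely supported functions as sums of monomials\<close>

lemma poly_mapping_eq_sum_single:
  assumes "finite K" "Poly_Mapping.keys f \<subseteq> K"
  shows "f = (\<Sum>p\<in>K. Poly_Mapping.single p (Poly_Mapping.lookup f p))"
proof (rule poly_mapping_eqI)
  fix q
  show "Poly_Mapping.lookup f q
    = Poly_Mapping.lookup (\<Sum>p\<in>K. Poly_Mapping.single p (Poly_Mapping.lookup f p)) q"
    using assms by (auto simp: lookup_sum lookup_single when_def in_keys_iff)
qed

text \<open>The monomials are restricted to keys of f so that a hypothesis on the support of f can
  be used for them.\<close>

lemma poly_mapping_single_induct [case_names zero single plus]: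
  fixes f :: "'a \<Rightarrow>\<^sub>0 'b::comm_monoid_add"
  assumes "P 0" "\<And>p c. p \<in> Poly_Mapping.keys f \<Longrightarrow> P (Poly_Mapping.single p c)"
    and "\<And>g h. P g \<Longrightarrow> P h \<Longrightarrow> P (g + h)"
  shows "P f"
proof -
  have "P (\<Sum>p\<in>K. Poly_Mapping.single p (Poly_Mapping.lookup f p))"
    if "finite K" "K \<subseteq> Poly_Mapping.keys f" for K
    using that by (induction K) (auto intro: assms)
  from this[OF finite_keys order_refl] show ?thesis
    by (simp only: poly_mapping_eq_sum_single[OF finite_keys order_refl, symmetric])
qed

section \<open>Path algebras\<close>

definition single_path_mult ::
    "('a, 'b) qpath \<Rightarrow> ('a, 'b) qpath \<Rightarrow> 'k::field \<Rightarrow> (('a, 'b) qpath \<Rightarrow>\<^sub>0 'k)" where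
  "single_path_mult = (\<lambda>(i, p, j) (i', p', j') c.
     if j = i' then Poly_Mapping.single (i, p @ p', j') c else 0)"

lemma single_path_mult_0 [simp]: "single_path_mult p q 0 = 0"
  by (simp add: single_path_mult_def split: prod.split)

lemma single_path_mult_add:
  "single_path_mult p q (c + c') = single_path_mult p q c + single_path_mult p q c'"
  by (simp add: single_path_mult_def single_add split: prod.split)

text \<open>The summation sets may be any finite supersets of the supports. The distributive laws
  need this: it puts f, f' and f + f' over a common index set even where coefficients
  cancel.\<close>

lemma path_mult_eq_sum:
  assumes "finite K" "Poly_Mapping.keys f \<subseteq> K" "finite L" "Poly_Mapping.keys g \<subseteq> L"
  shows "path_mult f g = (\<Sum>p\<in>K. \<Sum>q\<in>L.
    single_path_mult p q (Poly_Mapping.lookup f p * Poly_Mapping.lookup g q))"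
proof -
  have "path_mult f g = (\<Sum>p\<in>Poly_Mapping.keys f. \<Sum>q\<in>Poly_Mapping.keys g.
    single_path_mult p q (Poly_Mapping.lookup f p * Poly_Mapping.lookup g q))"
    by (auto simp: path_mult_def single_path_mult_def case_prod_unfold intro!: sum.cong)
  also have "\<dots> = (\<Sum>p\<in>K. \<Sum>q\<in>Poly_Mapping.keys g.
    single_path_mult p q (Poly_Mapping.lookup f p * Poly_Mapping.lookup g q))"
    using assms by (intro sum.mono_neutral_left) (auto simp: in_keys_iff)
  also have "\<dots> = (\<Sum>p\<in>K. \<Sum>q\<in>L.
    single_path_mult p q (Poly_Mapping.lookup f p * Poly_Mapping.lookup g q))"
    using assms by (intro sum.cong refl sum.mono_neutral_left) (auto simp: in_keys_iff)
  finally show ?thesis .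
qed

lemma path_mult_add_left: "path_mult (f + f') g = path_mult f g + path_mult f' g"
proof -
  let ?K = "Poly_Mapping.keys f \<union> Poly_Mapping.keys f'" and ?L = "Poly_Mapping.keys g"
  have "Poly_Mapping.keys (f + f') \<subseteq> ?K" by (rule keys_add)
  then show ?thesis
    by (subst (1 2 3) path_mult_eq_sum[of ?K _ ?L])
      (auto simp: lookup_add distrib_right single_path_mult_add sum.distrib)
qed

lemma path_mult_add_right: "path_mult f (g + g') = path_mult f g + path_mult f g'"
proof -
  let ?K = "Poly_Mapping.keys f" and ?L = "Poly_Mapping.keys g \<union> Poly_Mapping.keys g'"
  have "Poly_Mapping.keys (g + g') \<subseteq> ?L" by (rule keys_add)
  then show ?thesis
    by (subst (1 2 3) path_mult_eq_sum[of ?K _ ?L])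
      (auto simp: lookup_add distrib_left single_path_mult_add sum.distrib)
qed

lemma path_mult_0 [simp]: "path_mult 0 g = 0" "path_mult f 0 = 0"
  by (simp_all add: path_mult_def case_prod_unfold)

lemma path_mult_sum_left: "path_mult (\<Sum>a\<in>S. F a) g = (\<Sum>a\<in>S. path_mult (F a) g)"
  by (induction S rule: infinite_finite_induct) (simp_all add: path_mult_add_left)

lemma path_mult_sum_right: "path_mult f (\<Sum>a\<in>S. F a) = (\<Sum>a\<in>S. path_mult f (F a))"
  by (induction S rule: infinite_finite_induct) (simp_all add: path_mult_add_right)

lemma path_mult_single:
  "path_mult (Poly_Mapping.single p c) (Poly_Mapping.single q c') = single_path_mult p q (c * c')"
  by (subst path_mult_eq_sum[of "{p}" _ "{q}"]) auto

lemma path_mult_single':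
  "path_mult (Poly_Mapping.single (i, p, j) c) (Poly_Mapping.single (i', p', j') c')
   = (if j = i' then Poly_Mapping.single (i, p @ p', j') (c * c') else 0)"
  by (simp add: path_mult_single single_path_mult_def)

lemma path_mult_assoc: "path_mult (path_mult f g) h = path_mult f (path_mult g h)"
proof (induction f rule: poly_mapping_single_induct)
  case (single p c)
  show ?case
  proof (induction g rule: poly_mapping_single_induct)
    case (single q c')
    show ?case
    proof (induction h rule: poly_mapping_single_induct)
      case (single t c'')
      obtain i a j i' a' j' i'' a'' j'' where "p = (i, a, j)" "q = (i', a', j')" "t = (i'', a'', j'')"
        by (metis surj_pair)
      then show ?case by (simp add: path_mult_single' mult.assoc)
    qed (simp_all add: path_mult_add_right)
  qed (simp_all add: path_mult_add_left path_mult_add_right)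
qed (simp_all add: path_mult_add_left)

lemma cas_append:
  "pre_digraph.cas Q u (p @ q) w \<longleftrightarrow> (\<exists>v. pre_digraph.cas Q u p v \<and> pre_digraph.cas Q v q w)"
  by (induction p arbitrary: u) (auto simp: pre_digraph.cas.simps)

lemma qpaths_iff:
  "(i, p, j) \<in> qpaths Q \<longleftrightarrow> i \<in> verts Q \<and> set p \<subseteq> arcs Q \<and> pre_digraph.cas Q i p j"
  by (simp add: qpaths_def pre_digraph.awalk_def)

lemma qpaths_append:
  "(i, p, j) \<in> qpaths Q \<Longrightarrow> (j, q, k) \<in> qpaths Q \<Longrightarrow> (i, p @ q, k) \<in> qpaths Q"
  by (auto simp: qpaths_iff cas_append)

lemma keys_path_mult:
  assumes "t \<in> Poly_Mapping.keys (path_mult f g)"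
  obtains i p j p' j' where "(i, p, j) \<in> Poly_Mapping.keys f" "(j, p', j') \<in> Poly_Mapping.keys g"
    "t = (i, p @ p', j')"
proof -
  have "t \<in> (\<Union>p\<in>Poly_Mapping.keys f. \<Union>q\<in>Poly_Mapping.keys g. Poly_Mapping.keys
      (single_path_mult p q (Poly_Mapping.lookup f p * Poly_Mapping.lookup g q)))"
    using assms unfolding path_mult_eq_sum[OF finite_keys order_refl finite_keys order_refl]
    by (blast dest: subsetD[OF keys_sum])
  then show thesis using that
    by (auto simp: single_path_mult_def split: if_splits)
qed

locale finite_quiver =
  fixes Q :: "('a, 'b) pre_digraph"
  assumes finite_verts: "finite (verts Q)"
begin

abbreviation R :: "(('a, 'b) qpath \<Rightarrow>\<^sub>0 'k::field) ring" where "R \<equiv> path_algebra Q"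

lemma carrier_iff: "f \<in> carrier R \<longleftrightarrow> Poly_Mapping.keys f \<subseteq> qpaths Q"
  by (simp add: path_algebra_def)

lemma R_simps [simp]: "mult R = path_mult" "one R = path_scalar Q 1" "zero R = 0" "add R = (+)"
  by (simp_all add: path_algebra_def)

lemma single_in_carrier: "p \<in> qpaths Q \<Longrightarrow> Poly_Mapping.single p c \<in> carrier R"
  by (simp add: carrier_iff)

lemma carrier_add: "f \<in> carrier R \<Longrightarrow> g \<in> carrier R \<Longrightarrow> f + g \<in> carrier R"
  unfolding carrier_iff using keys_add[of f g] by blast

lemma carrier_0 [simp]: "0 \<in> carrier R"
  by (simp add: carrier_iff)

lemma carrier_mult: "f \<in> carrier R \<Longrightarrow> g \<in> carrier R \<Longrightarrow> path_mult f g \<in> carrier R"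
  unfolding carrier_iff by (auto elim!: keys_path_mult intro!: qpaths_append)

lemma carrier_scalar: "path_scalar Q c \<in> carrier R"
  unfolding carrier_iff path_scalar_def
  by (rule order_trans[OF keys_sum]) (auto simp: qpaths_iff pre_digraph.cas.simps split: if_splits)

lemma cas_target:
  assumes "(i, p, j) \<in> qpaths Q" "\<And>a. a \<in> arcs Q \<Longrightarrow> head Q a \<in> verts Q"
  shows "j \<in> verts Q"
  using assms by (induction p arbitrary: i) (auto simp: qpaths_iff pre_digraph.cas.simps)

lemma scalar_mult_single:
  assumes "(i, p, j) \<in> qpaths Q"
  shows "path_mult (path_scalar Q c) (Poly_Mapping.single (i, p, j) c')
    = Poly_Mapping.single (i, p, j) (c * c')"
proof -
  have "path_mult (path_scalar Q c) (Poly_Mapping.single (i, p, j) c')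
    = (\<Sum>k\<in>verts Q. if k = i then Poly_Mapping.single (i, p, j) (c * c') else 0)"
    unfolding path_scalar_def path_mult_sum_left
    by (rule sum.cong) (auto simp: path_mult_single')
  then show ?thesis using assms finite_verts by (simp add: qpaths_iff)
qed

end

text \<open>A path starts in a vertex by definition, so the sum of the trivial paths is a left unit
  in any case. It is a right unit only if arrows also end in vertices.\<close>

locale finite_wf_quiver = finite_quiver +
  assumes heads: "a \<in> arcs Q \<Longrightarrow> head Q a \<in> verts Q"
begin

lemma single_mult_scalar:
  assumes "(i, p, j) \<in> qpaths Q"
  shows "path_mult (Poly_Mapping.single (i, p, j) c') (path_scalar Q c)
    = Poly_Mapping.single (i, p, j) (c * c')"
proof -
  have "path_mult (Poly_Mapping.single (i, p, j) c') (path_scalar Q c)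
    = (\<Sum>k\<in>verts Q. if k = j then Poly_Mapping.single (i, p, j) (c * c') else 0)"
    unfolding path_scalar_def path_mult_sum_right
    by (rule sum.cong) (auto simp: path_mult_single' mult.commute)
  then show ?thesis using cas_target[OF assms heads] finite_verts by simp
qed

lemma carrier_induct [consumes 1, case_names zero single plus]:
  assumes "f \<in> carrier R" "P 0"
    and "\<And>i p j c. (i, p, j) \<in> qpaths Q \<Longrightarrow> P (Poly_Mapping.single (i, p, j) c)"
    and "\<And>g h. P g \<Longrightarrow> P h \<Longrightarrow> P (g + h)"
  shows "P f"
proof (induction f rule: poly_mapping_single_induct)
  case (single p c)
  then show ?case using assms(1,3) by (cases p) (auto simp: carrier_iff)
qed (use assms in auto)

lemma scalar_commute:
  assumes "f \<in> carrier R"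
  shows "path_mult (path_scalar Q c) f = path_mult f (path_scalar Q c)"
  using assms
  by (induction f rule: carrier_induct)
    (simp_all add: scalar_mult_single single_mult_scalar path_mult_add_left path_mult_add_right)

lemma scalar_one:
  assumes "f \<in> carrier R"
  shows "path_mult (path_scalar Q 1) f = f"
  using assms
  by (induction f rule: carrier_induct) (simp_all add: scalar_mult_single path_mult_add_right)

lemma ring_path_algebra: "ring R"
proof (rule ringI)
  show "abelian_group R"
  proof (rule abelian_groupI)
    fix f assume "f \<in> carrier R"
    then show "\<exists>g\<in>carrier R. g \<oplus>\<^bsub>R\<^esub> f = \<zero>\<^bsub>R\<^esub>"
      by (intro bexI[of _ "- f"]) (simp_all add: carrier_iff)
  qed (simp_all add: carrier_add ac_simps)
  show "Group.monoid R"
    by (rule monoidI)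
      (simp_all add: carrier_mult carrier_scalar path_mult_assoc scalar_one flip: scalar_commute)
qed (simp_all add: path_mult_add_left path_mult_add_right)

end

section \<open>Brauer trees and Green's walk\<close>

text \<open>The path grows at its front. If the new vertex already occurs, only the part from that
  occurrence on is kept.\<close>

lemma rtrancl_distinct_path:
  assumes "(a, b) \<in> R\<^sup>*"
  shows "\<exists>vs. vs \<noteq> [] \<and> hd vs = a \<and> last vs = b \<and> distinct vs \<and> successively (\<lambda>x y. (x, y) \<in> R) vs"
  using assms
proof (induction rule: converse_rtrancl_induct)
  case base
  show ?case by (rule exI[of _ "[b]"]) simp
next
  case (step a a')
  then obtain vs where vs: "vs \<noteq> []" "hd vs = a'" "last vs = b" "distinct vs"
    "successively (\<lambda>x y. (x, y) \<in> R) vs" by blast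
  show ?case
  proof (cases "a \<in> set vs")
    case True
    then obtain ys zs where "vs = ys @ a # zs" by (auto simp: in_set_conv_decomp)
    then show ?thesis using vs by (intro exI[of _ "a # zs"]) (auto simp: successively_append_iff)
  next
    case False
    then show ?thesis using vs step.hyps
      by (intro exI[of _ "a # vs"]) (auto simp: successively_Cons)
  qed
qed

locale brauer =
  fixes \<Gamma> :: "'v brauer_tree" and s :: "'v set" and m e :: nat
  assumes bt: "is_brauer_tree \<Gamma> m e"
    and s: "s \<in> edges_at \<Gamma> (bt_exc \<Gamma>)"
begin

abbreviation x :: 'v where "x \<equiv> bt_exc \<Gamma>"
abbreviation V :: "'v set" where "V \<equiv> bt_verts \<Gamma>"
abbreviation E :: "'v set set" where "E \<equiv> bt_edges \<Gamma>"
abbreviation E_at :: "'v \<Rightarrow> 'v set set" where "E_at \<equiv> edges_at \<Gamma>"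
abbreviation ccw :: "'v \<Rightarrow> 'v set \<Rightarrow> 'v set" where "ccw \<equiv> bt_ccw \<Gamma>"
abbreviation cw :: "'v \<Rightarrow> 'v set \<Rightarrow> 'v set" where "cw \<equiv> bt_cw \<Gamma>"
abbreviation adj :: "'v rel" where "adj \<equiv> {(a, b). {a, b} \<in> E}"
abbreviation d :: "'v \<Rightarrow> nat" where "d \<equiv> exc_dist \<Gamma>"

section \<open>The tree rooted at the exceptional vertex\<close>

lemma tree: "tree V E"
  and card_E: "card E = e" and e_pos: "e \<ge> 1"
  and x_in: "x \<in> V" and mult: "bt_mult \<Gamma> = m" and m_pos: "m \<ge> 1"
  and cyclic: "u \<in> V \<Longrightarrow> cyclic_on (ccw u) (E_at u)"
  using bt by (auto simp: is_brauer_tree_def)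

lemma finite_V: "finite V" and finite_E: "finite E"
  using tree card_E e_pos by (auto simp: tree_def intro: card_ge_0_finite)

lemma edgeE:
  assumes "j \<in> E" "u \<in> j"
  obtains v where "j = {u, v}" "u \<in> V" "v \<in> V" "u \<noteq> v"
proof -
  have "E \<subseteq> {{x, y} | x y. x \<in> V \<and> y \<in> V \<and> x \<noteq> y}" using tree by (simp add: tree_def)
  with assms that show thesis by blast
qed

lemma edge_ends:
  assumes "{a, b} \<in> E"
  shows "a \<in> V" "b \<in> V" "a \<noteq> b"
  using edgeE[OF assms, of a] edgeE[OF assms, of b] by (auto simp: doubleton_eq_iff)

lemma E_at_iff: "j \<in> E_at u \<longleftrightarrow> j \<in> E \<and> u \<in> j"
  by (auto simp: edges_at_def)

lemma edge_nonempty: "j \<in> E \<Longrightarrow> \<exists>u v. j = {u, v}"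
  using tree by (auto simp: tree_def)

lemma connected: "u \<in> V \<Longrightarrow> v \<in> V \<Longrightarrow> (u, v) \<in> adj\<^sup>*"
  using tree by (auto simp: tree_def)

lemma acyclic:
  "3 \<le> length vs \<Longrightarrow> distinct vs \<Longrightarrow> successively (\<lambda>a b. {a, b} \<in> E) vs \<Longrightarrow> {last vs, hd vs} \<notin> E"
  using tree unfolding tree_def by blast

lemma exc_dist_path:
  assumes "u \<in> V" shows "(x, u) \<in> adj ^^ d u"
  unfolding exc_dist_def
  using rtrancl_imp_relpow[OF connected[OF x_in assms]] by (rule LeastI_ex)

lemma exc_dist_le: "(x, u) \<in> adj ^^ n \<Longrightarrow> d u \<le> n"
  unfolding exc_dist_def by (rule Least_le)

lemma exc_dist_adj:
  assumes "{u, v} \<in> E" shows "d v \<le> Suc (d u)"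
  by (rule exc_dist_le) (use exc_dist_path[of u] edge_ends[OF assms] assms in auto)

lemma exc_dist_0_iff: "u \<in> V \<Longrightarrow> d u = 0 \<longleftrightarrow> u = x"
  using exc_dist_path[of u] exc_dist_le[of x 0] by auto

lemma exc_dist_pred:
  assumes "u \<in> V" "u \<noteq> x"
  shows "\<exists>w. {w, u} \<in> E \<and> Suc (d w) = d u"
proof -
  obtain n where n: "d u = Suc n" using assms exc_dist_0_iff by (cases "d u") auto
  then obtain w where w: "(x, w) \<in> adj ^^ n" "{w, u} \<in> E"
    using exc_dist_path[OF assms(1)] by auto
  then show ?thesis using exc_dist_le[OF w(1)] exc_dist_adj[OF w(2)] n by auto
qed

text \<open>A shortest path from \<open>x\<close> to u passes only through vertices strictly closer
  to \<open>x\<close> than u, hence never through v.\<close>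

lemma low_vertex_connected:
  assumes "u \<in> V" "u \<noteq> v" "d u \<le> d v" "v \<noteq> x"
  shows "(x, u) \<in> {(a, b). {a, b} \<in> E \<and> a \<noteq> v \<and> b \<noteq> v}\<^sup>*"
  using assms
proof (induction "d u" arbitrary: u)
  case 0
  then show ?case using exc_dist_0_iff by auto
next
  case (Suc n)
  have "u \<noteq> x" using Suc.hyps(2) Suc.prems(1) exc_dist_0_iff[of u] by simp
  then obtain w where w: "{w, u} \<in> E" "Suc (d w) = d u"
    using exc_dist_pred[OF Suc.prems(1)] by blast
  then have "(x, w) \<in> {(a, b). {a, b} \<in> E \<and> a \<noteq> v \<and> b \<noteq> v}\<^sup>*"
    using Suc edge_ends[OF w(1)] by (intro Suc.hyps) auto
  moreover have "w \<noteq> v" using w Suc.prems by auto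
  ultimately show ?case using w(1) Suc.prems by (auto intro: rtrancl_into_rtrancl)
qed

text \<open>Two such neighbours would be joined by a path avoiding \<open>v\<close>, giving a cycle through \<open>v\<close>.\<close>

lemma low_neighbour_unique:
  assumes "{u1, v} \<in> E" "{u2, v} \<in> E" "d u1 \<le> d v" "d u2 \<le> d v" "v \<noteq> x"
  shows "u1 = u2"
proof (rule ccontr)
  assume ne: "u1 \<noteq> u2"
  let ?R = "{(a, b). {a, b} \<in> E \<and> a \<noteq> v \<and> b \<noteq> v}"
  note ends = edge_ends[OF assms(1)] edge_ends[OF assms(2)]
  have "sym ?R" by (auto simp: sym_def insert_commute)
  then have "(u1, x) \<in> ?R\<^sup>*"
    using low_vertex_connected[of u1 v] assms ends by (meson symD sym_rtrancl)
  moreover have "(x, u2) \<in> ?R\<^sup>*"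
    using low_vertex_connected[of u2 v] assms ends by auto
  ultimately have "(u1, u2) \<in> ?R\<^sup>*" by (rule rtrancl_trans)
  from rtrancl_distinct_path[OF this] obtain vs where vs: "vs \<noteq> []" "hd vs = u1" "last vs = u2"
    "distinct vs" "successively (\<lambda>a b. (a, b) \<in> ?R) vs" by blast
  have v_notin: "successively (\<lambda>a b. (a, b) \<in> ?R) us \<Longrightarrow> us \<noteq> [] \<Longrightarrow> hd us \<noteq> v \<Longrightarrow> v \<notin> set us" for us
    by (induction us rule: induct_list012) auto
  have "length vs \<ge> 2" using vs ne by (cases vs; cases "tl vs") auto
  then have "{last (v # vs), hd (v # vs)} \<notin> E"
    using vs v_notin[OF vs(5,1)] ends assms(1)
    by (intro acyclic)
      (auto simp: successively_Cons insert_commute elim: successively_mono)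
  then show False using vs assms(2) by simp
qed

definition par :: "'v \<Rightarrow> 'v" where
  "par v = (THE w. {w, v} \<in> E \<and> d w < d v)"

definition par_edge :: "'v \<Rightarrow> 'v set" where
  "par_edge v = {par v, v}"

lemma par_eqI:
  assumes "{w, v} \<in> E" "d w < d v" shows "par v = w"
proof -
  have "v \<noteq> x" using assms(2) edge_ends[OF assms(1)] exc_dist_0_iff by force
  then have "w' = w" if "{w', v} \<in> E \<and> d w' < d v" for w'
    using low_neighbour_unique[of w' v w] that assms by simp
  with assms show ?thesis unfolding par_def by (intro the_equality) blast+
qed

lemma par:
  assumes "v \<in> V" "v \<noteq> x"
  shows par_edge_in: "par_edge v \<in> E" and Suc_d_par: "Suc (d (par v)) = d v"
    and par_in: "par v \<in> V"
proof -
  obtain w where w: "{w, v} \<in> E" "Suc (d w) = d v" using exc_dist_pred[OF assms] by blast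
  then have "par v = w" by (intro par_eqI) auto
  then show "par_edge v \<in> E" "Suc (d (par v)) = d v" "par v \<in> V"
    using w edge_ends[OF w(1)] by (auto simp: par_edge_def)
qed

text \<open>The neighbour \<open>par v\<close> is already the only one at distance at most
  \<open>d v\<close>, so every other neighbour lies strictly farther from \<open>x\<close>; in
  particular no edge joins two vertices at equal distance.\<close>

lemma child:
  assumes "{v, w} \<in> E" "v \<noteq> x \<Longrightarrow> w \<noteq> par v"
  shows "par w = v" "w \<noteq> x" "d w = Suc (d v)" "par_edge w = {v, w}"
proof -
  note ends = edge_ends[OF assms(1)]
  have "d v < d w"
  proof (cases "v = x")
    case True
    then show ?thesis using ends exc_dist_0_iff[of v] exc_dist_0_iff[of w] by auto
  next
    case False
    show ?thesis
    proof (rule ccontr)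
      assume "\<not> d v < d w"
      moreover have "{par v, v} \<in> E" "d (par v) < d v"
        using par[of v] False ends by (auto simp: par_edge_def)
      ultimately have "w = par v"
        using low_neighbour_unique[of w v "par v"] assms(1) False by (auto simp: insert_commute)
      then show False using assms(2) False by blast
    qed
  qed
  then show "par w = v" using assms(1) by (intro par_eqI) auto
  then show "par_edge w = {v, w}" by (simp add: par_edge_def)
  show "w \<noteq> x" using \<open>d v < d w\<close> exc_dist_0_iff[of w] ends by auto
  show "d w = Suc (d v)" using \<open>d v < d w\<close> exc_dist_adj[OF assms(1)] by auto
qed

lemma edge_is_par_edge:
  assumes "j \<in> E"
  obtains v where "v \<in> V" "v \<noteq> x" "j = par_edge v"
proof -
  obtain u v where j: "j = {u, v}" using edge_nonempty assms by blast
  note ends = edge_ends[OF assms[unfolded j]]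
  show thesis
  proof (cases "u \<noteq> x \<and> v = par u")
    case True
    then show thesis using that[of u] j ends by (auto simp: par_edge_def insert_commute)
  next
    case False
    then show thesis using child[of u v] assms j ends that[of v] by auto
  qed
qed

lemma par_edge_inj:
  assumes "v \<in> V" "v \<noteq> x" "w \<in> V" "w \<noteq> x" "par_edge v = par_edge w"
  shows "v = w"
  using Suc_d_par[OF assms(1,2)] Suc_d_par[OF assms(3,4)] assms(5)
  by (auto simp: par_edge_def doubleton_eq_iff)

text \<open>This is the edge along which Green's walk meets u for the first time. The cyclic order
  at u is cut open here: the numbers of the edges increase counter-clockwise from this edge
  on.\<close>

definition first_edge :: "'v \<Rightarrow> 'v set" where
  "first_edge u = (if u = x then s else par_edge u)"

lemma first_edge_in: "u \<in> V \<Longrightarrow> first_edge u \<in> E_at u"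
  using s par_edge_in by (auto simp: first_edge_def E_at_iff par_edge_def)

lemma not_first_edge:
  assumes "j \<in> E_at u" "j \<noteq> first_edge u"
  obtains v where "j = {u, v}" "v \<in> V" "v \<noteq> x" "par v = u" "j = par_edge v"
proof -
  obtain v where j: "j = {u, v}" "v \<in> V" using assms by (auto simp: E_at_iff elim: edgeE)
  have "u \<noteq> x \<Longrightarrow> v \<noteq> par u" using assms(2) j by (auto simp: first_edge_def par_edge_def insert_commute)
  then show thesis using child[of u v] that j assms by (auto simp: E_at_iff)
qed

lemma common_vertex_unique:
  assumes "i \<in> E" "j \<in> E" "i \<noteq> j" "u \<in> i \<inter> j" "v \<in> i \<inter> j"
  shows "u = v"
  using edgeE[OF assms(1), of u] edgeE[OF assms(2), of u] assms(3-5) by blast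

section \<open>Green's walk\<close>

abbreviation gw :: "nat \<Rightarrow> 'v \<times> 'v set" where "gw \<equiv> green_walk \<Gamma> s"
abbreviation fv :: "'v set \<Rightarrow> nat" where "fv \<equiv> first_visit \<Gamma> s"
abbreviation N :: "'v set \<Rightarrow> nat" where "N \<equiv> green_number \<Gamma> s"

declare green_walk.simps(2) [simp del]

lemma other_end: "other_end u {u, v} = v"
  by (auto simp: other_end_def doubleton_eq_iff)

lemma finite_E_at: "finite (E_at u)"
  using finite_E by (simp add: edges_at_def)

lemma ccw_in: "u \<in> V \<Longrightarrow> j \<in> E_at u \<Longrightarrow> ccw u j \<in> E_at u"
  using cyclic cyclic_on_inI by fastforce

lemma ccw_inj:
  assumes "u \<in> V" shows "inj_on (ccw u) (E_at u)"
proof (rule finite_surj_inj[OF finite_E_at])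
  show "E_at u \<subseteq> ccw u ` E_at u"
  proof
    fix j assume j: "j \<in> E_at u"
    then have "j \<in> orbit (ccw u) j" using cyclic[OF assms] by (auto simp: cyclic_on_alldef)
    then show "j \<in> ccw u ` E_at u"
      using j cyclic[OF assms] orbit_cyclic_eq3[OF cyclic[OF assms] j] by cases auto
  qed
qed

lemma cw_ccw: "u \<in> V \<Longrightarrow> j \<in> E_at u \<Longrightarrow> cw u (ccw u j) = j"
  by (simp add: bt_cw_def ccw_inj)

lemma gw_in: "fst (gw n) \<in> V \<and> snd (gw n) \<in> E_at (fst (gw n))"
proof (induction n)
  case 0
  then show ?case using s x_in by simp
next
  case (Suc n)
  obtain u j where g: "gw n = (u, j)" by force
  with Suc obtain v where j: "j = {u, v}" "v \<in> V" "j \<in> E" by (auto simp: E_at_iff elim: edgeE)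
  then show ?case using g ccw_in[of v j] by (simp add: green_walk.simps(2) other_end E_at_iff)
qed

lemma gw_edge:
  assumes "gw n = (u, j)"
  obtains v where "j = {u, v}" "j \<in> E" "u \<in> V" "v \<in> V" "u \<noteq> v" "gw (Suc n) = (v, ccw v j)"
proof -
  have "j \<in> E_at u" using gw_in[of n] assms by simp
  then obtain v where "j = {u, v}" "u \<in> V" "v \<in> V" "u \<noteq> v" by (auto simp: E_at_iff elim: edgeE)
  then show thesis using that assms \<open>j \<in> E_at u\<close> by (auto simp: green_walk.simps(2) E_at_iff other_end)
qed

lemma gw_Suc: "gw n = (u, {u, v}) \<Longrightarrow> gw (Suc n) = (v, ccw v {u, v})"
  by (simp add: green_walk.simps(2) other_end)

text \<open>The last step into w came either from the parent or from a child of w. In the second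
  case the walk must have entered that child from w, so it was at w even earlier, and induction on
  time applies.\<close>

lemma gw_entered:
  assumes "gw n = (w, k)" "w \<noteq> x"
  shows "\<exists>t<n. gw t = (par w, par_edge w)"
  using assms
proof (induction n arbitrary: w k rule: less_induct)
  case (less n)
  then obtain n' where n: "n = Suc n'" by (cases n) auto
  obtain w' j where g: "gw n' = (w', j)" by force
  then obtain v where v: "j = {w', v}" "j \<in> E" "gw n = (v, ccw v j)"
    using n by (metis gw_edge)
  then have w: "v = w" using less.prems by simp
  show ?case
  proof (cases "w' = par w")
    case True
    then show ?thesis using g v w n by (auto simp: par_edge_def)
  next
    case False
    then have w': "par w' = w" "w' \<noteq> x" "par_edge w' = {w, w'}"
      using child[of w w'] v w by (auto simp: insert_commute)
    then obtain t where "t < n'" "gw t = (w, par_edge w')"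
      using less.IH[of n' w' j] g n by auto
    then obtain t' where "t' < t" "gw t' = (par w, par_edge w)"
      using less.IH[of t w] less.prems n by auto
    then show ?thesis using \<open>t < n'\<close> n by (intro exI[of _ t']) auto
  qed
qed

text \<open>This is the counterpart of \<open>gw_entered\<close> for the future: before reaching
  \<open>x\<close> the walk has to leave w upwards. If it descends into a child instead, it comes
  back up to w later, with less time left until T.\<close>

lemma gw_left:
  assumes "gw n = (w, k)" "w \<noteq> x" "n \<le> T" "gw T = (x, k')"
  shows "\<exists>t. n \<le> t \<and> t < T \<and> gw t = (w, par_edge w)"
  using assms(1-3)
proof (induction "T - n" arbitrary: n w k rule: less_induct)
  case less
  then have nT: "n < T" using assms(4) by (metis Pair_inject le_neq_implies_less)
  obtain v where v: "k = {w, v}" "k \<in> E" "gw (Suc n) = (v, ccw v k)"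
    using less.prems by (metis gw_edge)
  show ?case
  proof (cases "v = par w")
    case True
    then show ?thesis using less.prems v nT by (auto simp: par_edge_def insert_commute)
  next
    case False
    then have w': "par v = w" "v \<noteq> x" "par_edge v = {w, v}"
      using child[of w v] v by auto
    have "T - Suc n < T - n" using nT by arith
    then obtain t where t: "Suc n \<le> t" "t < T" "gw t = (v, {v, w})"
      using less.hyps[OF _ v(3) w'(2)] nT by (auto simp: w'(3) insert_commute)
    then have "gw (Suc t) = (w, ccw w {v, w})" by (simp add: gw_Suc)
    moreover have "T - Suc t < T - n" using t nT by arith
    ultimately obtain t' where "Suc t \<le> t'" "t' < T" "gw t' = (w, par_edge w)"
      using less.hyps[of "Suc t" w] less.prems(2) t by auto
    then show ?thesis using t by (intro exI[of _ t']) auto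
  qed
qed

lemma gw_step_inj:
  assumes "gw (Suc a) = gw (Suc b)" shows "gw a = gw b"
proof -
  obtain u j u' j' where g: "gw a = (u, j)" "gw b = (u', j')" by (metis surj_pair)
  obtain v where v: "j = {u, v}" "j \<in> E" "v \<in> V" "gw (Suc a) = (v, ccw v j)" "u \<noteq> v"
    using gw_edge[OF g(1)] by metis
  obtain v' where v': "j' = {u', v'}" "j' \<in> E" "gw (Suc b) = (v', ccw v' j')" "u' \<noteq> v'"
    using gw_edge[OF g(2)] by metis
  have [simp]: "v' = v" and "ccw v j = ccw v j'" using v v' assms by auto
  then have "j = j'" using ccw_inj[OF v(3)] v v' by (auto simp: inj_on_def E_at_iff)
  then show ?thesis using g v v' by (auto simp: doubleton_eq_iff)
qed

text \<open>A step can be undone, because \<open>ccw\<close> is injective and the traversed edge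
  determines the vertex it came from. A repetition among the finitely many states can therefore be
  shifted back to time 0, and the walk is periodic.\<close>

lemma gw_returns: "\<exists>T>n. gw T = gw 0"
proof -
  have "finite (range gw)"
  proof (rule finite_subset)
    show "range gw \<subseteq> V \<times> E" using gw_in by (auto simp: E_at_iff) (metis fst_conv snd_conv)+
  qed (simp add: finite_V finite_E)
  then have "\<not> inj gw" using finite_imageD infinite_UNIV_nat by blast
  then obtain a b where ab: "a < b" "gw a = gw b"
    by (metis injI linorder_neqE_nat)
  have "gw (c + k) = gw (c' + k) \<Longrightarrow> gw c = gw c'" for c c' k
    by (induction k) (auto dest: gw_step_inj)
  from this[of 0 a "b - a"] ab have T: "gw (b - a) = gw 0" by simp
  have "gw (b - a + k) = gw k" for k
    by (induction k) (use T in \<open>auto simp: green_walk.simps(2)\<close>)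
  then have "gw (k * (b - a)) = gw 0" for k
    by (induction k) auto
  moreover have "Suc n * 1 \<le> Suc n * (b - a)" using ab by (intro mult_le_mono) auto
  ultimately show ?thesis by (metis Suc_le_lessD mult.right_neutral)
qed

text \<open>Whenever the walk arrives at v along k, it continues with the next edge, so an arrival
  along k is all that is needed. If k leads to the parent, the walk first came to v along k. If k
  leads to a child, the walk returns from the branch behind k on its way back to
  \<open>x\<close>.\<close>

lemma gw_rotates:
  assumes "(v, k) \<in> range gw"
  shows "(v, ccw v k) \<in> range gw"
proof -
  obtain n where n: "gw n = (v, k)" using assms by auto
  obtain w where w: "k = {v, w}" "k \<in> E" "gw (Suc n) = (w, ccw w k)"
    using gw_edge[OF n] by metis
  show ?thesis
  proof (cases "v \<noteq> x \<and> w = par v")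
    case True
    then obtain t where t: "gw t = (w, {w, v})" using gw_entered[OF n] by (auto simp: par_edge_def)
    have "gw (Suc t) = (v, ccw v k)" using gw_Suc[OF t] w by (simp add: insert_commute)
    then show ?thesis by (metis rangeI)
  next
    case False
    then have c: "w \<noteq> x" "par_edge w = {w, v}" using child[of v w] w by (auto simp: insert_commute)
    obtain T where "T > Suc n" "gw T = gw 0" using gw_returns by blast
    then obtain t where t: "gw t = (w, {w, v})"
      using gw_left[OF w(3) c(1), of T s] c by auto
    have "gw (Suc t) = (v, ccw v k)" using gw_Suc[OF t] w by (simp add: insert_commute)
    then show ?thesis by (metis rangeI)
  qed
qed

text \<open>Rotation reaches all edges at a visited vertex, and connectedness spreads this over the
  tree. Thus each edge is traversed in both directions.\<close>

lemma gw_surj: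
  assumes "v \<in> V" "k \<in> E_at v"
  shows "(v, k) \<in> range gw"
proof -
  have rot: "(v, k') \<in> range gw" if "(v, k) \<in> range gw" "v \<in> V" "k' \<in> E_at v" for v k k'
  proof -
    have "k \<in> E_at v" using that(1) gw_in by (auto) (metis fst_conv snd_conv)
    then have "k' \<in> orbit (ccw v) k" using cyclic that by (auto simp: cyclic_on_alldef)
    then show ?thesis by induction (use that(1) gw_rotates in auto)
  qed
  have "\<exists>k. (v, k) \<in> range gw"
    using connected[OF x_in assms(1)]
  proof (induction rule: rtrancl_induct)
    case base
    then show ?case by (metis green_walk.simps(1) rangeI)
  next
    case (step v w)
    then have "(v, {v, w}) \<in> range gw"
      using rot[of v _ "{v, w}"] edge_ends[of v w] by (auto simp: E_at_iff)
    then obtain n where "(v, {v, w}) = gw n" by (rule rangeE)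
    from gw_Suc[OF this[symmetric]] show ?case by (metis rangeI)
  qed
  then show ?thesis using rot assms by blast
qed

lemma gw_first_visit:
  assumes "j \<in> E" shows "snd (gw (fv j)) = j"
proof -
  obtain u where "u \<in> j" using edge_nonempty[OF assms] by blast
  then have "(u, j) \<in> range gw" using gw_surj[of u j] assms by (auto simp: E_at_iff elim: edgeE)
  then have "\<exists>n. snd (gw n) = j" by (metis rangeE snd_conv)
  then show ?thesis unfolding first_visit_def by (rule LeastI_ex)
qed

lemma first_visit_le: "snd (gw n) = j \<Longrightarrow> fv j \<le> n"
  unfolding first_visit_def by (rule Least_le)

text \<open>A traversal upwards starts at v, and by \<open>gw_entered\<close> the same edge was
  traversed downwards before.\<close>

lemma first_visit_downwards:
  assumes "v \<in> V" "v \<noteq> x"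
  shows "gw (fv (par_edge v)) = (par v, par_edge v)"
proof -
  let ?n = "fv (par_edge v)"
  have sn: "snd (gw ?n) = par_edge v" using gw_first_visit par_edge_in assms by simp
  then have "fst (gw ?n) \<in> {par v, v}" using gw_in[of ?n] by (auto simp: E_at_iff par_edge_def)
  moreover have "fst (gw ?n) \<noteq> v"
  proof
    assume "fst (gw ?n) = v"
    then obtain t where "t < ?n" "gw t = (par v, par_edge v)"
      using gw_entered[of ?n v "par_edge v"] assms sn by (metis prod.collapse)
    then show False using first_visit_le[of t] by auto
  qed
  ultimately show ?thesis using sn by (metis empty_iff insert_iff prod.collapse)
qed

text \<open>The edge j leads to a child, so its first traversal starts at u, directly after the walk
  has arrived at u along the clockwise neighbour of j. That neighbour is thus visited one step
  earlier. Excluding the first edge ensures that there is a step before.\<close>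

lemma first_visit_cw:
  assumes "u \<in> V" "j \<in> E_at u" "j \<noteq> first_edge u"
  shows "fv (cw u j) < fv j"
proof -
  obtain v where v: "v \<in> V" "v \<noteq> x" "par v = u" "j = par_edge v"
    using not_first_edge[OF assms(2,3)] by metis
  then have g: "gw (fv j) = (u, j)" using first_visit_downwards by simp
  have "fv j \<noteq> 0"
  proof
    assume "fv j = 0"
    then have "u = x" "j = s" using g by simp_all
    then show False using assms(3) by (simp add: first_edge_def)
  qed
  then obtain n where n: "fv j = Suc n" by (cases "fv j") auto
  obtain w k where k: "gw n = (w, k)" by force
  obtain v' where v': "k = {w, v'}" "k \<in> E" "gw (Suc n) = (v', ccw v' k)"
    using gw_edge[OF k] by metis
  then have "v' = u" "ccw u k = j" using g n by auto
  then have "cw u j = k" using cw_ccw[OF assms(1), of k] v' by (auto simp: E_at_iff)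
  then show ?thesis using first_visit_le[of n k] k n by simp
qed

lemma first_visit_inj: "inj_on fv E"
  by (rule inj_onI) (metis gw_first_visit)

section \<open>Green's numbering\<close>

lemma green_number_less_iff:
  assumes "i \<in> E" "j \<in> E"
  shows "N i < N j \<longleftrightarrow> fv i < fv j"
proof -
  have mono: "N i < N j" if "j \<in> E" "fv i < fv j" for i j
  proof -
    have "j \<in> {k \<in> E. fv k \<le> fv j}" "j \<notin> {k \<in> E. fv k \<le> fv i}" using that by auto
    then have "{k \<in> E. fv k \<le> fv i} \<subset> {k \<in> E. fv k \<le> fv j}" using that by fastforce
    then show ?thesis unfolding green_number_def using finite_E by (intro psubset_card_mono) auto
  qed
  show ?thesis
    using mono[of j i] mono[of i j] assms first_visit_inj
    by (metis inj_onD linorder_neqE_nat not_less_iff_gr_or_eq)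
qed

lemma green_number_bij: "bij_betw N E {1..e}"
proof -
  have inj: "inj_on N E"
    by (rule inj_onI)
      (metis first_visit_inj green_number_less_iff inj_onD less_irrefl linorder_neqE_nat)
  have "N ` E \<subseteq> {1..e}"
  proof clarify
    fix j assume j: "j \<in> E"
    have "N j \<le> card E" unfolding green_number_def by (intro card_mono finite_E) auto
    moreover have "N j > 0" unfolding green_number_def using j finite_E by (auto simp: card_gt_0_iff)
    ultimately show "N j \<in> {1..e}" by (auto simp: card_E)
  qed
  then have "N ` E = {1..e}"
    using card_image[OF inj] by (intro card_subset_eq) (auto simp: card_E)
  with inj show ?thesis by (simp add: bij_betw_def)
qed

lemma green_edge:
  assumes "i < e"
  shows green_edge_in: "green_edge \<Gamma> s (Suc i) \<in> E"
    and green_number_edge: "N (green_edge \<Gamma> s (Suc i)) = Suc i"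
proof -
  have "Suc i \<in> N ` E" using green_number_bij assms by (simp add: bij_betw_def)
  then obtain j where "j \<in> E" "N j = Suc i" by auto
  then have "\<exists>!j. j \<in> E \<and> N j = Suc i"
    using inj_onD[OF bij_betw_imp_inj_on[OF green_number_bij]] by (intro ex1I[of _ j]) simp_all
  from theI'[OF this] show "green_edge \<Gamma> s (Suc i) \<in> E" "N (green_edge \<Gamma> s (Suc i)) = Suc i"
    by (simp_all add: green_edge_def)
qed

lemma green_edge_number:
  assumes "j \<in> E" shows "green_edge \<Gamma> s (N j) = j"
  unfolding green_edge_def
  using assms green_number_bij by (intro the_equality) (auto simp: bij_betw_def inj_on_def)

text \<open>An edge with the smallest number at u has no clockwise neighbour with a smaller number,
  which by \<open>first_visit_cw\<close> leaves only the first edge.\<close>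

lemma green_number_first_edge:
  assumes "u \<in> V" "j \<in> E_at u"
  shows "N (first_edge u) \<le> N j"
proof (rule ccontr)
  assume less: "\<not> ?thesis"
  define i where "i = (ARG_MIN N i. i \<in> E_at u)"
  have i: "i \<in> E_at u" "\<And>k. k \<in> E_at u \<Longrightarrow> N i \<le> N k"
    unfolding i_def using assms(2) arg_min_natI[of "\<lambda>i. i \<in> E_at u" _ N] arg_min_nat_le[of "\<lambda>i. i \<in> E_at u" _ N] by blast+
  then have "i \<noteq> first_edge u" using less assms by auto
  then have "fv (cw u i) < fv i" using first_visit_cw i assms by auto
  moreover have "cw u i \<in> E_at u"
  proof -
    have "i \<in> ccw u ` E_at u"
      using endo_inj_surj[OF finite_E_at _ ccw_inj[OF assms(1)]] ccw_in[OF assms(1)] i by blast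
    then show ?thesis using cw_ccw assms(1) by auto
  qed
  ultimately show False using i green_number_less_iff[of "cw u i" i] by (force simp: E_at_iff)
qed

end

section \<open>Degrees of turns\<close>

text \<open>The indicator of the multiples of r is written as a difference of consecutive quotients.
  Summed along a turn it telescopes and counts how often the turn leaves the first edge.\<close>

lemma div_minus_pred_div:
  fixes z r :: int
  assumes "r > 0"
  shows "z div r - (z - 1) div r = (if z mod r = 0 then 1 else 0)"
proof (cases "z mod r = 0")
  case True
  then obtain k where z: "z = r * k" by auto
  have "(r * k - 1) div r = k - 1"
    by (rule int_div_pos_eq[of _ _ _ "r - 1"]) (use assms in \<open>auto simp: algebra_simps\<close>)
  then show ?thesis using True z assms by simp
next
  case False
  then have "z mod r > 0" "z mod r < r"
    using pos_mod_sign[OF assms, of z] pos_mod_bound[OF assms, of z] by linarith+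
  then have "(z - 1) div r = z div r"
    by (intro int_div_pos_eq[of _ _ _ "z mod r - 1"]) (auto simp: algebra_simps)
  then show ?thesis using False by simp
qed

lemma minus_mult_mod: "(a - r * k) mod r = a mod (r::int)"
  using mod_mult_self2[of a r "- k"] by simp

definition q_pow :: "int \<Rightarrow> laurent" where
  "q_pow k = Poly_Mapping.single k 1"

lemma q_pow_0 [simp]: "q_pow 0 = 1"
  by (simp add: q_pow_def)

lemma q_pow_add: "q_pow (k + l) = q_pow k * q_pow l"
  by (simp add: q_pow_def mult_single)

lemma q_pow_mult_nat: "q_pow (k * int n) = q_pow k ^ n"
  by (induction n) (simp_all add: q_pow_add algebra_simps)

context brauer
begin

definition valency :: "'v \<Rightarrow> nat" where
  "valency u = card (E_at u)"

text \<open>The edges at u are indexed by all integers, periodically and counter-clockwise from the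
  first edge. A clockwise turn of length n then just subtracts n from the index, with no case
  distinction at the wrap-around.\<close>

definition cyc_edge :: "'v \<Rightarrow> int \<Rightarrow> 'v set" where
  "cyc_edge u z = (ccw u ^^ nat (z mod int (valency u))) (first_edge u)"

context
  fixes u assumes u: "u \<in> V"
begin

lemma ccw_funpow:
  shows E_at_funpow: "E_at u = (\<lambda>n. (ccw u ^^ n) (first_edge u)) ` {0..<valency u}"
    and funpow_inj: "inj_on (\<lambda>n. (ccw u ^^ n) (first_edge u)) {0..<valency u}"
    and funpow_valency: "(ccw u ^^ valency u) (first_edge u) = first_edge u"
    and valency_pos: "valency u > 0"
proof -
  let ?f = "ccw u" and ?y = "first_edge u"
  have orb: "E_at u = orbit ?f ?y" and y: "?y \<in> orbit ?f ?y"
    using cyclic[OF u] first_edge_in[OF u] by (auto simp: cyclic_on_alldef)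
  have 1: "E_at u = (\<lambda>n. (?f ^^ n) ?y) ` {0..<funpow_dist1 ?f ?y ?y}"
    unfolding orb by (rule orbit_conv_funpow_dist1[OF y])
  have 2: "inj_on (\<lambda>n. (?f ^^ n) ?y) {0..<funpow_dist1 ?f ?y ?y}"
    by (rule inj_on_funpow_dist1[OF y])
  have 3: "valency u = funpow_dist1 ?f ?y ?y"
    unfolding valency_def 1 using card_image[OF 2] by simp
  show "E_at u = (\<lambda>n. (?f ^^ n) ?y) ` {0..<valency u}" "inj_on (\<lambda>n. (?f ^^ n) ?y) {0..<valency u}"
    "(?f ^^ valency u) ?y = ?y" "valency u > 0"
    using 1 2 funpow_dist1_prop[OF y] unfolding 3 by simp_all
qed

lemma cyc_edge_in: "cyc_edge u z \<in> E_at u"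
proof -
  have "nat (z mod int (valency u)) < valency u" using valency_pos by (simp add: nat_less_iff)
  then show ?thesis unfolding cyc_edge_def by (subst E_at_funpow) auto
qed

lemma cyc_edge_eq_iff: "cyc_edge u z = cyc_edge u z' \<longleftrightarrow> z mod int (valency u) = z' mod int (valency u)"
proof
  assume "cyc_edge u z = cyc_edge u z'"
  then have "nat (z mod int (valency u)) = nat (z' mod int (valency u))"
    unfolding cyc_edge_def using valency_pos by (intro inj_onD[OF funpow_inj]) (simp_all add: nat_less_iff)
  then show "z mod int (valency u) = z' mod int (valency u)" using valency_pos by (simp add: nat_eq_iff)
qed (simp add: cyc_edge_def)

lemma cyc_edge_0: "cyc_edge u 0 = first_edge u"
  by (simp add: cyc_edge_def)

lemma cyc_edge_surj:
  assumes "j \<in> E_at u"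
  obtains a where "0 \<le> a" "a < int (valency u)" "j = cyc_edge u a"
proof -
  obtain n where "n < valency u" "j = (ccw u ^^ n) (first_edge u)"
    using assms by (subst (asm) E_at_funpow) auto
  then show thesis by (intro that[of "int n"]) (auto simp: cyc_edge_def)
qed

lemma ccw_cyc_edge: "ccw u (cyc_edge u z) = cyc_edge u (z + 1)"
proof -
  let ?k = "z mod int (valency u)"
  have k: "0 \<le> ?k" "?k < int (valency u)" using valency_pos by simp_all
  have 1: "ccw u (cyc_edge u z) = (ccw u ^^ Suc (nat ?k)) (first_edge u)" by (simp add: cyc_edge_def)
  have 2: "(z + 1) mod int (valency u) = (?k + 1) mod int (valency u)" by (simp add: mod_add_left_eq)
  show ?thesis
  proof (cases "?k + 1 = int (valency u)")
    case True
    then have "Suc (nat ?k) = valency u" using k by linarith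
    then show ?thesis using True funpow_valency unfolding 1 by (simp add: cyc_edge_def 2)
  next
    case False
    then have "(?k + 1) mod int (valency u) = ?k + 1" using k by (intro mod_pos_pos_trivial) linarith+
    then have "nat ((z + 1) mod int (valency u)) = Suc (nat ?k)" using k 2 by linarith
    then show ?thesis unfolding 1 by (simp add: cyc_edge_def)
  qed
qed

lemma cw_cyc_edge: "cw u (cyc_edge u z) = cyc_edge u (z - 1)"
  using cw_ccw[OF u cyc_edge_in[of "z - 1"]] by (simp add: ccw_cyc_edge)

lemma cw_funpow_cyc_edge: "(cw u ^^ n) (cyc_edge u z) = cyc_edge u (z - int n)"
  by (induction n) (simp_all add: cw_cyc_edge algebra_simps)

lemma cw_funpow_in: "j \<in> E_at u \<Longrightarrow> (cw u ^^ n) j \<in> E_at u"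
  by (elim cyc_edge_surj) (simp add: cw_funpow_cyc_edge cyc_edge_in)

lemma green_number_cyc_edge_pred:
  assumes "z mod int (valency u) \<noteq> 0"
  shows "N (cyc_edge u (z - 1)) < N (cyc_edge u z)"
proof -
  have "cyc_edge u z \<noteq> first_edge u" using assms cyc_edge_eq_iff[of z 0] by (simp add: cyc_edge_0)
  then have "fv (cyc_edge u (z - 1)) < fv (cyc_edge u z)"
    using first_visit_cw[OF u cyc_edge_in] by (simp add: cw_cyc_edge)
  then show ?thesis using cyc_edge_in by (simp add: green_number_less_iff E_at_iff)
qed

lemma green_number_cyc_edge_mono:
  assumes "0 \<le> a" "a < b" "b < int (valency u)"
  shows "N (cyc_edge u a) < N (cyc_edge u b)"
  using assms(2,3)
proof (induction b rule: int_gr_induct)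
  case base
  then show ?case using green_number_cyc_edge_pred[of "a + 1"] assms(1) by simp
next
  case (step b)
  then show ?case using green_number_cyc_edge_pred[of "b + 1"] assms(1) by simp
qed

lemma green_number_cyc_edge_less_iff:
  assumes "0 \<le> a" "a < int (valency u)" "0 \<le> b" "b < int (valency u)"
  shows "N (cyc_edge u a) < N (cyc_edge u b) \<longleftrightarrow> a < b"
  using green_number_cyc_edge_mono[of a b] green_number_cyc_edge_mono[of b a] assms
  by (cases a b rule: linorder_cases) auto

lemma closest_edge_iff:
  assumes "u \<noteq> x" "j \<in> E_at u"
  shows "closest_edge \<Gamma> u j \<longleftrightarrow> j = first_edge u"
proof -
  let ?f = "\<lambda>j. Min (d ` j)"
  have f1: "?f (first_edge u) < d u"
    using Suc_d_par[OF u assms(1)] assms(1) by (simp add: first_edge_def par_edge_def)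
  have f2: "?f k = d u" if k: "k \<in> E_at u" "k \<noteq> first_edge u" for k
  proof -
    obtain v where v: "k = {u, v}" "v \<in> V" "v \<noteq> x" "par v = u" using not_first_edge[OF k] by metis
    then show ?thesis using Suc_d_par[OF v(2,3)] by simp
  qed
  show ?thesis
  proof
    assume "closest_edge \<Gamma> u j"
    then have "\<not> ?f (first_edge u) < ?f j"
      using first_edge_in[OF u] by (auto simp: closest_edge_def is_arg_min_def)
    then show "j = first_edge u" using f1 f2[OF assms(2)] by force
  next
    assume j: "j = first_edge u"
    have "\<not> ?f k < ?f j" if "k \<in> E_at u" for k
      using f1 f2[OF that] j by (cases "k = first_edge u") auto
    then show "closest_edge \<Gamma> u j"
      using assms(2) unfolding closest_edge_def is_arg_min_def by blast
  qed
qed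

text \<open>The degree of going once around u.\<close>

definition Q :: int where
  "Q = (if u = x then int e else int (m * e))"

lemma arrow_degree_cyc_edge:
  "arrow_degree \<Gamma> s (u, cyc_edge u z) =
     (if u = x then int (N (cyc_edge u z)) - int (N (cyc_edge u (z - 1))) else 0)
     + Q * (z div int (valency u) - (z - 1) div int (valency u))"
proof -
  have r: "int (valency u) > 0" using valency_pos by simp
  have first: "cyc_edge u z = first_edge u \<longleftrightarrow> z mod int (valency u) = 0"
    using cyc_edge_eq_iff[of z 0] by (simp add: cyc_edge_0)
  have closest: "u \<noteq> x \<Longrightarrow> closest_edge \<Gamma> u (cyc_edge u z) \<longleftrightarrow> z mod int (valency u) = 0"
    using closest_edge_iff[OF _ cyc_edge_in] first by simp
  show ?thesis
  proof (cases "z mod int (valency u) = 0")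
    case True
    \<comment> \<open>The arrow leaves the first edge. At the exceptional vertex its target has a
      larger number, or the same one for a loop; the prescribed degrees e - (j - i) and e both equal
      i - j + e.\<close>
    have "N (cyc_edge u z) \<le> N (cyc_edge u (z - 1))"
      using green_number_first_edge[OF u cyc_edge_in, of "z - 1"] first True by simp
    then show ?thesis
      using closest True
      unfolding div_minus_pred_div[OF r]
      by (auto simp: arrow_degree_def bt_quiver_def cw_cyc_edge Q_def mult card_E Let_def)
  next
    case False
    show ?thesis
      using closest False green_number_cyc_edge_pred[OF False]
      unfolding div_minus_pred_div[OF r]
      by (auto simp: arrow_degree_def bt_quiver_def cw_cyc_edge Q_def mult card_E Let_def)
  qed
qed

lemma turn_degree:
  "path_degree \<Gamma> s (turn \<Gamma> u (cyc_edge u z) n) =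
     (if u = x then int (N (cyc_edge u z)) - int (N (cyc_edge u (z - int n))) else 0)
     + Q * (z div int (valency u) - (z - int n) div int (valency u))"
proof (induction n)
  case 0
  then show ?case by (simp add: path_degree_def turn_def)
next
  case (Suc n)
  have "path_degree \<Gamma> s (turn \<Gamma> u (cyc_edge u z) (Suc n))
    = path_degree \<Gamma> s (turn \<Gamma> u (cyc_edge u z) n) + arrow_degree \<Gamma> s (u, cyc_edge u (z - int n))"
    by (simp add: path_degree_def turn_def cw_funpow_cyc_edge)
  then show ?case by (simp add: Suc.IH arrow_degree_cyc_edge diff_diff_eq add.commute algebra_simps)
qed

definition mu :: nat where
  "mu = (if u = x then m else 1)"

text \<open>\<open>M = 1\<close> if \<open>u\<close> has no cycle, so that no proper nontrivial turn is counted at such a vertex.\<close>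

definition M :: nat where
  "M = valency u * mu"

lemma full_turn_target: "j \<in> E_at u \<Longrightarrow> (cw u ^^ M) j = j"
  by (elim cyc_edge_surj) (simp add: cw_funpow_cyc_edge M_def cyc_edge_eq_iff minus_mult_mod)

lemma mu_pos: "mu > 0"
  using m_pos by (simp add: mu_def)

lemma Q_mu: "Q * int mu = int (m * e)"
  by (simp add: Q_def mu_def)

lemma M_pos: "M > 0"
  using valency_pos mu_pos by (simp add: M_def)

text \<open>A full turn goes \<open>mu\<close> times around u, and \<open>Q * mu\<close> is the same
  at all vertices. Hence the relation identifying the full turns at the two ends of an edge is
  homogeneous.\<close>

lemma full_turn_degree:
  assumes "j \<in> E_at u" shows "path_degree \<Gamma> s (turn \<Gamma> u j M) = int (m * e)"
proof -
  obtain a where a: "j = cyc_edge u a" using cyc_edge_surj[OF assms] by metis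
  have cyc_edge: "cyc_edge u (a - int M) = cyc_edge u a" by (simp add: cyc_edge_eq_iff M_def minus_mult_mod)
  have div: "a div int (valency u) - (a - int M) div int (valency u) = int mu"
  proof -
    have "(a - int M) div int (valency u) = (a + int (valency u) * (- int mu)) div int (valency u)" by (simp add: M_def)
    also have "\<dots> = a div int (valency u) - int mu" using valency_pos by (subst div_mult_self2) auto
    finally show ?thesis by simp
  qed
  show ?thesis unfolding a turn_degree cyc_edge div by (simp add: Q_mu)
qed

text \<open>This is h u of the overview: one term for each number of complete rounds short of a full
  turn. Multiplying by q to the power \<open>Q\<close> shifts the terms and hence adds q^(me) -
  1.\<close>

definition vertex_sum :: laurent where
  "vertex_sum = (\<Sum>t<mu. q_pow (Q * int t))"

lemma vertex_sum_Q: "vertex_sum * q_pow Q = vertex_sum + (q_pow (int (m * e)) - 1)"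
proof -
  have "(\<Sum>t<n. q_pow (Q * int t)) * q_pow Q = (\<Sum>t<n. q_pow (Q * int t)) + (q_pow (Q * int n) - 1)" for n
    by (induction n) (simp_all add: algebra_simps q_pow_add)
  from this[of mu] show ?thesis by (simp only: Q_mu flip: vertex_sum_def)
qed

definition weight :: "int \<Rightarrow> 'v set \<Rightarrow> laurent" where
  "weight \<epsilon> j = (if u = x then q_pow (\<epsilon> * int (N j)) else 1)"

lemma weight_inverse: "weight 1 j * weight (- 1) j = 1"
  by (simp add: weight_def flip: q_pow_add)

text \<open>The turns from i to j differ by complete rounds, so their degrees form an arithmetic
  progression with difference \<open>Q\<close>. The bound n < \<open>M\<close> excludes the full
  turn but admits the trivial path if i = j; \<open>basis_sum\<close> corrects for both.\<close>

lemma turns_sum: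
  assumes "i \<in> E_at u" "j \<in> E_at u"
  shows "(\<Sum>n | n < M \<and> (cw u ^^ n) i = j. q_pow (path_degree \<Gamma> s (turn \<Gamma> u i n)))
    = weight 1 i * weight (- 1) j * (vertex_sum + (if N i < N j then q_pow (int (m * e)) - 1 else 0))"
proof -
  obtain a where a: "0 \<le> a" "a < int (valency u)" "i = cyc_edge u a" using cyc_edge_surj[OF assms(1)] by metis
  obtain b where b: "0 \<le> b" "b < int (valency u)" "j = cyc_edge u b" using cyc_edge_surj[OF assms(2)] by metis
  \<comment> \<open>Indices decrease along a turn. If a < b, the turn has to leave the first edge
    once before it can reach j, otherwise not at all. \<open>?g t\<close> is the length of the turn
    from i to j that does so t + c times.\<close>
  define c :: int where "c = (if a < b then 1 else 0)"
  let ?g = "\<lambda>t. nat (a - b + int (valency u) * (int t + c))"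
  have g: "int (?g t) = a - b + int (valency u) * (int t + c)" for t
  proof -
    have "int (valency u) * c \<le> int (valency u) * (int t + c)" by (intro mult_left_mono) auto
    moreover have "a - b + int (valency u) * c \<ge> 0" using a b by (auto simp: c_def)
    ultimately show ?thesis by linarith
  qed
  have div_ab: "a div int (valency u) = 0" "(b - int (valency u) * k) div int (valency u) = - k" for k
  proof -
    show "a div int (valency u) = 0" using a by (simp add: div_pos_pos_trivial)
    show "(b - int (valency u) * k) div int (valency u) = - k"
      using b by (intro int_div_pos_eq[of _ _ _ b]) auto
  qed
  have eq: "{n. n < M \<and> (cw u ^^ n) i = j} = ?g ` {..<mu}"
  proof (intro Set.set_eqI iffI)
    fix n assume "n \<in> {n. n < M \<and> (cw u ^^ n) i = j}"
    then have n: "n < M" "(a - int n) mod int (valency u) = b mod int (valency u)"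
      using a b by (auto simp: cw_funpow_cyc_edge cyc_edge_eq_iff)
    then have "int (valency u) dvd a - int n - b" by (simp add: mod_eq_dvd_iff)
    then obtain k where "a - int n - b = int (valency u) * k" by (auto elim: dvdE)
    then have k: "int n = a - b + int (valency u) * (- k)" by (simp add: algebra_simps)
    have r: "int (valency u) > 0" using valency_pos by simp
    have "- k \<ge> c"
    proof (rule ccontr)
      assume "\<not> - k \<ge> c"
      then have "int (valency u) * (- k) \<le> int (valency u) * (c - 1)" using r by (intro mult_left_mono) auto
      then have "int n \<le> a - b + int (valency u) * (c - 1)" using k by linarith
      then show False using a b by (auto simp: c_def split: if_splits)
    qed
    moreover have "- k < int mu + c"
    proof (rule ccontr)
      assume "\<not> - k < int mu + c"
      then have "int (valency u) * (- k) \<ge> int (valency u) * (int mu + c)" using r by (intro mult_left_mono) auto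
      moreover have "int n < int (valency u) * int mu" using n(1) unfolding M_def
        by (metis of_nat_less_iff of_nat_mult)
      ultimately show False using k a b r by (auto simp: c_def algebra_simps split: if_splits)
    qed
    ultimately have "int n = int (?g (nat (- k - c)))" "nat (- k - c) < mu"
      unfolding g by (auto simp: k)
    then have "n = ?g (nat (- k - c))" "nat (- k - c) \<in> {..<mu}"
      by (simp_all only: of_nat_eq_iff lessThan_iff)
    then show "n \<in> ?g ` {..<mu}" by (rule image_eqI)
  next
    fix n assume "n \<in> ?g ` {..<mu}"
    then obtain t where t: "n = ?g t" "t < mu" by auto
    have nn: "int n = a - b + int (valency u) * (int t + c)" using g t by simp
    have "int (valency u) * (int t + c) \<le> int (valency u) * (int mu - 1 + c)"
      using t by (intro mult_left_mono) auto
    then have "int n < int (valency u) * int mu"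
      using nn a b by (auto simp: c_def algebra_simps split: if_splits)
    then have "n < M" unfolding M_def by (metis of_nat_less_iff of_nat_mult)
    moreover have "cyc_edge u (a - int n) = cyc_edge u b"
      using minus_mult_mod[of b "int (valency u)" "int t + c"] unfolding nn cyc_edge_eq_iff by (simp add: algebra_simps)
    ultimately show "n \<in> {n. n < M \<and> (cw u ^^ n) i = j}"
      using a b by (simp add: cw_funpow_cyc_edge)
  qed
  have inj: "inj_on ?g {..<mu}"
  proof (rule inj_onI)
    fix t t' assume "?g t = ?g t'"
    then have "int (?g t) = int (?g t')" by simp
    then show "t = t'" unfolding g using valency_pos by simp
  qed
  have "(\<Sum>n | n < M \<and> (cw u ^^ n) i = j. q_pow (path_degree \<Gamma> s (turn \<Gamma> u i n)))
    = (\<Sum>t<mu. q_pow (path_degree \<Gamma> s (turn \<Gamma> u i (?g t))))"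
    unfolding eq using sum.reindex[OF inj] by (simp add: o_def)
  also have "\<dots> = (\<Sum>t<mu. weight 1 i * weight (- 1) j * q_pow (Q * int t) * q_pow (Q * c))"
  proof (rule sum.cong[OF refl])
    fix t assume "t \<in> {..<mu}"
    then have t: "(cw u ^^ ?g t) i = j" using eq by blast
    have z: "a - int (?g t) = b - int (valency u) * (int t + c)" unfolding g by simp
    have edj: "cyc_edge u (b - int (valency u) * (int t + c)) = j"
      using t a cw_funpow_cyc_edge[of "?g t" a] unfolding z by simp
    then have "path_degree \<Gamma> s (turn \<Gamma> u i (?g t)) =
      (if u = x then int (N i) - int (N j) else 0) + Q * (int t + c)"
      unfolding a(3) turn_degree z div_ab edj by simp
    then show "q_pow (path_degree \<Gamma> s (turn \<Gamma> u i (?g t)))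
      = weight 1 i * weight (- 1) j * q_pow (Q * int t) * q_pow (Q * c)"
      by (simp add: weight_def algebra_simps flip: q_pow_add)
  qed
  also have "\<dots> = weight 1 i * weight (- 1) j * (vertex_sum * q_pow (Q * c))"
    by (simp add: vertex_sum_def sum_distrib_left sum_distrib_right mult.assoc)
  \<comment> \<open>Positions and numbers order the edges at u in the same way, so c = 1 exactly if
    i has the smaller number; the extra factor then adds q^(me) - 1.\<close>
  also have "vertex_sum * q_pow (Q * c) = vertex_sum + (if N i < N j then q_pow (int (m * e)) - 1 else 0)"
    using green_number_cyc_edge_less_iff[OF a(1,2) b(1,2)] vertex_sum_Q a b by (simp add: c_def)
  finally show ?thesis .
qed

end

end

section \<open>The ideal of relations\<close>

lemma consecutive_distinct_fst:
  assumes "\<nexists>u. fst ` set p \<subseteq> {u}"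
  shows "\<exists>p1 a b p2. p = p1 @ [a, b] @ p2 \<and> fst a \<noteq> fst b"
proof (rule ccontr)
  assume "\<not> ?thesis"
  then have no: "p = p1 @ [a, b] @ p2 \<Longrightarrow> fst a = fst b" for p1 a b p2 by blast
  have "fst ` set p \<subseteq> {fst (hd p)}"
    using no
  proof (induction p rule: induct_list012)
    case (3 a b p)
    have "fst a = fst b" using "3.prems"[of "[]" a b p] by simp
    moreover have "fst ` set (b # p) \<subseteq> {fst (hd (b # p))}"
      by (rule "3.IH"(2)) (metis "3.prems" append_Cons)
    ultimately show ?case by simp
  qed auto
  then show False using assms by blast
qed

section \<open>Functions on paths as linear functionals on the path algebra\<close>

lemma keys_uminus: "Poly_Mapping.keys (- f) = Poly_Mapping.keys (f :: 'a \<Rightarrow>\<^sub>0 'b::ab_group_add)"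
  by (auto simp: in_keys_iff)

definition path_pairing :: "(('a, 'b) qpath \<Rightarrow>\<^sub>0 'k::field) \<Rightarrow> (('a, 'b) qpath \<Rightarrow> 'k) \<Rightarrow> 'k" where
  "path_pairing f g = (\<Sum>p\<in>Poly_Mapping.keys f. Poly_Mapping.lookup f p * g p)"

lemma path_pairing_eq_sum:
  assumes "finite K" "Poly_Mapping.keys f \<subseteq> K"
  shows "path_pairing f g = (\<Sum>p\<in>K. Poly_Mapping.lookup f p * g p)"
  unfolding path_pairing_def using assms by (intro sum.mono_neutral_left) (auto simp: in_keys_iff)

lemma path_pairing_add: "path_pairing (f + f') g = path_pairing f g + path_pairing f' g"
proof -
  let ?K = "Poly_Mapping.keys f \<union> Poly_Mapping.keys f'"
  have "Poly_Mapping.keys (f + f') \<subseteq> ?K" by (rule keys_add)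
  then show ?thesis
    by (subst (1 2 3) path_pairing_eq_sum[of ?K]) (auto simp: lookup_add distrib_right sum.distrib)
qed

lemma path_pairing_0 [simp]: "path_pairing 0 g = 0"
  by (simp add: path_pairing_def)

lemma path_pairing_single [simp]: "path_pairing (Poly_Mapping.single p c) g = c * g p"
  by (subst path_pairing_eq_sum[of "{p}"]) auto

lemma path_pairing_uminus: "path_pairing (- f) g = - path_pairing f g"
  using path_pairing_add[of "- f" f g] by (simp add: eq_neg_iff_add_eq_0)

lemma path_pairing_minus: "path_pairing (f - f') g = path_pairing f g - path_pairing f' g"
  using path_pairing_add[of f "- f'" g] by (simp add: path_pairing_uminus)

text \<open>Multiplication by a path is moved to the test function, which reduces closure of an
  annihilator under multiplication to a stability property of the functions.\<close>

lemma path_pairing_single_mult: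
  "path_pairing (path_mult (Poly_Mapping.single (i, p, j) c) f) g
   = path_pairing f (\<lambda>(i', p', j'). if j = i' then c * g (i, p @ p', j') else 0)"
proof (induction f rule: poly_mapping_single_induct)
  case (single t c')
  then show ?case by (cases t) (simp add: path_mult_single')
qed (simp_all add: path_mult_add_right path_pairing_add)

lemma path_pairing_mult_single:
  "path_pairing (path_mult f (Poly_Mapping.single (i', p', j') c)) g
   = path_pairing f (\<lambda>(i, p, j). if j = i' then c * g (i, p @ p', j') else 0)"
proof (induction f rule: poly_mapping_single_induct)
  case (single t c')
  then show ?case by (cases t) (simp add: path_mult_single')
qed (simp_all add: path_mult_add_left path_pairing_add)

context brauer
begin

abbreviation Qv :: "('v set, 'v arrow) pre_digraph" where "Qv \<equiv> bt_quiver \<Gamma>"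

lemma Qv_simps [simp]:
  "verts Qv = E" "(u, j) \<in> arcs Qv \<longleftrightarrow> has_cycle \<Gamma> u \<and> j \<in> E_at u"
  "tail Qv (u, j) = j" "head Qv (u, j) = cw u j"
  by (simp_all add: bt_quiver_def)

lemma has_cycle_in: "has_cycle \<Gamma> u \<Longrightarrow> u \<in> V"
  by (simp add: has_cycle_def)

sublocale finite_wf_quiver Qv
proof
  show "finite (verts Qv)" using finite_E by simp
  fix a assume "a \<in> arcs Qv"
  then show "head Qv a \<in> verts Qv"
    using cw_funpow_in[of "fst a" "snd a" 1] has_cycle_in[of "fst a"] by (cases a) (auto simp: E_at_iff)
qed

section \<open>Paths around a single vertex\<close>

lemma turn_in_qpaths:
  assumes "has_cycle \<Gamma> u" "j \<in> E_at u"
  shows "turn \<Gamma> u j n \<in> qpaths Qv"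
proof -
  have in_E: "(cw u ^^ i) j \<in> E_at u" for i
    using cw_funpow_in assms has_cycle_in by blast
  have "pre_digraph.cas Qv j (map (\<lambda>i. (u, (cw u ^^ i) j)) [0..<n]) ((cw u ^^ n) j)"
    by (induction n) (auto simp: cas_append pre_digraph.cas.simps)
  then show ?thesis using assms in_E by (auto simp: turn_def qpaths_iff E_at_iff)
qed

lemma turn_Suc: "turn \<Gamma> u j (Suc n) = (j, (u, j) # fst (snd (turn \<Gamma> u (cw u j) n)), (cw u ^^ Suc n) j)"
  by (auto simp: turn_def upt_conv_Cons funpow_swap1 simp flip: map_Suc_upt simp del: upt_Suc)

text \<open>Each edge is the source of only one arrow of the cycle at u, so source and length
  determine the path. For the trivial path u is arbitrary.\<close>

lemma path_is_turn:
  assumes "(i, p, j) \<in> qpaths Qv" "fst ` set p \<subseteq> {u}"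
  shows "(i, p, j) = turn \<Gamma> u i (length p)"
  using assms
proof (induction p arbitrary: i)
  case Nil
  then show ?case by (simp add: qpaths_iff pre_digraph.cas.simps turn_def)
next
  case (Cons a p)
  obtain k where a: "a = (u, k)" using Cons.prems by (cases a) auto
  have k: "k = i" "has_cycle \<Gamma> u" "i \<in> E_at u" "pre_digraph.cas Qv (cw u i) p j" "set p \<subseteq> arcs Qv"
    using Cons.prems(1) by (auto simp: a qpaths_iff pre_digraph.cas.simps)
  then have "(cw u i, p, j) \<in> qpaths Qv"
    using heads[of a] a by (auto simp: qpaths_iff)
  then have "(cw u i, p, j) = turn \<Gamma> u (cw u i) (length p)"
    using Cons by simp
  then show ?case using k a by (simp add: turn_Suc) (simp add: turn_def funpow_swap1)
qed

lemma path_start: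
  assumes "(i, p, j) \<in> qpaths Qv" "fst ` set p \<subseteq> {u}" "p \<noteq> []"
  shows "has_cycle \<Gamma> u" "i \<in> E_at u"
  using assms by (cases p; auto simp: qpaths_iff pre_digraph.cas.simps)+

lemma qpaths_split:
  assumes "(i, p @ q, k) \<in> qpaths Qv"
  obtains j where "(i, p, j) \<in> qpaths Qv" "(j, q, k) \<in> qpaths Qv"
proof -
  obtain j where j: "pre_digraph.cas Qv i p j" "pre_digraph.cas Qv j q k"
    using assms by (auto simp: qpaths_iff cas_append)
  then have "(i, p, j) \<in> qpaths Qv" using assms by (auto simp: qpaths_iff)
  with cas_target[OF this heads] that j assms show thesis by (auto simp: qpaths_iff)
qed

text \<open>With inclusion in {u} instead of equality, a trivial path satisfies the condition for
  every u and so counts as nonzero.\<close>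

definition zero_path :: "('v set, 'v arrow) qpath \<Rightarrow> bool" where
  "zero_path = (\<lambda>(i, p, j). \<nexists>u. fst ` set p \<subseteq> {u} \<and> length p \<le> M u)"

definition full_turn :: "'v \<Rightarrow> 'v set \<Rightarrow> ('v set, 'v arrow) qpath" where
  "full_turn u j = turn \<Gamma> u j (M u)"

text \<open>As linear functionals on the path algebra, these are the ones that factor through the
  Brauer tree algebra.\<close>

definition invariant :: "(('v set, 'v arrow) qpath \<Rightarrow> 'k::field) \<Rightarrow> bool" where
  "invariant g \<longleftrightarrow> (\<forall>p\<in>qpaths Qv. zero_path p \<longrightarrow> g p = 0) \<and>
    (\<forall>u v j. has_cycle \<Gamma> u \<longrightarrow> has_cycle \<Gamma> v \<longrightarrow> j \<in> E_at u \<longrightarrow> j \<in> E_at v \<longrightarrow>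
       g (full_turn u j) = g (full_turn v j))"

lemma invariant_zero: "invariant g \<Longrightarrow> p \<in> qpaths Qv \<Longrightarrow> zero_path p \<Longrightarrow> g p = 0"
  by (simp add: invariant_def)

lemma invariant_full_turn:
  "invariant g \<Longrightarrow> has_cycle \<Gamma> u \<Longrightarrow> has_cycle \<Gamma> v \<Longrightarrow> j \<in> E_at u \<Longrightarrow> j \<in> E_at v \<Longrightarrow>
    g (full_turn u j) = g (full_turn v j)"
  unfolding invariant_def by blast

lemma zero_path_append:
  "zero_path (i, p, j) \<Longrightarrow> zero_path (i', q @ p, j')" "zero_path (i, p, j) \<Longrightarrow> zero_path (i', p @ q, j')"
  by (auto simp: zero_path_def image_Un) (meson add_leD2 add_leD1)+

lemma full_turn_eq:
  assumes "has_cycle \<Gamma> u" "j \<in> E_at u"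
  shows "full_turn u j = (j, map (\<lambda>i. (u, (cw u ^^ i) j)) [0..<M u], j)"
  using full_turn_target[OF has_cycle_in[OF assms(1)] assms(2)] by (simp add: full_turn_def turn_def)

lemma full_turn_in_qpaths: "has_cycle \<Gamma> u \<Longrightarrow> j \<in> E_at u \<Longrightarrow> full_turn u j \<in> qpaths Qv"
  unfolding full_turn_def by (rule turn_in_qpaths)

lemma zero_path_longer:
  assumes "fst ` set p = {u}" "length p > M u"
  shows "zero_path (i, p, j)"
  using assms by (auto simp: zero_path_def)

lemma zero_path_full_turn_append:
  assumes "has_cycle \<Gamma> u" "q \<noteq> []" "full_turn u j = (j, t, j)"
  shows "zero_path (i, q @ t, k)" "zero_path (i, t @ q, k)"
proof -
  have t: "fst ` set t = {u}" "length t = M u"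
    using assms(3) M_pos[OF has_cycle_in[OF assms(1)]]
    by (auto simp: full_turn_def turn_def image_image)
  show "zero_path (i, q @ t, k)" "zero_path (i, t @ q, k)"
    using t assms(2) by (auto simp: zero_path_def image_Un)
qed

text \<open>Prolonging zero paths gives zero paths. A full turn prolonged by a nontrivial path is a
  zero path as well, so both full turns at an edge get the value 0; prolonging by a trivial path
  changes nothing but the scalar.\<close>

lemma invariant_mult_left:
  fixes g :: "('v set, 'v arrow) qpath \<Rightarrow> 'k::field"
  assumes "invariant g" "(i, p, j) \<in> qpaths Qv"
  shows "invariant (\<lambda>(i', p', j'). if j = i' then c * g (i, p @ p', j') else 0)" (is "invariant ?h")
  unfolding invariant_def
proof (intro conjI ballI allI impI)
  fix t assume "t \<in> qpaths Qv" "zero_path t"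
  then show "?h t = 0"
    by (cases t)
      (simp add: invariant_zero[OF assms(1)] qpaths_append[OF assms(2)] zero_path_append(1))
next
  fix u v k assume uv: "has_cycle \<Gamma> u" "has_cycle \<Gamma> v" "k \<in> E_at u" "k \<in> E_at v"
  obtain t t' where t: "full_turn u k = (k, t, k)" "full_turn v k = (k, t', k)"
    using full_turn_eq uv by blast
  have tq: "(k, t, k) \<in> qpaths Qv" "(k, t', k) \<in> qpaths Qv"
    using full_turn_in_qpaths[OF uv(1,3)] full_turn_in_qpaths[OF uv(2,4)] by (simp_all add: t)
  show "?h (full_turn u k) = ?h (full_turn v k)"
  proof (cases "j = k")
    case True
    show ?thesis
    proof (cases "p = []")
      case True
      then have "i = k" using assms(2) \<open>j = k\<close> by (simp add: qpaths_iff pre_digraph.cas.simps)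
      have "g (full_turn u k) = g (full_turn v k)" by (rule invariant_full_turn[OF assms(1) uv])
      then show ?thesis using True \<open>i = k\<close> by (simp add: t)
    next
      case False
      have "g (i, p @ t, k) = 0" "g (i, p @ t', k) = 0"
        using tq assms(2) True zero_path_full_turn_append(1)[OF uv(1) False t(1)]
          zero_path_full_turn_append(1)[OF uv(2) False t(2)]
        by (auto intro!: invariant_zero[OF assms(1)] qpaths_append)
      then show ?thesis by (simp add: t)
    qed
  qed (simp add: t)
qed

lemma invariant_mult_right:
  fixes g :: "('v set, 'v arrow) qpath \<Rightarrow> 'k::field"
  assumes "invariant g" "(i', p', j') \<in> qpaths Qv"
  shows "invariant (\<lambda>(i, p, j). if j = i' then c * g (i, p @ p', j') else 0)" (is "invariant ?h")
  unfolding invariant_def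
proof (intro conjI ballI allI impI)
  fix t assume "t \<in> qpaths Qv" "zero_path t"
  then show "?h t = 0"
    by (cases t)
      (auto intro!: disjI2 invariant_zero[OF assms(1)] qpaths_append[OF _ assms(2)] zero_path_append(2))
next
  fix u v k assume uv: "has_cycle \<Gamma> u" "has_cycle \<Gamma> v" "k \<in> E_at u" "k \<in> E_at v"
  obtain t t' where t: "full_turn u k = (k, t, k)" "full_turn v k = (k, t', k)"
    using full_turn_eq uv by blast
  have tq: "(k, t, k) \<in> qpaths Qv" "(k, t', k) \<in> qpaths Qv"
    using full_turn_in_qpaths[OF uv(1,3)] full_turn_in_qpaths[OF uv(2,4)] by (simp_all add: t)
  show "?h (full_turn u k) = ?h (full_turn v k)"
  proof (cases "k = i'")
    case True
    show ?thesis
    proof (cases "p' = []")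
      case True
      then have "j' = k" using assms(2) \<open>k = i'\<close> by (simp add: qpaths_iff pre_digraph.cas.simps)
      have "g (full_turn u k) = g (full_turn v k)" by (rule invariant_full_turn[OF assms(1) uv])
      then show ?thesis using True \<open>j' = k\<close> by (auto simp: t)
    next
      case False
      have "g (k, t @ p', j') = 0" "g (k, t' @ p', j') = 0"
        using tq assms(2) True zero_path_full_turn_append(2)[OF uv(1) False t(1)]
          zero_path_full_turn_append(2)[OF uv(2) False t(2)]
        by (auto intro!: invariant_zero[OF assms(1)] qpaths_append)
      then show ?thesis unfolding t using True by simp
    qed
  qed (simp add: t)
qed

lemma M_le: "u \<in> V \<Longrightarrow> M u \<le> m * e"
proof -
  have "valency u \<le> e" unfolding valency_def card_E[symmetric] by (rule card_mono[OF finite_E]) (auto simp: E_at_iff)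
  moreover assume "u \<in> V"
  ultimately show ?thesis
    using mult_le_mono[of "valency u" e "mu u" m] m_pos by (simp add: M_def mu_def mult.commute)
qed

lemma M_cases: "u \<in> V \<Longrightarrow> u \<noteq> x \<Longrightarrow> card (E_at u) = M u" "m * card (E_at x) = M x"
  using x_in by (simp_all add: M_def valency_def mu_def)

end

text \<open>The otherwise unused parameter \<open>k\<close> pins down the type of the coefficients.\<close>

locale brauer_over = brauer \<Gamma> s m e
  for \<Gamma> :: "'v brauer_tree" and s :: "'v set" and m e :: nat +
  fixes k :: "'k::field itself"
begin

abbreviation kQ :: "(('v set, 'v arrow) qpath \<Rightarrow>\<^sub>0 'k) ring" where
  "kQ \<equiv> path_algebra (bt_quiver \<Gamma>)"

abbreviation sg :: "('v set, 'v arrow) qpath \<Rightarrow> 'k \<Rightarrow> (('v set, 'v arrow) qpath \<Rightarrow>\<^sub>0 'k)" where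
  "sg \<equiv> Poly_Mapping.single"

sublocale kQ: ring kQ
  by (rule ring_path_algebra)

lemma kQ_uminus: "f \<in> carrier kQ \<Longrightarrow> \<ominus>\<^bsub>kQ\<^esub> f = - f"
  using kQ.minus_equality[of "- f" f] by (simp add: carrier_iff keys_uminus)

text \<open>An upper bound for the ideal generated by the relations; it certifies that an element
  lies outside that ideal.\<close>

definition annihilator :: "(('v set, 'v arrow) qpath \<Rightarrow>\<^sub>0 'k) set" where
  "annihilator = {f \<in> carrier kQ. \<forall>g. invariant g \<longrightarrow> path_pairing f g = 0}"

lemma annihilatorD: "f \<in> annihilator \<Longrightarrow> invariant g \<Longrightarrow> path_pairing f g = 0"
  by (simp add: annihilator_def)

lemma ideal_annihilator: "ideal annihilator kQ"
proof (rule idealI)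
  show "ring kQ" by (rule kQ.ring_axioms)
  show "subgroup annihilator (add_monoid kQ)"
  proof (rule kQ.add.subgroupI)
    have "0 \<in> annihilator" by (simp add: annihilator_def carrier_iff)
    then show "annihilator \<noteq> {}" by blast
    fix f assume f: "f \<in> annihilator"
    then have fc: "f \<in> carrier kQ" and "- f \<in> annihilator"
      by (simp_all add: annihilator_def carrier_iff keys_uminus path_pairing_uminus)
    then show "\<ominus>\<^bsub>kQ\<^esub> f \<in> annihilator"
      unfolding kQ_uminus[OF fc] by blast
  qed (auto simp: annihilator_def path_pairing_add carrier_add)
next
  fix f h
  assume f: "f \<in> annihilator" and h: "h \<in> carrier kQ"
  show "h \<otimes>\<^bsub>kQ\<^esub> f \<in> annihilator"
    using h
  proof (induction h rule: carrier_induct)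
    case (single i p j c)
    then show ?case
      using f invariant_mult_left[OF _ single]
      by (auto simp: annihilator_def path_pairing_single_mult intro!: carrier_mult single_in_carrier)
  qed (use f in \<open>auto simp: annihilator_def path_mult_add_left path_pairing_add intro: carrier_add\<close>)
  show "f \<otimes>\<^bsub>kQ\<^esub> h \<in> annihilator"
    using h
  proof (induction h rule: carrier_induct)
    case (single i p j c)
    then show ?case
      using f invariant_mult_right[OF _ single]
      by (auto simp: annihilator_def path_pairing_mult_single intro!: carrier_mult single_in_carrier)
  qed (use f in \<open>auto simp: annihilator_def path_mult_add_right path_pairing_add intro: carrier_add\<close>)
qed

lemma single_in_annihilator:
  assumes "p \<in> qpaths Qv" "zero_path p" shows "sg p c \<in> annihilator"
  using assms by (simp add: annihilator_def single_in_carrier invariant_zero)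

lemma full_turn_diff_in_annihilator:
  assumes "has_cycle \<Gamma> u" "has_cycle \<Gamma> v" "j \<in> E_at u" "j \<in> E_at v"
  shows "sg (full_turn u j) 1 - sg (full_turn v j) 1 \<in> annihilator"
proof -
  have "sg (full_turn u j) 1 - sg (full_turn v j) 1 \<in> carrier kQ"
    using kQ.minus_closed[of "sg (full_turn u j) 1" "sg (full_turn v j) 1"] kQ_uminus
      full_turn_in_qpaths assms by (simp add: a_minus_def single_in_carrier)
  then show ?thesis
    using invariant_full_turn[OF _ assms] by (auto simp: annihilator_def path_pairing_minus)
qed

lemma turn_too_long:
  assumes "u \<in> V" shows "zero_path (turn \<Gamma> u j (M u + 1))"
  unfolding turn_def by (rule zero_path_longer) (auto simp: image_image)

lemma relations_in_annihilator: "brauer_relations \<Gamma> \<subseteq> annihilator"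
proof (cases "\<forall>j\<in>E. x \<in> j")
  case True
  have "zero_path (i, p, j)" if "(i, p, j) \<in> qpaths Qv" "length p = m * e + 1" for i p j
  proof -
    \<comment> \<open>A nonempty path can run around u only if u has a cycle, and \<open>M u\<close>
      is then at most m e.\<close>
    have "length p > M u" if "fst ` set p \<subseteq> {u}" for u
    proof -
      have "p \<noteq> []" using \<open>length p = m * e + 1\<close> by auto
      then have "has_cycle \<Gamma> u" using path_start[OF \<open>(i, p, j) \<in> qpaths Qv\<close> that] by blast
      from M_le[OF has_cycle_in[OF this]] show ?thesis using \<open>length p = m * e + 1\<close> by simp
    qed
    then show ?thesis by (fastforce simp: zero_path_def)
  qed
  then show ?thesis
    using True by (auto simp: brauer_relations_def mult card_E Let_def intro!: single_in_annihilator)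
next
  case False
  have 1: "path_elem (i, [a, b], j) \<in> annihilator"
    if "(i, [a, b], j) \<in> qpaths Qv" "fst a \<noteq> fst b" for i a b j
    using that by (intro single_in_annihilator) (auto simp: zero_path_def)
  have 2: "path_elem (turn \<Gamma> u j (card (E_at u))) - path_elem (turn \<Gamma> v j (card (E_at v))) \<in> annihilator"
    if "has_cycle \<Gamma> u" "has_cycle \<Gamma> v" "u \<noteq> x" "v \<noteq> x" "j \<in> E_at u" "j \<in> E_at v" for u v j
    using full_turn_diff_in_annihilator[of u v j] M_cases(1) has_cycle_in that
    by (simp add: full_turn_def)
  have 3: "path_elem (turn \<Gamma> x j (m * card (E_at x))) - path_elem (turn \<Gamma> v j (card (E_at v))) \<in> annihilator"
    if "has_cycle \<Gamma> x" "has_cycle \<Gamma> v" "v \<noteq> x" "j \<in> E_at x" "j \<in> E_at v" for v j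
    using full_turn_diff_in_annihilator[of x v j] M_cases has_cycle_in that
    by (simp add: full_turn_def)
  have 4: "path_elem (turn \<Gamma> u j (card (E_at u) + 1)) \<in> annihilator"
    if "has_cycle \<Gamma> u" "u \<noteq> x" "j \<in> E_at u" for u j
    unfolding M_cases(1)[OF has_cycle_in[OF that(1)] that(2)]
    using that by (intro single_in_annihilator turn_in_qpaths turn_too_long has_cycle_in)
  have 5: "path_elem (turn \<Gamma> x j (m * card (E_at x) + 1)) \<in> annihilator"
    if "has_cycle \<Gamma> x" "j \<in> E_at x" for j
    unfolding M_cases(2)
    using that by (intro single_in_annihilator turn_in_qpaths turn_too_long has_cycle_in)
  show ?thesis
    using False unfolding brauer_relations_def Let_def mult if_not_P[OF False]
    by (intro Un_least subsetI) (use 1 2 3 4 5 in \<open>blast+\<close>)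
qed

section \<open>Paths modulo the relations\<close>

abbreviation I :: "(('v set, 'v arrow) qpath \<Rightarrow>\<^sub>0 'k) set" where
  "I \<equiv> brauer_ideal \<Gamma>"

lemma relations_carrier: "brauer_relations \<Gamma> \<subseteq> carrier kQ"
  using relations_in_annihilator by (auto simp: annihilator_def)

lemma ideal_I: "ideal I kQ"
  unfolding brauer_ideal_def by (rule kQ.genideal_ideal[OF relations_carrier])

lemma I_subset: "I \<subseteq> annihilator"
  unfolding brauer_ideal_def by (rule kQ.genideal_minimal[OF ideal_annihilator relations_in_annihilator])

lemma relations_in_I: "brauer_relations \<Gamma> \<subseteq> I"
  unfolding brauer_ideal_def by (rule kQ.genideal_self[OF relations_carrier])

sublocale I: ideal I kQ
  by (rule ideal_I)

lemma single_in_I_infix: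
  assumes "(i, p1 @ p @ p2, j) \<in> qpaths Qv"
    and "\<And>k l. (k, p, l) \<in> qpaths Qv \<Longrightarrow> sg (k, p, l) 1 \<in> I"
  shows "sg (i, p1 @ p @ p2, j) c \<in> I"
proof -
  obtain k l where kl: "(i, p1, k) \<in> qpaths Qv" "(k, p, l) \<in> qpaths Qv" "(l, p2, j) \<in> qpaths Qv"
    using assms(1) by (metis qpaths_split)
  have "path_mult (path_mult (sg (i, p1, k) c) (sg (k, p, l) 1)) (sg (l, p2, j) 1) \<in> I"
    using I.I_r_closed[of "path_mult (sg (i, p1, k) c) (sg (k, p, l) 1)" "sg (l, p2, j) 1"]
      I.I_l_closed[of "sg (k, p, l) 1" "sg (i, p1, k) c"] assms(2)[OF kl(2)] kl
    by (simp add: single_in_carrier)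
  then show ?thesis by (simp add: path_mult_single')
qed

text \<open>Two edges at a vertex other than \<open>x\<close> would both join it to
  \<open>x\<close>.\<close>

lemma star_cycle:
  assumes "\<forall>j\<in>E. x \<in> j" "has_cycle \<Gamma> u" shows "u = x"
proof (rule ccontr)
  assume "u \<noteq> x"
  then have "card (E_at u) \<ge> 2" using assms(2) by (simp add: has_cycle_def)
  then obtain j k where "j \<in> E_at u" "k \<in> E_at u" "j \<noteq> k"
    using card_le_Suc0_iff_eq[OF finite_E_at, of u] by fastforce
  then show False using common_vertex_unique[of j k u x] \<open>u \<noteq> x\<close> assms(1) by (auto simp: E_at_iff)
qed

text \<open>Either two consecutive arrows come from different vertices, or all arrows come from one
  vertex and the path is too long. In both cases some subpath is a generator. The first case cannot
  occur in a star, where all arrows come from \<open>x\<close>.\<close>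

lemma zero_path_in_I:
  assumes "(i, p, j) \<in> qpaths Qv" "zero_path (i, p, j)"
  shows "sg (i, p, j) c \<in> I"
proof (cases "\<exists>u. fst ` set p \<subseteq> {u}")
  case False
  have nonstar: "\<not> (\<forall>j\<in>E. x \<in> j)"
  proof
    assume "\<forall>j\<in>E. x \<in> j"
    then have "fst ` set p \<subseteq> {x}" using assms(1) star_cycle by (auto simp: qpaths_iff)
    then show False using False by blast
  qed
  obtain p1 a b p2 where p: "p = p1 @ [a, b] @ p2" "fst a \<noteq> fst b"
    using consecutive_distinct_fst[of p] False by blast
  show ?thesis
    unfolding p(1)
  proof (rule single_in_I_infix)
    fix k l assume "(k, [a, b], l) \<in> qpaths Qv"
    then show "sg (k, [a, b], l) 1 \<in> I"
      using p(2) by (intro subsetD[OF relations_in_I])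
        (unfold brauer_relations_def Let_def if_not_P[OF nonstar], blast)
  qed (use assms p in simp)
next
  case True
  then obtain u where u: "fst ` set p \<subseteq> {u}" by blast
  moreover have "\<not> (fst ` set p \<subseteq> {u} \<and> length p \<le> M u)"
    using assms(2) by (simp add: zero_path_def)
  ultimately have len: "length p > M u" by simp
  then have "p \<noteq> []" by auto
  note start = path_start[OF assms(1) u this]
  \<comment> \<open>The generators concern paths of length exactly \<open>M u + 1\<close>, so the
    path is cut there.\<close>
  define p' where "p' = take (M u + 1) p"
  have p: "p = [] @ p' @ drop (M u + 1) p" by (simp add: p'_def)
  have lenp': "length p' = M u + 1" using len by (simp add: p'_def)
  have up': "fst ` set p' \<subseteq> {u}" using u by (auto simp: p'_def dest: in_set_takeD)
  show ?thesis
  proof (subst p, rule single_in_I_infix)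
    fix k l assume kl: "(k, p', l) \<in> qpaths Qv"
    have turn: "(k, p', l) = turn \<Gamma> u k (M u + 1)" using path_is_turn[OF kl up'] lenp' by simp
    have "p' \<noteq> []" using lenp' by auto
    then have "k \<in> E_at u" by (rule path_start(2)[OF kl up'])
    have "sg (k, p', l) 1 \<in> brauer_relations \<Gamma>"
    proof (cases "\<forall>j\<in>E. x \<in> j")
      case star: True
      then have "u = x" using star_cycle start(1) by blast
      have "E_at x = E" using star by (auto simp: E_at_iff)
      then have "M u = m * e" using \<open>u = x\<close> M_cases(2) card_E by simp
      then show ?thesis
        unfolding brauer_relations_def Let_def if_P[OF star] mult card_E using kl lenp' by auto
    next
      case nonstar: False
      show ?thesis
      proof (cases "u = x")
        case True
        then show ?thesis
          unfolding brauer_relations_def Let_def if_not_P[OF nonstar] mult M_cases(2) turn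
          using start(1) \<open>k \<in> E_at u\<close> by blast
      next
        case False
        then have "M u = card (E_at u)" using M_cases(1) start(1) has_cycle_in by simp
        then show ?thesis
          unfolding brauer_relations_def Let_def if_not_P[OF nonstar] turn
          using start(1) \<open>k \<in> E_at u\<close> False by auto
      qed
    qed
    then show "sg (k, p', l) 1 \<in> I" using relations_in_I by blast
  qed (use assms p in simp)
qed

lemma full_turn_diff_in_I:
  assumes "has_cycle \<Gamma> u" "has_cycle \<Gamma> v" "j \<in> E_at u" "j \<in> E_at v"
  shows "sg (full_turn u j) 1 - sg (full_turn v j) 1 \<in> I"
proof -
  \<comment> \<open>The relations put the exceptional vertex first, hence the restriction on v; the
    other order follows by negation. Since only \<open>x\<close> has a cycle in a star, the general
    list of relations applies.\<close>
  have *: "sg (full_turn u j) 1 - sg (full_turn v j) 1 \<in> I"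
    if "v \<noteq> x" "u \<noteq> v" and hyp: "has_cycle \<Gamma> u" "has_cycle \<Gamma> v" "j \<in> E_at u" "j \<in> E_at v" for u v
  proof -
    have nonstar: "\<not> (\<forall>j\<in>E. x \<in> j)" using star_cycle hyp that(1) by blast
    have Mv: "M v = card (E_at v)" using M_cases(1)[OF has_cycle_in[OF hyp(2)] that(1)] by simp
    have "sg (full_turn u j) 1 - sg (full_turn v j) 1 \<in> brauer_relations \<Gamma>"
    proof (cases "u = x")
      case True
      show ?thesis
        unfolding brauer_relations_def Let_def if_not_P[OF nonstar] mult M_cases(2) full_turn_def Mv
        using hyp that True by blast
    next
      case False
      have Mu: "M u = card (E_at u)" using M_cases(1)[OF has_cycle_in[OF hyp(1)] False] by simp
      show ?thesis
        unfolding brauer_relations_def Let_def if_not_P[OF nonstar] full_turn_def Mv Mu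
        using hyp that False by blast
    qed
    then show ?thesis using relations_in_I by blast
  qed
  consider "u = v" | "u \<noteq> v" "v \<noteq> x" | "u \<noteq> v" "v = x" by blast
  then show ?thesis
  proof cases
    case 1
    then show ?thesis using I.zero_closed by simp
  next
    case 2
    then show ?thesis using * assms by blast
  next
    case 3
    then have "sg (full_turn v j) 1 - sg (full_turn u j) 1 \<in> I" using *[of u v] assms by blast
    moreover have "f \<in> I \<Longrightarrow> - f \<in> I" for f
      using kQ_uminus[of f] I.a_inv_closed[of f] I.Icarr[of f] by simp
    ultimately show ?thesis by (metis minus_diff_eq)
  qed
qed

end

section \<open>Graded homomorphisms between projective modules\<close>

text \<open>For a Hom space the vector space axioms are not at hand. They are transported along T,
  which then is an isomorphism from k^n.\<close>

lemma dim_eq_by_coordinates: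
  fixes W :: "('k::field, 'b) module" and T :: "'k vec \<Rightarrow> 'b"
  assumes inj: "inj_on T (carrier_vec n)" and img: "T ` carrier_vec n = carrier W"
    and add: "\<And>c d. c \<in> carrier_vec n \<Longrightarrow> d \<in> carrier_vec n \<Longrightarrow> T (c + d) = T c \<oplus>\<^bsub>W\<^esub> T d"
    and smult: "\<And>a c. c \<in> carrier_vec n \<Longrightarrow> T (a \<cdot>\<^sub>v c) = a \<odot>\<^bsub>W\<^esub> T c"
    and zero: "T (0\<^sub>v n) = \<zero>\<^bsub>W\<^esub>"
  shows "vectorspace.dim (class_ring :: 'k ring) W = n"
proof -
  let ?K = "class_ring :: 'k ring" and ?V = "module_vec TYPE('k) n"
  have car: "w \<in> carrier W \<longleftrightarrow> (\<exists>c\<in>carrier_vec n. w = T c)" for w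
    unfolding img[symmetric] by blast
  have "abelian_group W"
  proof (rule abelian_groupI)
    show "\<zero>\<^bsub>W\<^esub> \<in> carrier W" unfolding zero[symmetric] img[symmetric] by simp
  next
    fix w assume "w \<in> carrier W"
    then obtain c where c: "c \<in> carrier_vec n" "w = T c" using car by blast
    have "T (- c) \<oplus>\<^bsub>W\<^esub> w = \<zero>\<^bsub>W\<^esub>"
      unfolding c(2) using c(1) by (simp add: zero flip: add)
    then show "\<exists>v\<in>carrier W. v \<oplus>\<^bsub>W\<^esub> w = \<zero>\<^bsub>W\<^esub>"
      using c(1) by (intro bexI[of _ "T (- c)"]) (auto simp: car)
    show "\<zero>\<^bsub>W\<^esub> \<oplus>\<^bsub>W\<^esub> w = w"
      unfolding c(2) zero[symmetric] using c(1) by (simp flip: add)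
  next
    fix w w' assume "w \<in> carrier W" "w' \<in> carrier W"
    then obtain c d where c: "c \<in> carrier_vec n" "d \<in> carrier_vec n" "w = T c" "w' = T d"
      using car by blast
    have "w \<oplus>\<^bsub>W\<^esub> w' = T (c + d)" using c by (simp add: add)
    then show "w \<oplus>\<^bsub>W\<^esub> w' \<in> carrier W" using c car by (metis add_carrier_vec)
    show "w \<oplus>\<^bsub>W\<^esub> w' = w' \<oplus>\<^bsub>W\<^esub> w" using c by (simp add: comm_add_vec[of c n d] flip: add)
  next
    fix w w' w'' assume "w \<in> carrier W" "w' \<in> carrier W" "w'' \<in> carrier W"
    then obtain c d f where c: "c \<in> carrier_vec n" "d \<in> carrier_vec n" "f \<in> carrier_vec n"
      "w = T c" "w' = T d" "w'' = T f" using car by metis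
    show "w \<oplus>\<^bsub>W\<^esub> w' \<oplus>\<^bsub>W\<^esub> w'' = w \<oplus>\<^bsub>W\<^esub> (w' \<oplus>\<^bsub>W\<^esub> w'')"
      using c by (simp add: assoc_add_vec[of c n d f] flip: add)
  qed
  then have mod: "Module.module ?K W"
  proof (rule moduleI[rotated])
    fix a b :: 'k and w w' assume "w \<in> carrier W" "w' \<in> carrier W"
    then obtain c d where c: "c \<in> carrier_vec n" "w = T c" "d \<in> carrier_vec n" "w' = T d" using car by blast
    show "a \<odot>\<^bsub>W\<^esub> w \<in> carrier W" unfolding c(2) using c(1) by (auto simp: car simp flip: smult)
    show "(a \<oplus>\<^bsub>?K\<^esub> b) \<odot>\<^bsub>W\<^esub> w = a \<odot>\<^bsub>W\<^esub> w \<oplus>\<^bsub>W\<^esub> b \<odot>\<^bsub>W\<^esub> w"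
      unfolding c(2) using c(1) by (simp add: add_smult_distrib_vec flip: smult add)
    show "a \<odot>\<^bsub>W\<^esub> (w \<oplus>\<^bsub>W\<^esub> w') = a \<odot>\<^bsub>W\<^esub> w \<oplus>\<^bsub>W\<^esub> a \<odot>\<^bsub>W\<^esub> w'"
      unfolding c(2,4) using c(1,3) by (simp add: smult_add_distrib_vec[of c n d] flip: smult add)
    show "(a \<otimes>\<^bsub>?K\<^esub> b) \<odot>\<^bsub>W\<^esub> w = a \<odot>\<^bsub>W\<^esub> (b \<odot>\<^bsub>W\<^esub> w)"
      unfolding c(2) using c(1) by (simp add: smult_smult_assoc flip: smult)
    show "\<one>\<^bsub>?K\<^esub> \<odot>\<^bsub>W\<^esub> w = w"
      unfolding c(2) using c(1) by (simp flip: smult)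
  qed (rule class_cring.is_cring)
  then interpret W: vectorspace ?K W
    by (simp add: vectorspace_def class_field)
  interpret V: vectorspace ?K ?V by (rule vec_vs)
  interpret linear_map ?K ?V W T
  proof unfold_locales
    show "T \<in> module_hom ?K ?V W"
      using add smult img by (auto simp: module_hom_def module_vec_def)
  qed
  have "V.fin_dim" by (rule vec_space.fin_dim)
  moreover have "inj_on T (carrier ?V)" "T ` carrier ?V = carrier W"
    using inj img by (simp_all add: module_vec_def)
  ultimately have "V.dim = W.dim" by (rule dim_eq)
  moreover have "V.dim = n" by (rule vec_space.dim_is_n)
  ultimately show ?thesis by simp
qed

lemma path_mult_minus_right: "path_mult f (g - g') = path_mult f g - path_mult f g'"
  using path_mult_add_right[of f "g - g'" g'] by simp

lemma path_mult_unit_right: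
  assumes "\<And>p. p \<in> Poly_Mapping.keys f \<Longrightarrow> snd (snd p) = j"
  shows "path_mult f (Poly_Mapping.single (j, [], j) 1) = f"
proof (induction f rule: poly_mapping_single_induct)
  case (single p c)
  then show ?case using assms by (cases p) (force simp: path_mult_single')
qed (simp_all add: path_mult_add_left)

lemma path_mult_unit_left:
  assumes "\<And>p. p \<in> Poly_Mapping.keys f \<Longrightarrow> fst p = i"
  shows "path_mult (Poly_Mapping.single (i, [], i) 1) f = f"
proof (induction f rule: poly_mapping_single_induct)
  case (single p c)
  then show ?case using assms by (cases p) (force simp: path_mult_single')
qed (simp_all add: path_mult_add_right)

context brauer
begin

section \<open>A basis of the algebra consisting of paths\<close>

definition chosen_end :: "'v set \<Rightarrow> 'v" where
  "chosen_end j = (SOME u. has_cycle \<Gamma> u \<and> j \<in> E_at u)"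

text \<open>Of the full turns at an edge, which all coincide in the quotient, only the one around
  the chosen end is kept.\<close>

definition basis_path :: "('v set, 'v arrow) qpath \<Rightarrow> bool" where
  "basis_path p \<longleftrightarrow> p \<in> qpaths Qv \<and> \<not> zero_path p \<and>
     (\<forall>u j. has_cycle \<Gamma> u \<longrightarrow> j \<in> E_at u \<longrightarrow> p = full_turn u j \<longrightarrow> u = chosen_end j)"

lemma chosen_end:
  assumes "has_cycle \<Gamma> u" "j \<in> E_at u"
  shows "has_cycle \<Gamma> (chosen_end j)" "j \<in> E_at (chosen_end j)"
  using someI_ex[of "\<lambda>u. has_cycle \<Gamma> u \<and> j \<in> E_at u"] assms unfolding chosen_end_def by blast+

lemma turn_inj:
  assumes "turn \<Gamma> u i n = turn \<Gamma> v j n'" "n > 0" shows "u = v" "i = j" "n = n'"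
proof -
  show "i = j" using assms by (simp add: turn_def)
  have "length (map (\<lambda>i. (u, (cw u ^^ i) j)) [0..<n]) = length (map (\<lambda>i. (v, (cw v ^^ i) j)) [0..<n'])"
    using assms \<open>i = j\<close> by (simp add: turn_def)
  then show n: "n = n'" by simp
  have "map (\<lambda>i. (u, (cw u ^^ i) j)) [0..<n] ! 0 = map (\<lambda>i. (v, (cw v ^^ i) j)) [0..<n] ! 0"
    using assms \<open>i = j\<close> n by (simp add: turn_def)
  then show "u = v" using assms(2) by simp
qed

lemma full_turn_inj:
  assumes "full_turn u i = full_turn v j" "has_cycle \<Gamma> u" shows "u = v" "i = j"
  using turn_inj[OF assms(1)[unfolded full_turn_def]] M_pos[OF has_cycle_in[OF assms(2)]] by simp_all

lemma nonzero_turn: "n \<le> M u \<Longrightarrow> \<not> zero_path (turn \<Gamma> u j n)"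
  by (auto simp: zero_path_def turn_def)

lemma nonzero_path_cases:
  assumes "(i, p, j) \<in> qpaths Qv" "\<not> zero_path (i, p, j)"
  obtains "p = []" "i = j" "i \<in> E" |
    u n where "has_cycle \<Gamma> u" "i \<in> E_at u" "0 < n" "n \<le> M u" "(i, p, j) = turn \<Gamma> u i n"
proof (cases "p = []")
  case True
  moreover from this have "i = j" "i \<in> E"
    using assms(1) by (auto simp: qpaths_iff pre_digraph.cas.simps)
  ultimately show ?thesis by (rule that(1))
next
  case False
  obtain u where u: "fst ` set p \<subseteq> {u}" "length p \<le> M u" using assms(2) by (auto simp: zero_path_def)
  show ?thesis
    using that(2)[OF path_start[OF assms(1) u(1) False] _ u(2) path_is_turn[OF assms(1) u(1)]] False by simp
qed

lemma basis_path_full_turn: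
  assumes "has_cycle \<Gamma> u" "j \<in> E_at u"
  shows "basis_path (full_turn (chosen_end j) j)"
  unfolding basis_path_def
proof (intro conjI allI impI)
  show "full_turn (chosen_end j) j \<in> qpaths Qv"
    by (rule full_turn_in_qpaths[OF chosen_end[OF assms]])
  show "\<not> zero_path (full_turn (chosen_end j) j)"
    unfolding full_turn_def by (rule nonzero_turn) simp
  fix u k assume "full_turn (chosen_end j) j = full_turn u k"
  from full_turn_inj[OF this chosen_end(1)[OF assms]] show "u = chosen_end k" by simp
qed

definition basis :: "'v set \<Rightarrow> 'v set \<Rightarrow> ('v set, 'v arrow) qpath set" where
  "basis i j = {p. basis_path p \<and> fst p = i \<and> snd (snd p) = j}"

lemma finite_basis: "finite (basis i j)"
proof (rule finite_subset)
  have "arcs Qv \<subseteq> V \<times> E" using has_cycle_in by (auto simp: bt_quiver_def E_at_iff)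
  then have fin: "finite (arcs Qv)" by (rule finite_subset) (simp add: finite_V finite_E)
  then show "finite ({i} \<times> {p. set p \<subseteq> arcs Qv \<and> length p \<le> m * e} \<times> {j})"
    by (simp add: finite_lists_length_le)
  show "basis i j \<subseteq> {i} \<times> {p. set p \<subseteq> arcs Qv \<and> length p \<le> m * e} \<times> {j}"
  proof
    fix b assume b: "b \<in> basis i j"
    then obtain p where p: "b = (i, p, j)" "(i, p, j) \<in> qpaths Qv" "\<not> zero_path (i, p, j)"
      by (cases b) (auto simp: basis_def basis_path_def)
    have "length p \<le> m * e"
      using p(2,3)
    proof (cases rule: nonzero_path_cases)
      case (2 u n)
      then have "length p = n" by (simp add: turn_def)
      then show ?thesis using 2 M_le[OF has_cycle_in[of u]] by simp
    qed simp
    then show "b \<in> {i} \<times> {p. set p \<subseteq> arcs Qv \<and> length p \<le> m * e} \<times> {j}"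
      using p by (auto simp: qpaths_iff)
  qed
qed

end

context brauer_over
begin

text \<open>The degree belongs to the claim: exchanging one full turn for another must stay in the
  homogeneous component.\<close>

lemma path_to_basis:
  assumes "(i, p, j) \<in> qpaths Qv" "sg (i, p, j) c \<notin> I"
  obtains b where "b \<in> basis i j" "path_degree \<Gamma> s b = path_degree \<Gamma> s (i, p, j)"
    "sg (i, p, j) c - sg b c \<in> I"
proof (cases "basis_path (i, p, j)")
  case True
  then show ?thesis using that[of "(i, p, j)"] I.zero_closed by (simp add: basis_def)
next
  case False
  then obtain u k where u: "has_cycle \<Gamma> u" "k \<in> E_at u" "(i, p, j) = full_turn u k"
    using assms zero_path_in_I unfolding basis_path_def by blast
  then have k: "i = k" "j = k" using full_turn_eq[OF u(1,2)] by auto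
  let ?v = "chosen_end k"
  note v = chosen_end[OF u(1,2)]
  obtain t where t: "full_turn ?v k = (k, t, k)" using full_turn_eq[OF v] by blast
  \<comment> \<open>The relation has coefficients 1 and -1; multiplying by a scaled trivial path
    brings in c.\<close>
  have "path_mult (sg (k, [], k) c) (sg (full_turn u k) 1 - sg (full_turn ?v k) 1) \<in> I"
    using I.I_l_closed[OF full_turn_diff_in_I[OF u(1) v(1) u(2) v(2)], of "sg (k, [], k) c"] u(2)
    by (simp add: single_in_carrier qpaths_iff pre_digraph.cas.simps E_at_iff)
  then have "sg (i, p, j) c - sg (full_turn ?v k) c \<in> I"
    using u(3) k by (simp add: path_mult_minus_right t path_mult_single' flip: u(3))
  moreover have "path_degree \<Gamma> s (full_turn ?v k) = path_degree \<Gamma> s (i, p, j)"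
    unfolding u(3) full_turn_def
    using full_turn_degree[OF has_cycle_in[OF u(1)] u(2)] full_turn_degree[OF has_cycle_in[OF v(1)] v(2)]
    by simp
  moreover have "full_turn ?v k \<in> basis i j"
    using basis_path_full_turn[OF u(1,2)] t k by (simp add: basis_def)
  ultimately show ?thesis using that by blast
qed

text \<open>The test function is the indicator of the class of b under the identification of full
  turns. It is invariant and so kills f, but b is the only basis path in its class, so the pairing
  is the coefficient of f at b.\<close>

lemma basis_independent:
  assumes "f \<in> I" "\<And>p. p \<in> Poly_Mapping.keys f \<Longrightarrow> basis_path p"
  shows "f = 0"
proof (rule poly_mapping_eqI)
  fix b
  show "Poly_Mapping.lookup f b = Poly_Mapping.lookup 0 b"
  proof (cases "b \<in> Poly_Mapping.keys f")
    case True
    then have b: "basis_path b" using assms(2) by simp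
    define eqv where "eqv p \<longleftrightarrow> p = b \<or> (\<exists>u v j. has_cycle \<Gamma> u \<and> has_cycle \<Gamma> v \<and> j \<in> E_at u \<and>
      j \<in> E_at v \<and> p = full_turn u j \<and> b = full_turn v j)" for p
    define g :: "('v set, 'v arrow) qpath \<Rightarrow> 'k" where "g p = (if eqv p then 1 else 0)" for p
    have "invariant g"
      unfolding invariant_def
    proof (intro conjI ballI allI impI)
      fix p assume "zero_path p"
      then have "\<not> eqv p"
        using b nonzero_turn unfolding eqv_def basis_path_def full_turn_def by blast
      then show "g p = 0" by (simp add: g_def)
    next
      fix u v j assume uv: "has_cycle \<Gamma> u" "has_cycle \<Gamma> v" "j \<in> E_at u" "j \<in> E_at v"
      have "eqv (full_turn v j)" if "eqv (full_turn u j)" "has_cycle \<Gamma> u" "has_cycle \<Gamma> v" "j \<in> E_at u" "j \<in> E_at v" for u v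
        using that full_turn_inj unfolding eqv_def by metis
      then have "eqv (full_turn u j) = eqv (full_turn v j)" using uv by blast
      then show "g (full_turn u j) = g (full_turn v j)" by (simp add: g_def)
    qed
    then have "0 = path_pairing f g" using assms(1) I_subset annihilatorD by fastforce
    also have "\<dots> = (\<Sum>p\<in>Poly_Mapping.keys f. if p = b then Poly_Mapping.lookup f b else 0)"
      unfolding path_pairing_def
    proof (rule sum.cong[OF refl])
      fix p assume "p \<in> Poly_Mapping.keys f"
      then have p: "basis_path p" using assms(2) by simp
      have "eqv p \<longleftrightarrow> p = b"
        using p b unfolding eqv_def basis_path_def by metis
      then show "Poly_Mapping.lookup f p * g p = (if p = b then Poly_Mapping.lookup f b else 0)"
        by (simp add: g_def)
    qed
    also have "\<dots> = Poly_Mapping.lookup f b" using True by simp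
    finally show ?thesis by simp
  qed (simp add: in_keys_iff)
qed

section \<open>The quotient algebra and its projective modules\<close>

abbreviation A :: "(('v set, 'v arrow) qpath \<Rightarrow>\<^sub>0 'k) set ring" where "A \<equiv> brauer_algebra \<Gamma>"
abbreviation \<pi> :: "(('v set, 'v arrow) qpath \<Rightarrow>\<^sub>0 'k) \<Rightarrow> (('v set, 'v arrow) qpath \<Rightarrow>\<^sub>0 'k) set" where
  "\<pi> \<equiv> brauer_proj \<Gamma>"
abbreviation \<epsilon> :: "'v set \<Rightarrow> (('v set, 'v arrow) qpath \<Rightarrow>\<^sub>0 'k)" where
  "\<epsilon> j \<equiv> sg (j, [], j) 1"

sublocale pi: ring_hom_ring kQ A \<pi>
proof -
  have "\<pi> = (+>\<^bsub>kQ\<^esub>) I" by (rule ext) (simp add: brauer_proj_def)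
  then show "ring_hom_ring kQ A \<pi>"
    unfolding brauer_algebra_def using I.rcos_ring_hom_ring by simp
qed

lemma carrier_A: "carrier A = \<pi> ` carrier kQ"
  by (auto simp: brauer_algebra_def FactRing_def A_RCOSETS_def' brauer_proj_def)

lemma pi_mult: "f \<in> carrier kQ \<Longrightarrow> g \<in> carrier kQ \<Longrightarrow> \<pi> f \<otimes>\<^bsub>A\<^esub> \<pi> g = \<pi> (path_mult f g)"
  using pi.hom_mult[of f g] by simp

lemma pi_add: "f \<in> carrier kQ \<Longrightarrow> g \<in> carrier kQ \<Longrightarrow> \<pi> f \<oplus>\<^bsub>A\<^esub> \<pi> g = \<pi> (f + g)"
  using pi.hom_add[of f g] by simp

lemma pi_0: "\<pi> 0 = \<zero>\<^bsub>A\<^esub>"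
  using pi.hom_zero by simp

lemma pi_eq_iff:
  assumes "f \<in> carrier kQ" "g \<in> carrier kQ"
  shows "\<pi> f = \<pi> g \<longleftrightarrow> f - g \<in> I"
  using kQ.quotient_eq_iff_same_a_r_cos[OF ideal_I assms] kQ_uminus[OF assms(2)]
  by (simp add: brauer_proj_def a_minus_def)

lemma unit_in_carrier: "j \<in> E \<Longrightarrow> \<epsilon> j \<in> carrier kQ"
  by (simp add: single_in_carrier qpaths_iff pre_digraph.cas.simps)

definition proj :: "'v set \<Rightarrow> (('v set, 'v arrow) qpath \<Rightarrow>\<^sub>0 'k) set set" where
  "proj j = (\<lambda>a. a \<otimes>\<^bsub>A\<^esub> \<pi> (\<epsilon> j)) ` carrier A"

lemma proj_module_eq:
  "(proj_module \<Gamma> s j :: (('v set, 'v arrow) qpath \<Rightarrow>\<^sub>0 'k) set graded)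
    = (proj j, \<lambda>n. proj j \<inter> brauer_grading \<Gamma> s n)"
  by (simp add: proj_module_def proj_def Let_def)

lemma unit_idem: "path_mult (\<epsilon> j) (\<epsilon> j) = \<epsilon> j"
  by (simp add: path_mult_single')

context
  fixes j assumes j: "j \<in> E"
begin

lemma pi_unit_closed: "\<pi> (\<epsilon> j) \<in> carrier A"
  using unit_in_carrier[OF j] by simp

text \<open>Right multiplication by an idempotent is a projection, so its image consists of its
  fixed points.\<close>

lemma proj_iff: "y \<in> proj j \<longleftrightarrow> y \<in> carrier A \<and> y \<otimes>\<^bsub>A\<^esub> \<pi> (\<epsilon> j) = y"
proof -
  have "\<pi> (\<epsilon> j) \<otimes>\<^bsub>A\<^esub> \<pi> (\<epsilon> j) = \<pi> (\<epsilon> j)"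
    using unit_in_carrier[OF j] by (simp add: pi_mult unit_idem)
  then have "a \<otimes>\<^bsub>A\<^esub> \<pi> (\<epsilon> j) \<otimes>\<^bsub>A\<^esub> \<pi> (\<epsilon> j) = a \<otimes>\<^bsub>A\<^esub> \<pi> (\<epsilon> j)" if "a \<in> carrier A" for a
    using that pi_unit_closed by (simp add: pi.S.m_assoc)
  then show ?thesis
    unfolding proj_def using pi_unit_closed by (auto intro: rev_image_eqI)
qed

lemma unit_in_proj: "\<pi> (\<epsilon> j) \<in> proj j"
  using unit_in_carrier[OF j] by (simp add: proj_iff pi_mult unit_idem)

lemma mult_in_proj: "a \<in> carrier A \<Longrightarrow> y \<in> proj j \<Longrightarrow> a \<otimes>\<^bsub>A\<^esub> y \<in> proj j"
  using pi_unit_closed by (auto simp: proj_iff pi.S.m_assoc)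

lemma add_in_proj: "y \<in> proj j \<Longrightarrow> z \<in> proj j \<Longrightarrow> y \<oplus>\<^bsub>A\<^esub> z \<in> proj j"
  using pi_unit_closed by (auto simp: proj_iff pi.S.l_distr)

lemma unit_in_grading: "\<pi> (\<epsilon> j) \<in> brauer_grading \<Gamma> s 0"
  unfolding brauer_grading_def using j
  by (intro imageI) (simp add: path_degree_def qpaths_iff pre_digraph.cas.simps)

end

lemma scalar_central:
  assumes "y \<in> carrier A" "z \<in> carrier A"
  shows "brauer_scalar \<Gamma> a \<otimes>\<^bsub>A\<^esub> (y \<otimes>\<^bsub>A\<^esub> z) = y \<otimes>\<^bsub>A\<^esub> (brauer_scalar \<Gamma> a \<otimes>\<^bsub>A\<^esub> z)"
proof -
  obtain f where f: "f \<in> carrier kQ" "y = \<pi> f"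
    using assms(1) unfolding carrier_A by (rule imageE)
  obtain g where g: "g \<in> carrier kQ" "z = \<pi> g"
    using assms(2) unfolding carrier_A by (rule imageE)
  have "path_mult (path_scalar Qv a) (path_mult f g) = path_mult f (path_mult (path_scalar Qv a) g)"
    unfolding path_mult_assoc[symmetric] scalar_commute[OF f(1)] ..
  then show ?thesis
    using f g by (simp add: brauer_scalar_def pi_mult carrier_mult carrier_scalar)
qed

section \<open>Homomorphisms of degree l as right multiplications\<close>

definition homog_basis :: "'v set \<Rightarrow> 'v set \<Rightarrow> int \<Rightarrow> ('v set, 'v arrow) qpath set" where
  "homog_basis i j l = {b \<in> basis i j. path_degree \<Gamma> s b = l}"

context
  fixes i j :: "'v set" and l :: int
  assumes i: "i \<in> E" and j: "j \<in> E"
begin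

lemma graded_hom_iff:
  "f \<in> graded_hom A (proj_module \<Gamma> s i) (shift (proj_module \<Gamma> s j) l) \<longleftrightarrow>
     f \<in> proj i \<rightarrow>\<^sub>E proj j \<and>
     (\<forall>y\<in>proj i. \<forall>z\<in>proj i. f (y \<oplus>\<^bsub>A\<^esub> z) = f y \<oplus>\<^bsub>A\<^esub> f z) \<and>
     (\<forall>a\<in>carrier A. \<forall>y\<in>proj i. f (a \<otimes>\<^bsub>A\<^esub> y) = a \<otimes>\<^bsub>A\<^esub> f y) \<and>
     (\<forall>n. f ` (proj i \<inter> brauer_grading \<Gamma> s n) \<subseteq> proj j \<inter> brauer_grading \<Gamma> s (l + n))"
  by (simp add: graded_hom_def proj_module_eq shift_def)

lemma right_mult_graded_hom:
  assumes z: "Poly_Mapping.keys z \<subseteq> homog_basis i j l"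
  shows "(\<lambda>y\<in>proj i. y \<otimes>\<^bsub>A\<^esub> \<pi> z) \<in> graded_hom A (proj_module \<Gamma> s i) (shift (proj_module \<Gamma> s j) l)"
proof -
  have zc: "z \<in> carrier kQ"
    using z by (auto simp: carrier_iff homog_basis_def basis_def basis_path_def)
  then have pz: "\<pi> z \<in> carrier A" by simp
  have "path_mult z (\<epsilon> j) = z"
    by (rule path_mult_unit_right) (use z in \<open>auto simp: homog_basis_def basis_def\<close>)
  then have pzj: "\<pi> z \<in> proj j"
    using zc unit_in_carrier[OF j] by (simp add: proj_iff[OF j] pi_mult)
  have car: "y \<in> carrier A" if "y \<in> proj i" for y using that by (simp add: proj_iff[OF i])
  have "y \<otimes>\<^bsub>A\<^esub> \<pi> z \<in> brauer_grading \<Gamma> s (l + n)" if y: "y \<in> brauer_grading \<Gamma> s n" for y n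
  proof -
    obtain f where f: "y = \<pi> f" "Poly_Mapping.keys f \<subseteq> {p \<in> qpaths Qv. path_degree \<Gamma> s p = n}"
      using y by (auto simp: brauer_grading_def)
    have "Poly_Mapping.keys (path_mult f z) \<subseteq> {p \<in> qpaths Qv. path_degree \<Gamma> s p = l + n}"
    proof
      fix p assume "p \<in> Poly_Mapping.keys (path_mult f z)"
      then show "p \<in> {p \<in> qpaths Qv. path_degree \<Gamma> s p = l + n}"
      proof (rule keys_path_mult)
        fix a p1 b p2 c assume *: "(a, p1, b) \<in> Poly_Mapping.keys f" "(b, p2, c) \<in> Poly_Mapping.keys z"
          "p = (a, p1 @ p2, c)"
        have "(b, p2, c) \<in> qpaths Qv" "path_degree \<Gamma> s (b, p2, c) = l"
          using z *(2) by (auto simp: homog_basis_def basis_def basis_path_def)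
        moreover have "(a, p1, b) \<in> qpaths Qv" "path_degree \<Gamma> s (a, p1, b) = n" using f(2) *(1) by auto
        ultimately show ?thesis unfolding *(3) by (auto simp: path_degree_def intro: qpaths_append)
      qed
    qed
    moreover have "y \<otimes>\<^bsub>A\<^esub> \<pi> z = \<pi> (path_mult f z)"
      unfolding f(1) using f(2) zc by (intro pi_mult) (auto simp: carrier_iff)
    ultimately show ?thesis unfolding brauer_grading_def by blast
  qed
  then show ?thesis
    unfolding graded_hom_iff
    using car pz pzj
    by (auto simp: add_in_proj[OF i] mult_in_proj[OF i] mult_in_proj[OF j] pi.S.l_distr pi.S.m_assoc)
qed

text \<open>This is Hom(A e_i, A e_j) = e_i A e_j by evaluation at the idempotent e_i. As e_i has
  degree 0, its image under a map into the module shifted by l has degree l.\<close>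

lemma graded_hom_determined:
  assumes f: "f \<in> graded_hom A (proj_module \<Gamma> s i) (shift (proj_module \<Gamma> s j) l)"
  obtains g where "Poly_Mapping.keys g \<subseteq> {p \<in> qpaths Qv. path_degree \<Gamma> s p = l}"
    and "f = (\<lambda>y\<in>proj i. y \<otimes>\<^bsub>A\<^esub> \<pi> (path_mult (path_mult (\<epsilon> i) g) (\<epsilon> j)))"
proof -
  note f = f[unfolded graded_hom_iff]
  let ?z = "f (\<pi> (\<epsilon> i))"
  have "?z \<in> proj j \<inter> brauer_grading \<Gamma> s (l + 0)"
    using f unit_in_proj[OF i] unit_in_grading[OF i] by blast
  then obtain g where g: "Poly_Mapping.keys g \<subseteq> {p \<in> qpaths Qv. path_degree \<Gamma> s p = l}" "?z = \<pi> g"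
    and zj: "?z \<in> proj j"
    by (auto simp: brauer_grading_def)
  have gc: "g \<in> carrier kQ" using g(1) by (auto simp: carrier_iff)
  have ei: "\<pi> (\<epsilon> i) \<in> carrier A" by (rule pi_unit_closed[OF i])
  \<comment> \<open>Linearity applied to e_i e_i = e_i shows that the image is fixed by e_i on the
    left; on the right it is fixed by e_j as an element of A e_j.\<close>
  have "\<pi> (\<epsilon> i) \<otimes>\<^bsub>A\<^esub> ?z = f (\<pi> (\<epsilon> i) \<otimes>\<^bsub>A\<^esub> \<pi> (\<epsilon> i))"
    using f ei unit_in_proj[OF i] by metis
  also have "\<dots> = ?z" using unit_in_proj[OF i] by (simp add: proj_iff[OF i])
  finally have "?z = \<pi> (\<epsilon> i) \<otimes>\<^bsub>A\<^esub> ?z \<otimes>\<^bsub>A\<^esub> \<pi> (\<epsilon> j)"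
    using zj by (simp add: proj_iff[OF j])
  also have "\<dots> = \<pi> (path_mult (path_mult (\<epsilon> i) g) (\<epsilon> j))"
    using gc unit_in_carrier[OF i] unit_in_carrier[OF j] by (simp add: g(2) pi_mult carrier_mult)
  finally have z: "?z = \<pi> (path_mult (path_mult (\<epsilon> i) g) (\<epsilon> j))" .
  have "f y = y \<otimes>\<^bsub>A\<^esub> ?z" if y: "y \<in> proj i" for y
  proof -
    have "y \<in> carrier A" "y \<otimes>\<^bsub>A\<^esub> \<pi> (\<epsilon> i) = y" using y by (simp_all add: proj_iff[OF i])
    then show ?thesis using f unit_in_proj[OF i] by metis
  qed
  then have "f = (\<lambda>y\<in>proj i. y \<otimes>\<^bsub>A\<^esub> ?z)"
    using f by (intro extensionalityI[of f "proj i"]) (auto simp: PiE_def)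
  then show thesis using that[OF g(1)] z by simp
qed

context
  fixes bs :: "('v set, 'v arrow) qpath list"
  assumes bs: "distinct bs" "set bs = homog_basis i j l"
begin

definition comb :: "'k vec \<Rightarrow> (('v set, 'v arrow) qpath \<Rightarrow>\<^sub>0 'k)" where
  "comb c = (\<Sum>t<length bs. sg (bs ! t) (c $ t))"

lemma keys_comb: "Poly_Mapping.keys (comb c) \<subseteq> homog_basis i j l"
  unfolding comb_def bs(2)[symmetric]
  by (rule order_trans[OF keys_sum]) (auto split: if_splits)

lemma comb_carrier: "comb c \<in> carrier kQ"
  using keys_comb by (fastforce simp: carrier_iff homog_basis_def basis_def basis_path_def)

lemma lookup_comb: "t < length bs \<Longrightarrow> Poly_Mapping.lookup (comb c) (bs ! t) = c $ t"
  using bs(1) by (simp add: comb_def lookup_sum lookup_single when_def nth_eq_iff_index_eq)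

lemma comb_0: "comb (0\<^sub>v (length bs)) = 0"
  by (simp add: comb_def)

lemma comb_add:
  "c \<in> carrier_vec (length bs) \<Longrightarrow> c' \<in> carrier_vec (length bs) \<Longrightarrow> comb (c + c') = comb c + comb c'"
  by (simp add: comb_def single_add sum.distrib)

lemma comb_smult:
  assumes "c \<in> carrier_vec (length bs)"
  shows "comb (a \<cdot>\<^sub>v c) = path_mult (path_scalar Qv a) (comb c)"
proof -
  have "bs ! t \<in> qpaths Qv" if "t < length bs" for t
    using nth_mem[OF that] unfolding bs(2) by (simp add: homog_basis_def basis_def basis_path_def)
  then have "path_mult (path_scalar Qv a) (sg (bs ! t) (c $ t)) = sg (bs ! t) (a * c $ t)"
    if "t < length bs" for t
    using that scalar_mult_single[of "fst (bs ! t)" "fst (snd (bs ! t))" "snd (snd (bs ! t))"] by simp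
  then show ?thesis using assms by (simp add: comb_def path_mult_sum_right)
qed

text \<open>By linearity only single paths matter: one with the right ends is zero or a basis path
  modulo the ideal, any other is killed by the idempotents. Membership in the carrier is carried
  along because \<open>pi_add\<close> requires it in the induction.\<close>

lemma comb_spans:
  assumes "Poly_Mapping.keys g \<subseteq> {p \<in> qpaths Qv. path_degree \<Gamma> s p = l}"
  shows "path_mult (path_mult (\<epsilon> i) g) (\<epsilon> j) \<in> carrier kQ \<and>
    (\<exists>c\<in>carrier_vec (length bs). \<pi> (path_mult (path_mult (\<epsilon> i) g) (\<epsilon> j)) = \<pi> (comb c))"
proof (induction g rule: poly_mapping_single_induct)
  case zero
  show ?case by (auto intro!: bexI[of _ "0\<^sub>v (length bs)"] simp: comb_0)
next
  case (single p a)
  obtain i' t j' where p: "p = (i', t, j')" by (cases p)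
  have pq: "(i', t, j') \<in> qpaths Qv" "path_degree \<Gamma> s (i', t, j') = l" using single assms p by auto
  have car: "path_mult (path_mult (\<epsilon> i) (sg p a)) (\<epsilon> j) \<in> carrier kQ"
    using pq(1) unit_in_carrier[OF i] unit_in_carrier[OF j] by (simp add: p carrier_mult single_in_carrier)
  have zero: ?case if "\<pi> (path_mult (path_mult (\<epsilon> i) (sg p a)) (\<epsilon> j)) = \<pi> 0"
    using that car by (intro conjI bexI[of _ "0\<^sub>v (length bs)"]) (simp_all only: comb_0 zero_carrier_vec)
  show ?case
  proof (cases "i' = i \<and> j' = j \<and> sg p a \<notin> I")
    case True
    then obtain b where b: "b \<in> basis i j" "path_degree \<Gamma> s b = l" "sg p a - sg b a \<in> I"
      using path_to_basis[of i t j a] pq unfolding p by metis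
    then have "b \<in> set bs" by (simp add: bs(2) homog_basis_def)
    then obtain t0 where t0: "t0 < length bs" "b = bs ! t0" by (auto simp: in_set_conv_nth)
    let ?c = "vec (length bs) (\<lambda>t. if t = t0 then a else 0)"
    have "comb ?c = (\<Sum>t<length bs. if t = t0 then sg b a else 0)"
      unfolding comb_def by (rule sum.cong) (auto simp: t0)
    then have "comb ?c = sg b a" using t0 by simp
    moreover have "\<pi> (sg p a) = \<pi> (sg b a)"
      using b pq by (subst pi_eq_iff) (auto simp: p basis_def basis_path_def intro!: single_in_carrier)
    ultimately have "\<pi> (path_mult (path_mult (\<epsilon> i) (sg p a)) (\<epsilon> j)) = \<pi> (comb ?c)"
      using True by (simp add: p path_mult_single')
    then show ?thesis using car by (intro conjI bexI[of _ ?c] vec_carrier)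
  next
    case False
    show ?thesis
    proof (rule zero, cases "i' = i \<and> j' = j")
      case True
      then have "sg p a - 0 \<in> I" using False by simp
      then have "\<pi> (sg p a) = \<pi> 0" using pq by (subst pi_eq_iff) (auto simp: p intro!: single_in_carrier)
      then show "\<pi> (path_mult (path_mult (\<epsilon> i) (sg p a)) (\<epsilon> j)) = \<pi> 0"
        using True by (simp add: p path_mult_single')
    next
      case False
      then have "path_mult (path_mult (\<epsilon> i) (sg p a)) (\<epsilon> j) = 0" by (auto simp: p path_mult_single')
      then show "\<pi> (path_mult (path_mult (\<epsilon> i) (sg p a)) (\<epsilon> j)) = \<pi> 0" by simp
    qed
  qed
next
  case (plus g h)
  then obtain c c' where c: "c \<in> carrier_vec (length bs)" "c' \<in> carrier_vec (length bs)"
    "\<pi> (path_mult (path_mult (\<epsilon> i) g) (\<epsilon> j)) = \<pi> (comb c)"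
    "\<pi> (path_mult (path_mult (\<epsilon> i) h) (\<epsilon> j)) = \<pi> (comb c')" by blast
  let ?X = "\<lambda>g. path_mult (path_mult (\<epsilon> i) g) (\<epsilon> j)"
  have X: "?X (g + h) = ?X g + ?X h" by (simp add: path_mult_add_left path_mult_add_right)
  have "\<pi> (?X (g + h)) = \<pi> (?X g) \<oplus>\<^bsub>A\<^esub> \<pi> (?X h)"
    unfolding X using plus by (simp add: pi_add)
  also have "\<dots> = \<pi> (comb (c + c'))"
    using c by (simp add: comb_add pi_add comb_carrier)
  finally show ?case
    using plus c(1,2) unfolding X by (intro conjI bexI[of _ "c + c'"]) (auto intro: carrier_add)
qed

lemma dim_graded_hom:
  "vectorspace.dim (class_ring :: 'k ring)
     (hom_space A (brauer_scalar \<Gamma>) (proj_module \<Gamma> s i) (shift (proj_module \<Gamma> s j) l)) = length bs"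
proof (rule dim_eq_by_coordinates)
  let ?T = "\<lambda>c. \<lambda>y\<in>proj i. y \<otimes>\<^bsub>A\<^esub> \<pi> (comb c)"
  let ?W = "hom_space A (brauer_scalar \<Gamma>) (proj_module \<Gamma> s i) (shift (proj_module \<Gamma> s j) l)"
  have W: "carrier ?W = graded_hom A (proj_module \<Gamma> s i) (shift (proj_module \<Gamma> s j) l)"
    "zero ?W = (\<lambda>y\<in>proj i. \<zero>\<^bsub>A\<^esub>)"
    "add ?W = (\<lambda>f g. \<lambda>y\<in>proj i. f y \<oplus>\<^bsub>A\<^esub> g y)"
    "Module.module.smult ?W = (\<lambda>c f. \<lambda>y\<in>proj i. brauer_scalar \<Gamma> c \<otimes>\<^bsub>A\<^esub> f y)"
    by (simp_all add: hom_space_def proj_module_eq)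
  have pc: "\<pi> (comb c) \<in> carrier A" for c using comb_carrier by simp
  have car: "y \<in> carrier A" if "y \<in> proj i" for y using that by (simp add: proj_iff[OF i])
  show "inj_on ?T (carrier_vec (length bs))"
  proof (rule inj_onI)
    fix c c' assume c: "c \<in> carrier_vec (length bs)" "c' \<in> carrier_vec (length bs)" "?T c = ?T c'"
    \<comment> \<open>All paths in \<open>comb c\<close> start at i, so evaluation at the idempotent
      of i recovers \<open>comb c\<close> modulo the ideal; independence of the basis then gives
      c.\<close>
    have keys: "p \<in> Poly_Mapping.keys (comb c) \<Longrightarrow> fst p = i" for p c
      using keys_comb[of c] by (auto simp: homog_basis_def basis_def)
    have "\<pi> (\<epsilon> i) \<otimes>\<^bsub>A\<^esub> \<pi> (comb c) = \<pi> (\<epsilon> i) \<otimes>\<^bsub>A\<^esub> \<pi> (comb c')"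
      using fun_cong[OF c(3), of "\<pi> (\<epsilon> i)"] unit_in_proj[OF i] by simp
    moreover have "\<pi> (\<epsilon> i) \<otimes>\<^bsub>A\<^esub> \<pi> (comb c) = \<pi> (comb c)" for c
      using keys by (simp add: pi_mult unit_in_carrier[OF i] comb_carrier path_mult_unit_left)
    ultimately have "comb c - comb c' \<in> I" using pi_eq_iff comb_carrier by metis
    moreover have "basis_path p" if "p \<in> Poly_Mapping.keys (comb c - comb c')" for p
    proof -
      have "p \<in> Poly_Mapping.keys (comb c) \<union> Poly_Mapping.keys (comb c')"
        using that by (auto simp: in_keys_iff lookup_minus)
      then show ?thesis using keys_comb[of c] keys_comb[of c'] by (auto simp: homog_basis_def basis_def)
    qed
    ultimately have "comb c = comb c'" using basis_independent[of "comb c - comb c'"] by simp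
    then show "c = c'"
      using c lookup_comb by (intro eq_vecI) (auto, metis)
  qed
  show "?T ` carrier_vec (length bs) = carrier ?W"
  proof (intro equalityI subsetI)
    fix f assume "f \<in> ?T ` carrier_vec (length bs)"
    then show "f \<in> carrier ?W" using right_mult_graded_hom keys_comb by (auto simp: W)
  next
    fix f assume "f \<in> carrier ?W"
    then have "f \<in> graded_hom A (proj_module \<Gamma> s i) (shift (proj_module \<Gamma> s j) l)" by (simp only: W)
    then show "f \<in> ?T ` carrier_vec (length bs)"
    proof (rule graded_hom_determined)
      fix g assume g: "Poly_Mapping.keys g \<subseteq> {p \<in> qpaths Qv. path_degree \<Gamma> s p = l}"
        and f: "f = (\<lambda>y\<in>proj i. y \<otimes>\<^bsub>A\<^esub> \<pi> (path_mult (path_mult (\<epsilon> i) g) (\<epsilon> j)))"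
      obtain c where c: "c \<in> carrier_vec (length bs)"
        "\<pi> (path_mult (path_mult (\<epsilon> i) g) (\<epsilon> j)) = \<pi> (comb c)"
        using comb_spans[OF g] by blast
      show ?thesis unfolding f c(2) using c(1) by (rule imageI)
    qed
  qed
  show "?T (0\<^sub>v (length bs)) = zero ?W"
    using car by (auto simp: W comb_0 pi_0 restrict_def fun_eq_iff)
  fix c c' :: "'k vec" assume c: "c \<in> carrier_vec (length bs)"
  show "?T (c + c') = ?T c \<oplus>\<^bsub>?W\<^esub> ?T c'" if "c' \<in> carrier_vec (length bs)"
    using car pc that c
    by (auto simp: W comb_add comb_carrier pi.S.r_distr restrict_def fun_eq_iff simp flip: pi_add)
  fix a
  have "\<pi> (comb (a \<cdot>\<^sub>v c)) = brauer_scalar \<Gamma> a \<otimes>\<^bsub>A\<^esub> \<pi> (comb c)"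
    using c by (simp add: comb_smult brauer_scalar_def pi_mult carrier_scalar comb_carrier)
  then show "?T (a \<cdot>\<^sub>v c) = a \<odot>\<^bsub>?W\<^esub> ?T c"
    using car pc by (auto simp: W scalar_central restrict_def fun_eq_iff)
qed

end

lemma graded_hom_dim_eq: "graded_hom_dim k \<Gamma> s i j l = card (homog_basis i j l)"
proof -
  have "finite (homog_basis i j l)" using finite_basis by (simp add: homog_basis_def)
  then obtain bs where "distinct bs" "set bs = homog_basis i j l"
    using finite_distinct_list by blast
  then show ?thesis
    using dim_graded_hom[of bs] distinct_card[of bs] by (simp add: graded_hom_dim_def)
qed

end

end

section \<open>The Cartan matrix\<close>

context brauer
begin

section \<open>Counting the basis paths between two edges\<close>

lemma has_cycle_if_M_gt_1:
  assumes "u \<in> V" "M u > 1" shows "has_cycle \<Gamma> u"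
proof (rule ccontr)
  assume "\<not> has_cycle \<Gamma> u"
  then have "valency u < 2" "\<not> (u = x \<and> valency u = 1 \<and> m > 1)" using assms(1) by (auto simp: has_cycle_def valency_def mult)
  then have "valency u = 1" "mu u = 1" using valency_pos[OF assms(1)] m_pos by (auto simp: mu_def[OF assms(1)])
  then show False using assms(2) by (simp add: M_def[OF assms(1)])
qed

text \<open>If neither end had a cycle, both would be leaves and the tree a single edge; but then
  there is a loop from the exceptional vertex. Hence every edge has a full turn.\<close>

lemma edge_has_cycle:
  assumes "i \<in> E" shows "\<exists>u. has_cycle \<Gamma> u \<and> i \<in> E_at u"
proof (cases "e = 1")
  case True
  then have "E = {i}" using card_E assms by (metis card_1_singletonE singletonD)
  moreover have "s \<in> E" using s by (simp add: E_at_iff)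
  ultimately have "E_at x = {i}" using s by (auto simp: E_at_iff)
  then show ?thesis using x_in card_E True by (intro exI[of _ x]) (auto simp: has_cycle_def)
next
  case False
  obtain u v where i: "i = {u, v}" using edge_nonempty assms by blast
  note uv = edge_ends[OF assms[unfolded i]]
  show ?thesis
  proof (rule ccontr)
    assume no: "\<not> ?thesis"
    have single: "E_at w = {i}" if "w \<in> {u, v}" for w
    proof -
      have "w \<in> V" "i \<in> E_at w" using that uv i assms by (auto simp: E_at_iff)
      then have "\<not> card (E_at w) \<ge> 2" using no by (auto simp: has_cycle_def)
      then have "card (E_at w) \<le> Suc 0" by simp
      then have "\<forall>a\<in>E_at w. \<forall>b\<in>E_at w. a = b" by (simp only: card_le_Suc0_iff_eq[OF finite_E_at])
      then show ?thesis using \<open>i \<in> E_at w\<close> by blast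
    qed
    have only_i: "k = i" if "k \<in> E" "w \<in> k" "w \<in> {u, v}" for k w
    proof -
      have "k \<in> E_at w" using that by (simp add: E_at_iff)
      then show ?thesis unfolding single[OF that(3)] by simp
    qed
    have all: "w \<in> {u, v}" if "(u, w) \<in> adj\<^sup>*" for w
      using that
    proof (induction rule: rtrancl_induct)
      case (step y z)
      then have "{y, z} = i" using only_i[of "{y, z}" y] by auto
      then show ?case using i by auto
    qed simp
    have "k = i" if k: "k \<in> E" for k
    proof -
      obtain a b where ab: "k = {a, b}" using edge_nonempty[OF k] by blast
      then have "a \<in> V" using k edge_ends(1) by blast
      then have "a \<in> {u, v}" using all connected[OF uv(1)] by blast
      then show ?thesis using only_i[OF k, of a] ab by simp
    qed
    then have "E = {i}" using assms by blast
    then show False using card_E False by simp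
  qed
qed

text \<open>The trivial path and the full turn are listed apart because they are shared by both ends
  of an edge; every other nonzero path runs around exactly one vertex.\<close>

lemma basis_eq:
  assumes "i \<in> E" "j \<in> E"
  shows "basis i j =
    (if i = j then {(i, [], i), full_turn (chosen_end i) i} else {}) \<union>
    (\<lambda>(u, n). turn \<Gamma> u i n) ` (SIGMA u:i \<inter> j. {n. 0 < n \<and> n < M u \<and> (cw u ^^ n) i = j})"
    (is "_ = ?T \<union> ?A")
proof (intro equalityI subsetI)
  fix b assume b: "b \<in> basis i j"
  then obtain p where p: "b = (i, p, j)" "(i, p, j) \<in> qpaths Qv" "\<not> zero_path (i, p, j)"
    by (cases b) (auto simp: basis_def basis_path_def)
  from p(2,3) show "b \<in> ?T \<union> ?A"
  proof (cases rule: nonzero_path_cases)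
    case 1
    then show ?thesis using p by simp
  next
    case (2 u n)
    have t: "(cw u ^^ n) i = j" using 2 by (simp add: turn_def)
    have u: "u \<in> i \<inter> j"
      using cw_funpow_in[OF has_cycle_in[OF 2(1)] 2(2), of n] 2(2) unfolding t by (simp add: E_at_iff)
    show ?thesis
    proof (cases "n = M u")
      case True
      then have "b = full_turn u i" using 2 p by (simp add: full_turn_def)
      then have "u = chosen_end i" using b 2 by (auto simp: basis_def basis_path_def)
      moreover have "i = j" using full_turn_target[OF has_cycle_in[OF 2(1)] 2(2)] t True by simp
      ultimately show ?thesis using \<open>b = full_turn u i\<close> by simp
    next
      case False
      then have "(u, n) \<in> (SIGMA u:i \<inter> j. {n. 0 < n \<and> n < M u \<and> (cw u ^^ n) i = j})"
        using 2 t u by simp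
      then have "b \<in> ?A" by (rule rev_image_eqI) (simp add: 2(5) p(1))
      then show ?thesis by (rule UnI2)
    qed
  qed
next
  fix b assume "b \<in> ?T \<union> ?A"
  then consider "i = j" "b = (i, [], i)" | "i = j" "b = full_turn (chosen_end i) i" |
    u n where "u \<in> i \<inter> j" "0 < n" "n < M u" "(cw u ^^ n) i = j" "b = turn \<Gamma> u i n"
    by (auto split: if_splits)
  then show "b \<in> basis i j"
  proof cases
    case 1
    have "(i, [], i) \<noteq> full_turn u k" if "has_cycle \<Gamma> u" for u k
      using M_pos[OF has_cycle_in[OF that]] by (auto simp: full_turn_def turn_def)
    then show ?thesis using 1 assms
      by (auto simp: basis_def basis_path_def qpaths_iff pre_digraph.cas.simps zero_path_def)
  next
    case 2
    obtain u where u: "has_cycle \<Gamma> u" "i \<in> E_at u" using edge_has_cycle[OF assms(1)] by blast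
    show ?thesis
      using 2 basis_path_full_turn[OF u] full_turn_eq[OF chosen_end[OF u]] by (simp add: basis_def)
  next
    case (3 u n)
    have "i \<in> E_at u" "u \<in> V" using 3(1) assms by (auto simp: E_at_iff elim: edgeE)
    then have cyc: "has_cycle \<Gamma> u" using has_cycle_if_M_gt_1 3 by auto
    have "turn \<Gamma> u i n \<noteq> full_turn v k" for v k
      using turn_inj[of u i n v k "M v"] 3(2,3) by (auto simp: full_turn_def)
    then have "basis_path b"
      using turn_in_qpaths[OF cyc \<open>i \<in> E_at u\<close>] nonzero_turn[of n u i] 3 by (simp add: basis_path_def)
    then show ?thesis using 3 by (simp add: basis_def turn_def)
  qed
qed

text \<open>On the diagonal the sums over the two ends count the trivial path twice and the full
  turn never, whereas the basis contains each once. The correction 1 + q^(me) - 2 is the diagonal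
  summand \<open>b\<close> of the tree matrix.\<close>

lemma basis_sum:
  assumes "i \<in> E" "j \<in> E"
  shows "(\<Sum>b\<in>basis i j. q_pow (path_degree \<Gamma> s b)) =
    (\<Sum>u\<in>i \<inter> j. \<Sum>n | n < M u \<and> (cw u ^^ n) i = j. q_pow (path_degree \<Gamma> s (turn \<Gamma> u i n)))
    + (if i = j then q_pow (int (m * e)) - 1 else 0)"
proof -
  let ?f = "\<lambda>b. q_pow (path_degree \<Gamma> s b)"
  let ?N = "\<lambda>u. {n. 0 < n \<and> n < M u \<and> (cw u ^^ n) i = j}"
  let ?A = "(\<lambda>(u, n). turn \<Gamma> u i n) ` (SIGMA u:i \<inter> j. ?N u)"
  let ?T = "if i = j then {(i, [], i), full_turn (chosen_end i) i} else {}"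
  obtain a b where ab: "i = {a, b}" using edge_nonempty assms(1) by blast
  note ends = edge_ends[OF assms(1)[unfolded ab]]
  have fin: "finite (i \<inter> j)" by (simp add: ab)
  obtain w where w: "has_cycle \<Gamma> w" "i \<in> E_at w" using edge_has_cycle[OF assms(1)] by blast
  note ch = chosen_end[OF w]
  have inj: "inj_on (\<lambda>(u, n). turn \<Gamma> u i n) (SIGMA u:i \<inter> j. ?N u)"
    by (rule inj_onI) (auto dest: turn_inj)
  have disj: "?T \<inter> ?A = {}"
  proof -
    have "turn \<Gamma> u i n \<noteq> full_turn v k" if "n < M u" "0 < n" for u n v k
      using turn_inj[of u i n v k "M v"] that by (auto simp: full_turn_def)
    moreover have "turn \<Gamma> u i n \<noteq> (i, [], i)" if "0 < n" for u n
      using that by (auto simp: turn_def)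
    ultimately show ?thesis by auto metis+
  qed
  have G: "(\<Sum>n | n < M u \<and> (cw u ^^ n) i = j. ?f (turn \<Gamma> u i n))
      = (if i = j then 1 else 0) + (\<Sum>n\<in>?N u. ?f (turn \<Gamma> u i n))" if "u \<in> V" for u
  proof -
    have eq: "{n. n < M u \<and> (cw u ^^ n) i = j} = (if i = j then {0} else {}) \<union> ?N u"
      using M_pos[OF that] by (auto intro: gr0I)
    have "?f (turn \<Gamma> u i 0) = 1" by (simp add: turn_def path_degree_def)
    then show ?thesis unfolding eq by (subst sum.union_disjoint) auto
  qed
  have "(\<Sum>b\<in>basis i j. ?f b) = (\<Sum>b\<in>?T. ?f b) + (\<Sum>b\<in>?A. ?f b)"
    unfolding basis_eq[OF assms] by (rule sum.union_disjoint) (use disj fin in auto)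
  also have "(\<Sum>b\<in>?A. ?f b) = (\<Sum>u\<in>i \<inter> j. \<Sum>n\<in>?N u. ?f (turn \<Gamma> u i n))"
    unfolding sum.reindex[OF inj] using fin
    by (subst sum.Sigma) (auto simp: o_def case_prod_unfold)
  also have "\<dots> = (\<Sum>u\<in>i \<inter> j. (\<Sum>n | n < M u \<and> (cw u ^^ n) i = j. ?f (turn \<Gamma> u i n)) - (if i = j then 1 else 0))"
  proof (rule sum.cong[OF refl])
    fix u assume "u \<in> i \<inter> j"
    then have "u \<in> V" using ends ab by auto
    show "(\<Sum>n\<in>?N u. ?f (turn \<Gamma> u i n))
      = (\<Sum>n | n < M u \<and> (cw u ^^ n) i = j. ?f (turn \<Gamma> u i n)) - (if i = j then 1 else 0)"
      unfolding G[OF \<open>u \<in> V\<close>] by simp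
  qed
  also have "\<dots> = (\<Sum>u\<in>i \<inter> j. \<Sum>n | n < M u \<and> (cw u ^^ n) i = j. ?f (turn \<Gamma> u i n)) - (if i = j then 2 else 0)"
  proof -
    have "card (i \<inter> i) = 2" using ends by (simp add: ab)
    then show ?thesis by (auto simp: sum_subtractf)
  qed
  also have "(\<Sum>b\<in>?T. ?f b) = (if i = j then 1 + q_pow (int (m * e)) else 0)"
  proof -
    have "(i, [], i) \<noteq> full_turn (chosen_end i) i"
      using M_pos[OF has_cycle_in[OF ch(1)]] by (auto simp: full_turn_def turn_def)
    moreover have "?f (i, [], i) = 1" by (simp add: path_degree_def)
    moreover have "?f (full_turn (chosen_end i) i) = q_pow (int (m * e))"
      unfolding full_turn_def using full_turn_degree[OF has_cycle_in[OF ch(1)] ch(2)] by simp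
    ultimately show ?thesis by auto
  qed
  finally show ?thesis by simp
qed

abbreviation socle_gap :: laurent where "socle_gap \<equiv> q_pow (int (m * e)) - 1"

lemma basis_sum_weights:
  assumes "i \<in> E" "j \<in> E"
  shows "(\<Sum>b\<in>basis i j. q_pow (path_degree \<Gamma> s b)) =
    (\<Sum>u\<in>i \<inter> j. weight u 1 i * weight u (- 1) j * (vertex_sum u + (if N i < N j then socle_gap else 0)))
    + (if i = j then socle_gap else 0)"
  unfolding basis_sum[OF assms]
  by (intro arg_cong2[where f = "(+)"] refl sum.cong turns_sum)
    (use assms in \<open>auto simp: E_at_iff elim: edgeE\<close>)

section \<open>Building up the tree in the order of Green's numbers\<close>

abbreviation nth_edge :: "nat \<Rightarrow> 'v set" where "nth_edge i \<equiv> green_edge \<Gamma> s (Suc i)"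

definition far_end :: "nat \<Rightarrow> 'v" where
  "far_end i = (SOME v. v \<in> V \<and> v \<noteq> x \<and> nth_edge i = par_edge v)"

lemma far_end:
  assumes "i < e"
  shows "far_end i \<in> V" "far_end i \<noteq> x" "nth_edge i = par_edge (far_end i)"
proof -
  have "\<exists>v. v \<in> V \<and> v \<noteq> x \<and> nth_edge i = par_edge v"
    using edge_is_par_edge[OF green_edge_in[OF assms]] by blast
  from someI_ex[OF this] show "far_end i \<in> V" "far_end i \<noteq> x" "nth_edge i = par_edge (far_end i)"
    by (simp_all add: far_end_def)
qed

lemma par_edge_index:
  assumes "v \<in> V" "v \<noteq> x"
  obtains i where "i < e" "nth_edge i = par_edge v" "N (par_edge v) = Suc i"
proof -
  have p: "par_edge v \<in> E" using par_edge_in assms by blast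
  then have "N (par_edge v) \<in> {1..e}" using green_number_bij by (auto simp: bij_betw_def)
  then obtain i where "N (par_edge v) = Suc i" "i < e" by (cases "N (par_edge v)") auto
  then show thesis using that green_edge_number[OF p] by simp
qed

text \<open>At each vertex the first edge has the smallest number. Applied to the near end of an
  edge, this puts the parent edge of that end earlier; applied to the far end, it shows that no
  earlier edge contains the far end.\<close>

lemma edges_attach:
  assumes "i < e"
  shows "nth_edge i = {par (far_end i), far_end i}"
    and "par (far_end i) \<in> insert x (\<Union>k<i. nth_edge k)"
    and "far_end i \<notin> insert x (\<Union>k<i. nth_edge k)"
proof -
  note v = far_end[OF assms]
  let ?v = "far_end i" and ?u = "par (far_end i)"
  show "nth_edge i = {?u, ?v}" using v by (simp add: par_edge_def)
  show "?u \<in> insert x (\<Union>k<i. nth_edge k)"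
  proof (cases "?u = x")
    case False
    have uV: "?u \<in> V" using par_in v by blast
    obtain k where k: "k < e" "nth_edge k = par_edge ?u" "N (par_edge ?u) = Suc k"
      using par_edge_index[OF uV False] by blast
    have "nth_edge i \<in> E_at ?u" using v green_edge_in[OF assms] by (simp add: E_at_iff par_edge_def)
    then have "N (par_edge ?u) \<le> N (nth_edge i)"
      using green_number_first_edge[OF uV] False by (simp add: first_edge_def)
    moreover have "par_edge ?u \<noteq> nth_edge i"
      using par_edge_inj[OF uV False v(1,2)] Suc_d_par[OF v(1,2)] v(3) by auto
    ultimately have "k < i"
      using green_number_edge[OF assms] k by (metis Suc_le_mono le_neq_implies_less)
    then show ?thesis using k(2) by (auto simp: par_edge_def)
  qed simp
  show "?v \<notin> insert x (\<Union>k<i. nth_edge k)"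
  proof
    assume "?v \<in> insert x (\<Union>k<i. nth_edge k)"
    then obtain k where k: "k < i" "?v \<in> nth_edge k" using v(2) by auto
    then have "nth_edge k \<in> E_at ?v" using green_edge_in[of k] assms by (simp add: E_at_iff)
    then have "N (nth_edge i) \<le> N (nth_edge k)"
      using green_number_first_edge[OF v(1)] v by (simp add: first_edge_def)
    then show False using green_number_edge[of k] green_number_edge[OF assms] k assms by simp
  qed
qed

lemma vertices_eq: "insert x (\<Union>k<e. nth_edge k) = V"
proof (intro equalityI subsetI)
  fix v assume v: "v \<in> V"
  show "v \<in> insert x (\<Union>k<e. nth_edge k)"
  proof (cases "v = x")
    case False
    then obtain i where "i < e" "nth_edge i = par_edge v" using par_edge_index[OF v] by metis
    then show ?thesis by (auto simp: par_edge_def)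
  qed simp
qed (use x_in green_edge_in in \<open>auto elim: edgeE\<close>)

lemma card_V: "card (V - {x}) = e"
proof -
  have "bij_betw par_edge (V - {x}) E"
    using par_edge_inj par_edge_in edge_is_par_edge
    by (auto simp: bij_betw_def intro!: inj_onI) (metis DiffI image_eqI singletonD)
  then show ?thesis using bij_betw_same_card card_E by metis
qed

lemma q_pow_neq_1: "k \<noteq> 0 \<Longrightarrow> q_pow k \<noteq> 1"
proof
  assume "k \<noteq> 0" "q_pow k = 1"
  then have "Poly_Mapping.lookup (q_pow k) k = Poly_Mapping.lookup (1 :: laurent) k" by simp
  then show False using \<open>k \<noteq> 0\<close> by (simp add: q_pow_def lookup_one when_def)
qed

lemma det_cartan_matrix:
  "Determinant.det (tree_matrix nth_edge (\<lambda>z i. weight z 1 (nth_edge i)) (\<lambda>z i. weight z (- 1) (nth_edge i)) socle_gap vertex_sum e)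
    = (\<Sum>n = 0..m * e. laurent_q ^ (e * n))" (is "?D = ?S")
proof -
  let ?q = "q_pow (int e)" and ?a = "q_pow (int (m * e))"
  have weight: "weight z 1 (nth_edge i) * weight z (- 1) (nth_edge i) = 1" if "i < e" "z \<in> nth_edge i" for i z
    by (rule weight_inverse) (rule edgeE[OF green_edge_in[OF that(1)] that(2)])
  have "socle_gap * ?D = (\<Prod>z\<in>V. vertex_sum z + socle_gap) - (\<Prod>z\<in>V. vertex_sum z)"
    unfolding vertices_eq[symmetric]
  proof (rule det_tree_matrix)
    fix i assume i: "i < e"
    show "nth_edge i = {par (far_end i), far_end i}" "par (far_end i) \<in> insert x (\<Union>k<i. nth_edge k)"
      "far_end i \<notin> insert x (\<Union>k<i. nth_edge k)"
      by (rule edges_attach[OF i])+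
  qed (rule weight)
  also have "\<dots> = (vertex_sum x + socle_gap) * ?a ^ e - vertex_sum x"
  proof -
    \<comment> \<open>Each of the e vertices other than \<open>x\<close> contributes q^(me) to the
      first product and 1 to the second.\<close>
    have "vertex_sum z = 1" if "z \<in> V - {x}" for z
      using that by (simp add: vertex_sum_def[of z] mu_def[of z])
    then show ?thesis
      by (simp add: prod.remove[OF finite_V x_in] card_V)
  qed
  finally have D: "socle_gap * ?D = (vertex_sum x + socle_gap) * ?a ^ e - vertex_sum x" .
  have Q: "vertex_sum x * ?q = vertex_sum x + socle_gap"
    using vertex_sum_Q[OF x_in] by (simp add: Q_def[OF x_in])
  have "?S = (\<Sum>n<Suc (m * e). ?q ^ n)"
    unfolding atLeast0AtMost lessThan_Suc_atMost
    by (rule sum.cong) (simp_all add: laurent_q_def q_pow_def[symmetric] power_mult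
        q_pow_mult_nat[of 1 e, simplified])
  then have "(?q - 1) * ?S = ?q ^ Suc (m * e) - 1"
    by (simp only: power_diff_1_eq)
  also have "\<dots> = ?q * ?a ^ e - 1"
    by (simp add: q_pow_mult_nat[symmetric] mult.commute flip: q_pow_mult_nat of_nat_mult)
  finally have S: "(?q - 1) * ?S = ?q * ?a ^ e - 1" .
  \<comment> \<open>The determinant is known up to the factor \<open>socle_gap\<close> and the
    geometric sum up to q^e - 1, so both are compared after multiplying by the product of these
    nonzero factors.\<close>
  have "((?q - 1) * socle_gap) * ?D = (?q - 1) * ((vertex_sum x + socle_gap) * ?a ^ e - vertex_sum x)"
    by (simp only: mult.assoc D)
  also have "\<dots> = (vertex_sum x * ?q - vertex_sum x) * ?a ^ e + (?q - 1) * socle_gap * ?a ^ e - (vertex_sum x * ?q - vertex_sum x)"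
    by (simp add: algebra_simps)
  also have "vertex_sum x * ?q - vertex_sum x = socle_gap" by (simp only: Q) simp
  also have "socle_gap * ?a ^ e + (?q - 1) * socle_gap * ?a ^ e - socle_gap = socle_gap * (?q * ?a ^ e - 1)"
    by (simp add: algebra_simps)
  also have "\<dots> = ((?q - 1) * socle_gap) * ?S"
    unfolding S[symmetric] by (simp only: ac_simps)
  finally show ?thesis
    using q_pow_neq_1[of "int e"] q_pow_neq_1[of "int (m * e)"] m_pos e_pos by simp
qed

end

context brauer_over
begin

text \<open>Only the finitely many degrees of basis paths contribute to the sum over all integers,
  and the dimension in degree l counts the basis paths of that degree.\<close>

lemma cartan_entry:
  assumes "i \<in> E" "j \<in> E"
  shows "Sum_any (\<lambda>l. Poly_Mapping.single l (int (graded_hom_dim k \<Gamma> s i j l)))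
    = (\<Sum>b\<in>basis i j. q_pow (path_degree \<Gamma> s b))"
proof -
  let ?L = "path_degree \<Gamma> s ` basis i j"
  have dim: "graded_hom_dim k \<Gamma> s i j l = card {b \<in> basis i j. path_degree \<Gamma> s b = l}" for l
    using graded_hom_dim_eq[OF assms] by (simp add: homog_basis_def)
  have "Sum_any (\<lambda>l. Poly_Mapping.single l (int (graded_hom_dim k \<Gamma> s i j l)))
    = (\<Sum>l\<in>?L. Poly_Mapping.single l (int (graded_hom_dim k \<Gamma> s i j l)))"
  proof (rule Sum_any.expand_superset)
    have "graded_hom_dim k \<Gamma> s i j l = 0" if "l \<notin> ?L" for l
    proof -
      have empty: "{b \<in> basis i j. path_degree \<Gamma> s b = l} = {}" using that by blast
      show ?thesis unfolding dim empty by simp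
    qed
    then show "{l. Poly_Mapping.single l (int (graded_hom_dim k \<Gamma> s i j l)) \<noteq> 0} \<subseteq> ?L"
      by (auto, metis of_nat_0 single_zero)
  qed (simp add: finite_basis)
  also have "\<dots> = (\<Sum>l\<in>?L. \<Sum>b | b \<in> basis i j \<and> path_degree \<Gamma> s b = l. q_pow (path_degree \<Gamma> s b))"
  proof (rule sum.cong[OF refl])
    fix l
    have "(of_nat c :: laurent) * q_pow l = Poly_Mapping.single l (int c)" for c
      by (induction c) (simp_all add: q_pow_def algebra_simps flip: single_add)
    then show "Poly_Mapping.single l (int (graded_hom_dim k \<Gamma> s i j l))
      = (\<Sum>b | b \<in> basis i j \<and> path_degree \<Gamma> s b = l. q_pow (path_degree \<Gamma> s b))"
      unfolding dim by simp
  qed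
  also have "\<dots> = (\<Sum>b\<in>basis i j. q_pow (path_degree \<Gamma> s b))"
    by (rule sum.image_gen[OF finite_basis, symmetric])
  finally show ?thesis .
qed

lemma graded_cartan_eq:
  "graded_cartan k \<Gamma> s
    = tree_matrix nth_edge (\<lambda>z i. weight z 1 (nth_edge i)) (\<lambda>z i. weight z (- 1) (nth_edge i)) socle_gap vertex_sum e"
proof (rule eq_matI, goal_cases)
  case (1 i j)
  then have ij: "i < e" "j < e" by (simp_all add: tree_matrix_def)
  \<comment> \<open>Edge number i + 1 belongs to matrix index i, so comparing Green's numbers is the
    same as comparing indices.\<close>
  have "nth_edge i = nth_edge j \<longleftrightarrow> i = j" using green_number_edge ij by (metis Suc_inject)
  then show ?case
    using ij cartan_entry[OF green_edge_in green_edge_in, of i j]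
      basis_sum_weights[OF green_edge_in green_edge_in, of i j] green_number_edge
    by (simp add: graded_cartan_def tree_matrix_def card_E Let_def)
qed (simp_all add: graded_cartan_def tree_matrix_def card_E Let_def)

end

theorem proposition7p1:
  fixes \<Gamma> :: "'v brauer_tree" and s :: "'v set" and m e :: nat
  assumes "CHAR('k::alg_closed_field) > 0"
    and "is_brauer_tree \<Gamma> m e"
    and "s \<in> edges_at \<Gamma> (bt_exc \<Gamma>)"
  shows "Determinant.det (graded_cartan TYPE('k) \<Gamma> s) = (\<Sum>n = 0..m * e. laurent_q ^ (e * n))"
proof -
  interpret brauer_over \<Gamma> s m e "TYPE('k)"
    by unfold_locales (rule assms)+
  show ?thesis unfolding graded_cartan_eq by (rule det_cartan_matrix)
qed

end
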